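(* Let $R$ be a skew-invertible Hecke symmetry over $\mathbb{C}[[h]]$, $\overline R(x)$ the associated $R$-matrix with multiplicative spectral parameter and $\mathbf{Y}^+_{RTT}(\overline R)$ the associated algebra with unit $1$ (all defined in the context). For any $c\in\mathbb{C}$ there exists a unique formal power series $\overline T^-(x)$ in $\mathrm{End}\,\mathbb{C}^N\otimes\mathrm{Hom}(\mathbf{Y}^+_{RTT}(\overline R),\mathbf{Y}^+_{RTT}(\overline R)[x^{-1}]_h)$ satisfying $\overline T^-(x)1=I\otimes1$ and such that for all integers $n\geqslant1$ and variables $y=(y_1,\dots,y_n)$ \begin{align*} \overline T^{-}_0(x)\,\overline T_{[n]}^{+}(y)={}&\overline R_{10}(y_1e^{hc/a}/x)\cdots\overline R_{n0}(y_ne^{hc/a}/x)\\ &\times\overline T_{[n]}^{+}(y)\,\overline R_{n0}(y_ne^{-hc/a}/x)^{-1}\cdots\overline R_{10}(y_1e^{-hc/a}/x)^{-1}. \end{align*} The series $\overline T^-(x)$ is invertible in $\mathrm{End}\,\mathbb{C}^N\otimes\mathrm{Hom}(\mathbf{Y}^+_{RTT}(\overline R),\mathbf{Y}^+_{RTT}(\overline R)[x^{-1}]_h)$ and it satisfies the following identities for operators on $\mathbf{Y}^+_{RTT}(\overline R)$: \begin{align*} \overline R_{12}(x/y)\,\overline T_1^-(x)\,\overline T_2^-(y)&=\overline T_2^-(y)\,\overline T_1^-(x)\,\overline R_{12}(x/y),\\ \overline T_1^-(x)\,\overline T_2^+(y)\,\overline R_{21}(ye^{-hc/a}/x)&=\overline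 R_{21}(ye^{hc/a}/x)\,\overline T_2^+(y)\,\overline T_1^-(x). \end{align*}
   Context: Hecke symmetries. $N\geqslant 2$ is an integer, $h$ a formal parameter, $P=\sum_{i,j}e_{ij}\otimes e_{ji}$ and $I$ (identity) on $\mathbb{C}^N\otimes\mathbb{C}^N$ ($I$ also denotes the identity matrix in $\mathrm{End}\,\mathbb{C}^N$). For $A\in(\mathrm{End}\,\mathbb{C}^N)^{\otimes 2}$ (with any coefficients), $A_{rs}$ denotes $A$ acting on tensor factors $r$ and $s$ (first leg in factor $r$, second leg in factor $s$); e.g. $A_{21}=PA_{12}P$. A Hecke symmetry is $R\in(\mathrm{End}\,\mathbb{C}^N)^{\otimes 2}[[h]]$ with $R_{12}R_{23}R_{12}=R_{23}R_{12}R_{23}$ and $(R-e^hI)(R+e^{-h}I)=0$; it is skew-invertible if there is $\Psi\in(\mathrm{End}\,\mathbb{C}^N)^{\otimes 2}[[h]]$ with $\mathrm{tr}_2R_{12}\Psi_{23}=P_{13}=\mathrm{tr}_2\Psi_{12}R_{23}$. Multiplicative $R$-matrix. Fix an integer $M>0$ and $0\ne a\in\mathbb{C}$. Let $\overline g(x)\in 1+x\mathbb{C}[[x,h]]$ be the unique series with $\prod_{k=0}^{M-1}\overline g(xe^{-2kh})=\frac{1-xe^{-2(M-1)h}}{1-x}$, let $\overline f(x)=\frac{1-x}{1-xe^{-2h}}\,\overline g(x)$, and $\overline R(x)=\overline f(x)\big(PR+\frac{(e^h-e^{-h})x}{1-x}P\big)\in(\mathrm{End}\,\mathbb{C}^N)^{\otimes2}[[x,h]]$;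 all expansions are in nonnegative powers of $x$, so $\overline R(x/y)$ is a series in nonnegative powers of $x/y$, etc. Modules. For a $\mathbb{C}[[h]]$-module $V$, $V[x^{-1}]_h$ is the set of $\sum_{r\leqslant0}a_rx^r$, $a_r\in V$, with $a_r\to0$ $h$-adically as $r\to-\infty$. Tensor products of $\mathbb{C}[[h]]$-modules are $h$-adically completed. Algebra. $\mathbf{Y}^+_{RTT}(\overline R)$ is the topologically free associative unital $\mathbb{C}[[h]]$-algebra generated by $\overline t_{ij}^{(-r)}$ ($1\leqslant i,j\leqslant N$, $r\geqslant1$) subject to $\overline R(x/y)\overline T_1^+(x)\overline T_2^+(y)=\overline T_2^+(y)\overline T_1^+(x)\overline R(x/y)$, where $\overline T^+(x)=\sum_{i,j}e_{ij}\otimes\sum_{r\geqslant1}\overline t_{ij}^{(-r)}x^{r-1}$, and a subscript $k$ indicates that the matrix part sits in the $k$-th copy of $\mathrm{End}\,\mathbb{C}^N$. (Topologically free: the quotient of the $h$-adically completed free algebra by the smallest $h$-adically closed two-sided ideal $J$ containing the relations and such that $ha\in J$ implies $a\in J$.) Notation. $\overline T_{[n]}^+(y)=\overline T_1^+(y_1)\cdots\overline T_n^+(y_n)$. In the formula defining $\overline T^-$, copies of $\mathrm{End}\,\mathbb{C}^N$ are labelled $0,1,\dots,n$ and $\overline T^+_{[n]}(y)$ (in copies $1,\dots,n$) is regarded as a series of elements of $\mathbf{Y}^+_{RTT}(\overline R)$; in the operator identities $\overline T^+$ acts by left multiplication. *)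

theory Defs
  imports
    "HOL-Analysis.Analysis"
    "HOL-Computational_Algebra.Formal_Power_Series"
    "HOL-Library.Poly_Mapping"
    "HOL-Library.FuncSet"
    "HOL-Algebra.Module"
    "HOL-Algebra.QuotRing"
    "HOL-Algebra.Algebraic_Closure_Type"
begin

unbundle no fps_syntax

text \<open>
  The ring \<open>\<complex>[[h]]\<close> is \<^typ>\<open>complex fps\<close> and \<open>\<complex>[[x,h]]\<close> is \<^typ>\<open>complex fps fps\<close>, with \<open>x\<close> the outer
  variable. The dimension \<open>N\<close> is \<open>CARD('n)\<close>. An element \<open>A\<close> of \<open>(End \<complex>\<^sup>N)\<^bsup>\<otimes>2\<^esup>\<close> is a matrix indexed
  by pairs: \<open>A $ (i, k) $ (j, l)\<close> is the coefficient of \<open>e\<^sub>i\<^sub>j \<otimes> e\<^sub>k\<^sub>l\<close>.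
\<close>

section \<open>Hecke symmetries\<close>

definition flip :: "'a::zero_neq_one ^ ('n::finite \<times> 'n) ^ ('n \<times> 'n)" where
  "flip = (\<chi> r s. if fst r = snd s \<and> snd r = fst s then 1 else 0)"

definition legs12 :: "'a::zero ^ ('n::finite \<times> 'n) ^ ('n \<times> 'n) \<Rightarrow> 'a ^ ('n \<times> 'n \<times> 'n) ^ ('n \<times> 'n \<times> 'n)" where
  "legs12 A = (\<chi> r s. case (r, s) of ((i1, i2, i3), (j1, j2, j3)) \<Rightarrow>
     if i3 = j3 then A $ (i1, i2) $ (j1, j2) else 0)"

definition legs23 :: "'a::zero ^ ('n::finite \<times> 'n) ^ ('n \<times> 'n) \<Rightarrow> 'a ^ ('n \<times> 'n \<times> 'n) ^ ('n \<times> 'n \<times> 'n)" where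
  "legs23 A = (\<chi> r s. case (r, s) of ((i1, i2, i3), (j1, j2, j3)) \<Rightarrow>
     if i1 = j1 then A $ (i2, i3) $ (j2, j3) else 0)"

text \<open>The partial trace over the second of three factors; the result lives in factors 1 and 3.\<close>

definition trace2 :: "'a::comm_monoid_add ^ ('n::finite \<times> 'n \<times> 'n) ^ ('n \<times> 'n \<times> 'n) \<Rightarrow> 'a ^ ('n \<times> 'n) ^ ('n \<times> 'n)" where
  "trace2 A = (\<chi> r s. \<Sum>k\<in>UNIV. A $ (fst r, k, snd r) $ (fst s, k, snd s))"

definition hecke_symmetry :: "complex fps ^ ('n::finite \<times> 'n) ^ ('n \<times> 'n) \<Rightarrow> bool" where
  "hecke_symmetry R \<longleftrightarrow>
     legs12 R ** legs23 R ** legs12 R = legs23 R ** legs12 R ** legs23 R \<and>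
     (R - mat (fps_exp 1)) ** (R + mat (fps_exp (-1))) = 0"

definition skew_invertible :: "complex fps ^ ('n::finite \<times> 'n) ^ ('n \<times> 'n) \<Rightarrow> bool" where
  "skew_invertible R \<longleftrightarrow>
     (\<exists>\<Psi>. trace2 (legs12 R ** legs23 \<Psi>) = flip \<and> trace2 (legs12 \<Psi> ** legs23 R) = flip)"

section \<open>The R-matrix with multiplicative spectral parameter\<close>

definition gbar :: "nat \<Rightarrow> complex fps fps" where
  "gbar M = (THE g. fps_nth g 0 = 1 \<and>
     (\<Prod>k<M. fps_compose g (fps_const (fps_exp (- 2 * of_nat k)) * fps_X)) =
     (1 - fps_const (fps_exp (- 2 * (of_nat M - 1))) * fps_X) * inverse (1 - fps_X))"

definition fbar :: "nat \<Rightarrow> complex fps fps" where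
  "fbar M = (1 - fps_X) * inverse (1 - fps_const (fps_exp (- 2)) * fps_X) * gbar M"

definition Rbar :: "nat \<Rightarrow> complex fps ^ ('n::finite \<times> 'n) ^ ('n \<times> 'n) \<Rightarrow> complex fps fps ^ ('n \<times> 'n) ^ ('n \<times> 'n)" where
  "Rbar M R = (\<chi> r s. fbar M *
     (fps_const ((flip ** R) $ r $ s) +
      fps_const (fps_exp 1 - fps_exp (-1)) * fps_X * inverse (1 - fps_X) * fps_const (flip $ r $ s)))"

section \<open>The algebra\<close>

text \<open>Words form the free monoid, written additively so that finitely supported functions on words
  carry the convolution product.\<close>

datatype 'g gword = GWord "'g list"

instantiation gword :: (type) monoid_add
begin

definition zero_gword :: "'a gword" where "zero_gword = GWord []"

fun plus_gword :: "'a gword \<Rightarrow> 'a gword \<Rightarrow> 'a gword" where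
  "plus_gword (GWord u) (GWord v) = GWord (u @ v)"

instance
proof
  fix a b c :: "'a gword"
  show "a + b + c = a + (b + c)" by (cases a; cases b; cases c) simp
  show "0 + a = a" "a + 0 = a" by (cases a; simp add: zero_gword_def)+
qed

end

text \<open>The \<open>h\<close>-adic completion of the free \<open>\<complex>[[h]]\<close>-algebra is the ring of power series in \<open>h\<close> over the
  free \<open>\<complex>\<close>-algebra; \<^const>\<open>fps_X\<close> is \<open>h\<close>, and the metric topology of \<^type>\<open>fps\<close> is the \<open>h\<close>-adic one.
  The generator \<open>t\<^sub>i\<^sub>j\<^bsup>(-r)\<^esup>\<close>, \<open>r \<ge> 1\<close>, is represented by the triple \<open>(i, j, r - 1)\<close>.\<close>

type_synonym 'n falg = "(('n \<times> 'n \<times> nat) gword \<Rightarrow>\<^sub>0 complex) fps"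

definition scal :: "complex fps \<Rightarrow> 'n falg" where
  "scal s = Abs_fps (\<lambda>k. Poly_Mapping.single 0 (fps_nth s k))"

text \<open>\<open>tplus i j s\<close> is the coefficient of \<open>x\<^sup>s\<close> in the entry \<open>(i, j)\<close> of \<open>T\<^sup>+(x)\<close>, for any integer \<open>s\<close>.\<close>

definition tplus :: "'n \<Rightarrow> 'n \<Rightarrow> int \<Rightarrow> 'n falg" where
  "tplus i j s = (if s \<ge> 0 then fps_const (Poly_Mapping.single (GWord [(i, j, nat s)]) 1) else 0)"

text \<open>The coefficient of \<open>x\<^sup>p y\<^sup>q\<close> in the entry \<open>((i, k), (j, l))\<close> of
  \<open>B(x/y) T\<^sub>1\<^sup>+(x) T\<^sub>2\<^sup>+(y) - T\<^sub>2\<^sup>+(y) T\<^sub>1\<^sup>+(x) B(x/y)\<close>. Only powers \<open>(x/y)\<^sup>m\<close> with \<open>m \<le> p\<close> contribute,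
  and all coefficients with \<open>p < 0\<close> vanish.\<close>

definition rtt_relator ::
  "complex fps fps ^ ('n::finite \<times> 'n) ^ ('n \<times> 'n) \<Rightarrow> 'n \<Rightarrow> 'n \<Rightarrow> 'n \<Rightarrow> 'n \<Rightarrow> nat \<Rightarrow> int \<Rightarrow> 'n falg" where
  "rtt_relator B i k j l p q =
     (\<Sum>m\<le>p. \<Sum>a\<in>UNIV. \<Sum>b\<in>UNIV.
        scal (fps_nth (B $ (i, k) $ (a, b)) m) * tplus a j (int p - int m) * tplus b l (q + int m)) -
     (\<Sum>m\<le>p. \<Sum>a\<in>UNIV. \<Sum>b\<in>UNIV.
        tplus k b (q + int m) * tplus i a (int p - int m) * scal (fps_nth (B $ (a, b) $ (j, l)) m))"

definition rtt_ideal :: "complex fps fps ^ ('n::finite \<times> 'n) ^ ('n \<times> 'n) \<Rightarrow> 'n falg set" where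
  "rtt_ideal B = \<Inter> {J. ideal J ring_of_type_algebra \<and>
     (\<forall>i k j l p q. rtt_relator B i k j l p q \<in> J) \<and>
     closed J \<and> (\<forall>a. fps_X * a \<in> J \<longrightarrow> a \<in> J)}"

definition rtt_class ::
  "complex fps fps ^ ('n::finite \<times> 'n) ^ ('n \<times> 'n) \<Rightarrow> 'n falg \<Rightarrow> 'n falg set" where
  "rtt_class B v = rtt_ideal B +>\<^bsub>ring_of_type_algebra\<^esub> v"

definition Y_RTT ::
  "complex fps fps ^ ('n::finite \<times> 'n) ^ ('n \<times> 'n) \<Rightarrow> (complex fps, 'n falg set) module" where
  "Y_RTT B = (let Q = ring_of_type_algebra Quot rtt_ideal B in
     \<lparr>carrier = carrier Q, mult = mult Q, one = one Q, zero = zero Q, add = add Q,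
      smult = (\<lambda>s v. rtt_class B (scal s) \<otimes>\<^bsub>Q\<^esub> v)\<rparr>)"

section \<open>Operator series\<close>

text \<open>The elements \<open>\<Sum>\<^bsub>r\<ge>0\<^esub> f(r) x\<^bsup>-r\<^esup>\<close> of \<open>V[x\<^bsup>-1\<^esup>]\<^sub>h\<close>, and the \<open>\<complex>[[h]]\<close>-linear maps \<open>V \<rightarrow> V[x\<^bsup>-1\<^esup>]\<^sub>h\<close>.\<close>

definition xinv_series :: "(complex fps, 'v) module \<Rightarrow> (nat \<Rightarrow> 'v) set" where
  "xinv_series V = {f. (\<forall>r. f r \<in> carrier V) \<and>
     (\<forall>k. \<exists>r0. \<forall>r\<ge>r0. \<exists>w\<in>carrier V. f r = fps_X ^ k \<odot>\<^bsub>V\<^esub> w)}"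

definition xinv_hom :: "(complex fps, 'v) module \<Rightarrow> ('v \<Rightarrow> nat \<Rightarrow> 'v) set" where
  "xinv_hom V = {\<phi> \<in> carrier V \<rightarrow>\<^sub>E xinv_series V.
     (\<forall>v\<in>carrier V. \<forall>w\<in>carrier V. \<forall>r. \<phi> (v \<oplus>\<^bsub>V\<^esub> w) r = \<phi> v r \<oplus>\<^bsub>V\<^esub> \<phi> w r) \<and>
     (\<forall>s. \<forall>v\<in>carrier V. \<forall>r. \<phi> (s \<odot>\<^bsub>V\<^esub> v) r = s \<odot>\<^bsub>V\<^esub> \<phi> v r)}"

text \<open>\<open>End \<complex>\<^sup>N \<otimes> Hom(V, V[x\<^bsup>-1\<^esup>]\<^sub>h)\<close> as matrices: \<open>T i j v r\<close> is the coefficient of \<open>x\<^bsup>-r\<^esup>\<close> in \<open>T\<^sub>i\<^sub>j(x) v\<close>.\<close>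

type_synonym ('n, 'v) opser = "'n \<Rightarrow> 'n \<Rightarrow> 'v \<Rightarrow> nat \<Rightarrow> 'v"

definition op_series :: "(complex fps, 'v) module \<Rightarrow> ('n, 'v) opser set" where
  "op_series V = {T. \<forall>i j. T i j \<in> xinv_hom V}"

text \<open>Operator series are multiplied by applying the left factor to the \<open>x\<close>-coefficients of the values
  of the right one.\<close>

definition op_mult :: "(complex fps, 'v) module \<Rightarrow> ('n::finite, 'v) opser \<Rightarrow> ('n, 'v) opser \<Rightarrow> ('n, 'v) opser" where
  "op_mult V S T = (\<lambda>i j. \<lambda>v\<in>carrier V. \<lambda>p.
     \<Oplus>\<^bsub>V\<^esub>k\<in>UNIV. \<Oplus>\<^bsub>V\<^esub>r\<in>{..p}. S i k (T k j v (p - r)) r)"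

definition op_one :: "(complex fps, 'v) module \<Rightarrow> ('n, 'v) opser" where
  "op_one V = (\<lambda>i j. \<lambda>v\<in>carrier V. \<lambda>p. if i = j \<and> p = 0 then v else \<zero>\<^bsub>V\<^esub>)"

definition op_invertible :: "(complex fps, 'v) module \<Rightarrow> ('n::finite, 'v) opser \<Rightarrow> bool" where
  "op_invertible V T \<longleftrightarrow>
     (\<exists>S\<in>op_series V. op_mult V S T = op_one V \<and> op_mult V T S = op_one V)"

definition op_coeff :: "(complex fps, 'v) module \<Rightarrow> ('n, 'v) opser \<Rightarrow> 'n \<Rightarrow> 'n \<Rightarrow> int \<Rightarrow> 'v \<Rightarrow> 'v" where
  "op_coeff V T i j r v = (if r \<ge> 0 then T i j v (nat r) else \<zero>\<^bsub>V\<^esub>)"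

section \<open>Series on \<open>n + 1\<close> tensor factors\<close>

text \<open>Matrices over series in \<open>x\<^bsup>-1\<^esup>, y\<^sub>1, \<dots>, y\<^sub>n\<close> with coefficients in the completed free algebra, acting
  on tensor factors \<open>0, \<dots>, n\<close>. Row and column indices are lists of length \<open>n + 1\<close> whose \<open>k\<close>-th entry
  belongs to factor \<open>k\<close>; in an exponent \<open>e\<close>, \<open>lookup e 0\<close> is the power of \<open>x\<^bsup>-1\<^esup>\<close> and \<open>lookup e k\<close>, for
  \<open>k \<ge> 1\<close>, the power of \<open>y\<^sub>k\<close>.\<close>

type_synonym 'n mser = "'n list \<Rightarrow> 'n list \<Rightarrow> (nat \<Rightarrow>\<^sub>0 nat) \<Rightarrow> 'n falg"

definition mser_mult :: "nat \<Rightarrow> 'n mser \<Rightarrow> 'n mser \<Rightarrow> 'n mser" where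
  "mser_mult n A B = (\<lambda>\<alpha> \<beta> e. \<Sum>\<gamma> | length \<gamma> = Suc n.
     \<Sum>(d, d') | d + d' = e. A \<alpha> \<gamma> d * B \<gamma> \<beta> d')"

definition mser_one :: "'n mser" where
  "mser_one = (\<lambda>\<alpha> \<beta> e. if \<alpha> = \<beta> \<and> e = 0 then 1 else 0)"

definition mser_prod :: "nat \<Rightarrow> 'n mser list \<Rightarrow> 'n mser" where
  "mser_prod n As = foldr (mser_mult n) As mser_one"

lemma finite_exponent_splittings: "finite {(d, d'). d + d' = (e :: nat \<Rightarrow>\<^sub>0 nat)}"
proof -
  let ?F = "{f. \<forall>k. (k \<in> Poly_Mapping.keys e \<longrightarrow> f k \<in> {..Max (range (Poly_Mapping.lookup e))}) \<and>
              (k \<notin> Poly_Mapping.keys e \<longrightarrow> f k = (0::nat))}"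
  have fin: "finite ?F" by (rule finite_set_of_finite_funs) auto
  have "range (Poly_Mapping.lookup e) \<subseteq> insert 0 (Poly_Mapping.lookup e ` Poly_Mapping.keys e)"
    by (auto simp: in_keys_iff)
  then have rng: "finite (range (Poly_Mapping.lookup e))"
    by (rule finite_subset) simp
  have "d \<in> Poly_Mapping.lookup -` ?F \<and> d' \<in> Poly_Mapping.lookup -` ?F" if "d + d' = e" for d d'
  proof -
    have *: "Poly_Mapping.lookup e k = Poly_Mapping.lookup d k + Poly_Mapping.lookup d' k" for k
      by (simp add: lookup_add flip: that)
    have le: "Poly_Mapping.lookup e k \<le> Max (range (Poly_Mapping.lookup e))" for k
      using rng by simp
    have bnd: "Poly_Mapping.lookup d k \<le> Max (range (Poly_Mapping.lookup e)) \<and>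
        Poly_Mapping.lookup d' k \<le> Max (range (Poly_Mapping.lookup e))" for k
      using le[of k] *[of k] by linarith
    have "Poly_Mapping.lookup d k = 0 \<and> Poly_Mapping.lookup d' k = 0" if "k \<notin> Poly_Mapping.keys e" for k
      using that *[of k] by (simp add: in_keys_iff)
    then show ?thesis using bnd by simp
  qed
  then have "{(d, d'). d + d' = e} \<subseteq> (Poly_Mapping.lookup -` ?F) \<times> (Poly_Mapping.lookup -` ?F)"
    by blast
  moreover have "finite (Poly_Mapping.lookup -` ?F)"
    using fin by (rule finite_vimageI) (simp add: inj_on_def poly_mapping_eqI)
  ultimately show ?thesis by (meson finite_SigmaI finite_subset)
qed

text \<open>\<open>B\<^sub>k\<^sub>0(y\<^sub>k u/x)\<close>, with the first leg of \<open>B\<close> in factor \<open>k\<close> and the second in factor \<open>0\<close>.\<close>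

definition Bk0 ::
  "nat \<Rightarrow> nat \<Rightarrow> complex fps \<Rightarrow> complex fps fps ^ ('n::finite \<times> 'n) ^ ('n \<times> 'n) \<Rightarrow> 'n mser" where
  "Bk0 n k u B = (\<lambda>\<alpha> \<beta> e. let m = Poly_Mapping.lookup e 0 in
     if (\<forall>i\<le>n. i \<noteq> 0 \<and> i \<noteq> k \<longrightarrow> \<alpha> ! i = \<beta> ! i) \<and>
        e = Poly_Mapping.single 0 m + Poly_Mapping.single k m
     then scal (u ^ m * fps_nth (B $ (\<alpha> ! k, \<alpha> ! 0) $ (\<beta> ! k, \<beta> ! 0)) m) else 0)"

text \<open>The coefficient of \<open>y\<^sub>1\<^bsup>e\<^sub>1\<^esup> \<cdots> y\<^sub>n\<^bsup>e\<^sub>n\<^esup>\<close> in the entry of \<open>T\<^sub>1\<^sup>+(y\<^sub>1) \<cdots> T\<^sub>n\<^sup>+(y\<^sub>n)\<close> whose indices in factors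
  \<open>1, \<dots>, n\<close> are those of \<open>\<alpha>\<close> and \<open>\<beta>\<close>; \<open>Tplus_legs\<close> is the same product with the identity in factor \<open>0\<close>.\<close>

definition Tplus_coeff :: "nat \<Rightarrow> 'n list \<Rightarrow> 'n list \<Rightarrow> (nat \<Rightarrow>\<^sub>0 nat) \<Rightarrow> 'n falg" where
  "Tplus_coeff n \<alpha> \<beta> e =
     prod_list (map (\<lambda>k. tplus (\<alpha> ! k) (\<beta> ! k) (int (Poly_Mapping.lookup e k))) [1..<Suc n])"

definition Tplus_legs :: "nat \<Rightarrow> 'n mser" where
  "Tplus_legs n = (\<lambda>\<alpha> \<beta> e.
     if \<alpha> ! 0 = \<beta> ! 0 \<and> Poly_Mapping.keys e \<subseteq> {1..n} then Tplus_coeff n \<alpha> \<beta> e else 0)"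

section \<open>The identities\<close>

definition Tminus_unit ::
  "complex fps fps ^ ('n::finite \<times> 'n) ^ ('n \<times> 'n) \<Rightarrow> ('n, 'n falg set) opser \<Rightarrow> bool" where
  "Tminus_unit B T \<longleftrightarrow> (\<forall>i j p. T i j \<one>\<^bsub>Y_RTT B\<^esub> p =
     (if i = j \<and> p = 0 then \<one>\<^bsub>Y_RTT B\<^esub> else \<zero>\<^bsub>Y_RTT B\<^esub>))"

text \<open>The formula for \<open>T\<^sup>-\<^sub>0(x) T\<^sup>+\<^sub>[\<^sub>n\<^sub>](y)\<close>, compared at each entry and at each monomial
  \<open>x\<^bsup>-p\<^esup> y\<^sub>1\<^bsup>e\<^sub>1\<^esup> \<cdots> y\<^sub>n\<^bsup>e\<^sub>n\<^esup>\<close>. The parameter \<open>w\<close> stands for \<open>c/a\<close>. The right-hand side is computed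
  in the completed free algebra and then projected to the quotient.\<close>

definition Tminus_action ::
  "complex fps fps ^ ('n::finite \<times> 'n) ^ ('n \<times> 'n) \<Rightarrow> complex \<Rightarrow> ('n, 'n falg set) opser \<Rightarrow> bool" where
  "Tminus_action B w T \<longleftrightarrow> (\<forall>n\<ge>1. \<forall>\<alpha> \<beta> p e.
     length \<alpha> = Suc n \<and> length \<beta> = Suc n \<and> Poly_Mapping.keys e \<subseteq> {1..n} \<longrightarrow>
     T (\<alpha> ! 0) (\<beta> ! 0) (rtt_class B (Tplus_coeff n \<alpha> \<beta> e)) p =
     rtt_class B (mser_prod n
       (map (\<lambda>k. Bk0 n k (fps_exp w) B) [1..<Suc n] @
        [Tplus_legs n] @
        map (\<lambda>k. Bk0 n k (fps_exp (- w)) (matrix_inv B)) (rev [1..<Suc n]))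
       \<alpha> \<beta> (Poly_Mapping.single 0 p + e)))"

text \<open>The coefficient of \<open>x\<^sup>p y\<^bsup>-q\<^esup>\<close> in the entry \<open>((i, k), (j, l))\<close> of
  \<open>B\<^sub>1\<^sub>2(x/y) T\<^sub>1\<^sup>-(x) T\<^sub>2\<^sup>-(y) = T\<^sub>2\<^sup>-(y) T\<^sub>1\<^sup>-(x) B\<^sub>1\<^sub>2(x/y)\<close>, applied to \<open>v\<close>. Only powers \<open>(x/y)\<^sup>m\<close> with
  \<open>m \<le> q\<close> contribute, and all coefficients with \<open>q < 0\<close> vanish.\<close>

definition Tminus_RTT ::
  "complex fps fps ^ ('n::finite \<times> 'n) ^ ('n \<times> 'n) \<Rightarrow> ('n, 'n falg set) opser \<Rightarrow> bool" where
  "Tminus_RTT B T \<longleftrightarrow> (let Y = Y_RTT B; t = op_coeff Y T in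
     \<forall>v\<in>carrier Y. \<forall>i k j l. \<forall>p::int. \<forall>q::nat.
       (\<Oplus>\<^bsub>Y\<^esub>m\<in>{..q}. \<Oplus>\<^bsub>Y\<^esub>a\<in>UNIV. \<Oplus>\<^bsub>Y\<^esub>b\<in>UNIV. fps_nth (B $ (i, k) $ (a, b)) m \<odot>\<^bsub>Y\<^esub>
          t a j (int m - p) (t b l (int q - int m) v)) =
       (\<Oplus>\<^bsub>Y\<^esub>m\<in>{..q}. \<Oplus>\<^bsub>Y\<^esub>a\<in>UNIV. \<Oplus>\<^bsub>Y\<^esub>b\<in>UNIV. fps_nth (B $ (a, b) $ (j, l)) m \<odot>\<^bsub>Y\<^esub>
          t k b (int q - int m) (t i a (int m - p) v)))"

text \<open>The coefficient of \<open>x\<^bsup>-p\<^esup> y\<^sup>q\<close> in the entry \<open>((i, k), (j, l))\<close> of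
  \<open>T\<^sub>1\<^sup>-(x) T\<^sub>2\<^sup>+(y) B\<^sub>2\<^sub>1(y e\<^bsup>-hw\<^esup>/x) = B\<^sub>2\<^sub>1(y e\<^bsup>hw\<^esup>/x) T\<^sub>2\<^sup>+(y) T\<^sub>1\<^sup>-(x)\<close>, applied to \<open>v\<close>; note that the entry
  \<open>((i, k), (a, b))\<close> of \<open>B\<^sub>2\<^sub>1\<close> is the entry \<open>((k, i), (b, a))\<close> of \<open>B\<close>.\<close>

definition Tminus_Tplus ::
  "complex fps fps ^ ('n::finite \<times> 'n) ^ ('n \<times> 'n) \<Rightarrow> complex \<Rightarrow> ('n, 'n falg set) opser \<Rightarrow> bool" where
  "Tminus_Tplus B w T \<longleftrightarrow> (let Y = Y_RTT B; t = op_coeff Y T in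
     \<forall>v\<in>carrier Y. \<forall>i k j l. \<forall>p q :: nat.
       (\<Oplus>\<^bsub>Y\<^esub>m\<in>{..min p q}. \<Oplus>\<^bsub>Y\<^esub>a\<in>UNIV. \<Oplus>\<^bsub>Y\<^esub>b\<in>UNIV.
          (fps_exp (- w) ^ m * fps_nth (B $ (b, a) $ (l, j)) m) \<odot>\<^bsub>Y\<^esub>
          t i a (int p - int m) (rtt_class B (tplus k b (int q - int m)) \<otimes>\<^bsub>Y\<^esub> v)) =
       (\<Oplus>\<^bsub>Y\<^esub>m\<in>{..min p q}. \<Oplus>\<^bsub>Y\<^esub>a\<in>UNIV. \<Oplus>\<^bsub>Y\<^esub>b\<in>UNIV.
          (fps_exp w ^ m * fps_nth (B $ (k, i) $ (b, a)) m) \<odot>\<^bsub>Y\<^esub>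
          (rtt_class B (tplus b l (int q - int m)) \<otimes>\<^bsub>Y\<^esub> t a j (int p - int m) v)))"

definition is_Tminus ::
  "complex fps fps ^ ('n::finite \<times> 'n) ^ ('n \<times> 'n) \<Rightarrow> complex \<Rightarrow> ('n, 'n falg set) opser \<Rightarrow> bool" where
  "is_Tminus B w T \<longleftrightarrow> T \<in> op_series (Y_RTT B) \<and> Tminus_unit B T \<and> Tminus_action B w T"

end

theory Submission
  imports Defs
begin

text \<open>
  All identities hold exactly for linear operators on the completed free algebra \<open>F\<close>, before passing to
  the quotient by the ideal \<open>J\<close> of the RTT relations. Given an invertible series \<open>Q(x)\<close>, the rule
  \<open>T\<^sub>0\<^sup>-(x) T\<^sub>1\<^sup>+(y) = Q\<^sub>1\<^sub>0(y e\<^bsup>hw\<^esup>/x) T\<^sub>1\<^sup>+(y) T\<^sub>0\<^sup>-(x) Q\<^sub>1\<^sub>0(y e\<^bsup>-hw\<^esup>/x)\<^bsup>-1\<^esup>\<close> with \<open>T\<^sup>-(x) 1 = 1\<close> defines \<open>T\<^sup>-\<close>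
  on words, hence on \<open>F\<close>. If \<open>B\<^sub>1\<^sub>2 Q\<^sub>1\<^sub>3 Q\<^sub>2\<^sub>3 = Q\<^sub>2\<^sub>3 Q\<^sub>1\<^sub>3 B\<^sub>1\<^sub>2\<close>, then \<open>T\<^sup>-\<close> carries a relator times anything to a
  combination of relators times something, so it preserves \<open>J\<close>. With \<open>Q = B\<close> this is the series of the
  theorem; its RTT relation follows from the Yang--Baxter equation by induction on words. With \<open>Q\<close> the
  inverse of the partial transpose of \<open>B\<close>, which exists by skew-invertibility, the construction yields
  the transpose of the inverse of \<open>T\<^sup>-\<close>. Spectral parameters are made into power series variables by
  substituting monomials, such as \<open>x = u y\<close> in a relation in \<open>x/y\<close>.
\<close>

section \<open>Ring homomorphisms and power series\<close>

text \<open>No basis of the quotient is at hand, so a map out of it cannot simply be prescribed,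
  whereas F is topologically free on words. What must then be proved is that J is stable. But J is
  known only as the least closed, h-saturated ideal containing the relators, so its elements cannot
  be followed one by one; instead the set of all v with T^-(v u) in J for every u is shown to be an
  ideal of the same kind. For the inverse S of T^- the exchange rule reads S_0 B_10(y e^(hw)/x)
  T_1^+ = T_1^+ B_10(y e^(-hw)/x) S_0. Here the R-matrix stands between S and T^+, so this is no
  recursion for S on words. Transposing factor 0 reverses the order in that factor alone and brings
  the R-matrix outside; the price is that the partial transpose of B must be invertible, and this is
  where skew-invertibility enters. At spectral parameter 0, B is P R, and a rearrangement of \<Psi>
  inverts its partial transpose; the rest of B is a multiple of P, up to the scalar factor.\<close>

definition unital_hom :: "('a::ring_1 \<Rightarrow> 'b::ring_1) \<Rightarrow> bool" where
  "unital_hom g \<longleftrightarrow> (\<forall>a b. g (a + b) = g a + g b) \<and> (\<forall>a b. g (a * b) = g a * g b) \<and> g 1 = 1"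

lemma unital_homI:
  assumes "\<And>a b. g (a + b) = g a + g b" "\<And>a b. g (a * b) = g a * g b" "g 1 = 1"
  shows "unital_hom g"
  using assms by (simp add: unital_hom_def)

lemma unital_hom_add: "unital_hom g \<Longrightarrow> g (a + b) = g a + g b"
  and unital_hom_mult: "unital_hom g \<Longrightarrow> g (a * b) = g a * g b"
  and unital_hom_one: "unital_hom g \<Longrightarrow> g 1 = 1"
  by (simp_all add: unital_hom_def)

lemma unital_hom_zero: "unital_hom g \<Longrightarrow> g 0 = 0"
  using unital_hom_add[of g 0 0] by simp

lemma unital_hom_uminus: "unital_hom g \<Longrightarrow> g (- a) = - g a"
  using unital_hom_add[of g a "- a"] unital_hom_zero[of g] by (simp add: minus_unique)

lemma unital_hom_diff: "unital_hom g \<Longrightarrow> g (a - b) = g a - g b"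
  using unital_hom_add[of g a "- b"] unital_hom_uminus[of g b] by simp

lemma unital_hom_sum:
  assumes "unital_hom g" shows "g (sum f A) = (\<Sum>x\<in>A. g (f x))"
  by (induction A rule: infinite_finite_induct)
     (simp_all add: unital_hom_zero[OF assms] unital_hom_add[OF assms])

lemma unital_hom_power:
  assumes "unital_hom g" shows "g (a ^ n) = g a ^ n"
  by (induction n) (simp_all add: unital_hom_one[OF assms] unital_hom_mult[OF assms])

lemma unital_hom_comp: "unital_hom f \<Longrightarrow> unital_hom g \<Longrightarrow> unital_hom (\<lambda>x. f (g x))"
  by (simp add: unital_hom_def)

lemma unital_hom_fps_const: "unital_hom fps_const"
  by (simp add: unital_hom_def)

definition fps_map :: "('a \<Rightarrow> 'b) \<Rightarrow> 'a fps \<Rightarrow> 'b fps" where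
  "fps_map g f = Abs_fps (\<lambda>n. g (fps_nth f n))"

lemma fps_map_nth [simp]: "fps_nth (fps_map g f) n = g (fps_nth f n)"
  by (simp add: fps_map_def)

lemma unital_hom_fps_map:
  assumes "unital_hom g" shows "unital_hom (fps_map g)"
  by (intro unital_homI)
     (simp_all add: fps_eq_iff fps_mult_nth unital_hom_add[OF assms] unital_hom_mult[OF assms]
        unital_hom_sum[OF assms] unital_hom_one[OF assms] unital_hom_zero[OF assms])

definition fps_scale :: "'a::monoid_mult \<Rightarrow> 'a fps \<Rightarrow> 'a fps" where
  "fps_scale c f = Abs_fps (\<lambda>m. fps_nth f m * c ^ m)"

lemma fps_scale_nth [simp]: "fps_nth (fps_scale c f) n = fps_nth f n * c ^ n"
  by (simp add: fps_scale_def)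

lemma power_central:
  fixes c :: "'a::monoid_mult"
  assumes "\<And>a. c * a = a * c" shows "c ^ n * a = a * c ^ n"
proof (induction n)
  case (Suc n)
  have "c ^ Suc n * a = c * (c ^ n * a)" by (simp add: mult.assoc)
  also have "\<dots> = (c * a) * c ^ n" by (simp only: Suc mult.assoc)
  also have "\<dots> = a * c ^ Suc n" by (simp only: assms mult.assoc power_Suc)
  finally show ?case .
qed simp

lemma unital_hom_fps_scale:
  fixes c :: "'a::ring_1"
  assumes "\<And>a. c * a = a * c" shows "unital_hom (fps_scale c)"
proof (rule unital_homI)
  fix f g :: "'a fps"
  show "fps_scale c (f * g) = fps_scale c f * fps_scale c g"
  proof (rule fps_ext)
    fix n
    have "fps_nth f i * fps_nth g (n - i) * c ^ n = fps_nth f i * c ^ i * (fps_nth g (n - i) * c ^ (n - i))"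
      if "i \<in> {0..n}" for i
    proof -
      have "c ^ n = c ^ i * c ^ (n - i)" using that by (simp flip: power_add)
      then have "fps_nth f i * fps_nth g (n - i) * c ^ n = fps_nth f i * (fps_nth g (n - i) * c ^ i) * c ^ (n - i)"
        by (simp add: mult.assoc)
      also have "\<dots> = fps_nth f i * (c ^ i * fps_nth g (n - i)) * c ^ (n - i)"
        by (simp add: power_central[OF assms])
      finally show ?thesis by (simp add: mult.assoc)
    qed
    then show "fps_nth (fps_scale c (f * g)) n = fps_nth (fps_scale c f * fps_scale c g) n"
      by (simp add: fps_mult_nth sum_distrib_right)
  qed
qed (simp_all add: fps_eq_iff algebra_simps)

definition fps_swap :: "'a fps fps \<Rightarrow> 'a fps fps" where
  "fps_swap f = Abs_fps (\<lambda>m. Abs_fps (\<lambda>n. fps_nth (fps_nth f n) m))"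

lemma fps_swap_nth [simp]: "fps_nth (fps_nth (fps_swap f) m) n = fps_nth (fps_nth f n) m"
  by (simp add: fps_swap_def)

lemma unital_hom_fps_swap: "unital_hom (fps_swap :: 'a::ring_1 fps fps \<Rightarrow> _)"
proof (rule unital_homI)
  fix f g :: "'a fps fps"
  show "fps_swap (f * g) = fps_swap f * fps_swap g"
    by (rule fps_ext, rule fps_ext) (simp add: fps_mult_nth fps_sum_nth, rule sum.swap)
qed (simp_all add: fps_eq_iff)

section \<open>Rings of square matrices\<close>

text \<open>Matrices over a noncommutative ring form a \<open>ring_1\<close>, so operator identities
  on several tensor legs become identities between elements of one ring and can be proved by plain
  ring rewriting.\<close>

typedef ('a, 'i) sqm = "UNIV :: ('i \<Rightarrow> 'i \<Rightarrow> 'a) set"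
  morphisms ent Sqm by simp

lemma ent_Sqm [simp]: "ent (Sqm A) = A"
  by (simp add: Sqm_inverse)

lemma sqm_eqI: "(\<And>i j. ent A i j = ent B i j) \<Longrightarrow> A = B"
  by (metis ent_inverse ext)

instantiation sqm :: (ring_1, finite) ring_1
begin

definition "0 = Sqm (\<lambda>i j. 0)"
definition "1 = Sqm (\<lambda>i j. if i = j then 1 else 0)"
definition "A + B = Sqm (\<lambda>i j. ent A i j + ent B i j)"
definition "A - B = Sqm (\<lambda>i j. ent A i j - ent B i j)"
definition "- A = Sqm (\<lambda>i j. - ent A i j)"
definition "A * B = Sqm (\<lambda>i j. \<Sum>k\<in>UNIV. ent A i k * ent B k j)"

lemma ent_zero [simp]: "ent 0 i j = 0"
  and ent_one: "ent 1 i j = (if i = j then 1 else 0)"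
  and ent_add [simp]: "ent (A + B) i j = ent A i j + ent B i j"
  and ent_diff [simp]: "ent (A - B) i j = ent A i j - ent B i j"
  and ent_uminus [simp]: "ent (- A) i j = - ent A i j"
  and ent_mult: "ent (A * B) i j = (\<Sum>k\<in>UNIV. ent A i k * ent B k j)"
  by (simp_all add: zero_sqm_def one_sqm_def plus_sqm_def minus_sqm_def uminus_sqm_def times_sqm_def)

instance
proof
  fix A B C :: "('a, 'b) sqm"
  have "(\<Sum>k\<in>UNIV. (\<Sum>l\<in>UNIV. ent A i l * ent B l k) * ent C k j) =
      (\<Sum>k\<in>UNIV. ent A i k * (\<Sum>l\<in>UNIV. ent B k l * ent C l j))" for i j
    by (simp add: sum_distrib_left sum_distrib_right mult.assoc) (rule sum.swap)
  then show "A * B * C = A * (B * C)"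
    by (intro sqm_eqI) (simp add: ent_mult)
  show "1 * A = A" "A * 1 = A"
    by (rule sqm_eqI, simp add: ent_mult ent_one if_distrib[of "\<lambda>x. x * _"] if_distrib[of "\<lambda>x. _ * x"]
        cong: if_cong)+
  show "(A + B) * C = A * C + B * C" "A * (B + C) = A * B + A * C"
    by (rule sqm_eqI, simp add: ent_mult algebra_simps sum.distrib)+
  have "ent 0 undefined undefined \<noteq> ent (1 :: ('a, 'b) sqm) undefined undefined" by (simp add: ent_one)
  then show "(0 :: ('a, 'b) sqm) \<noteq> 1" by metis
qed (rule sqm_eqI, simp add: algebra_simps)+

end

definition sqm_map :: "('a \<Rightarrow> 'b) \<Rightarrow> ('a, 'i) sqm \<Rightarrow> ('b, 'i) sqm" where
  "sqm_map g A = Sqm (\<lambda>i j. g (ent A i j))"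

lemma ent_sqm_map [simp]: "ent (sqm_map g A) i j = g (ent A i j)"
  by (simp add: sqm_map_def)

lemma sqm_map_comp: "sqm_map f (sqm_map g A) = sqm_map (\<lambda>x. f (g x)) A"
  by (rule sqm_eqI) simp

lemma unital_hom_sqm_map:
  assumes "unital_hom g" shows "unital_hom (sqm_map g :: ('a::ring_1, 'i::finite) sqm \<Rightarrow> _)"
  by (intro unital_homI sqm_eqI)
     (simp_all add: ent_mult ent_one unital_hom_add[OF assms] unital_hom_mult[OF assms]
        unital_hom_sum[OF assms] unital_hom_one[OF assms] unital_hom_zero[OF assms])

section \<open>Tensor legs\<close>

text \<open>When \<open>r \<mapsto> (\<pi> r, \<rho> r)\<close> is a bijection, \<open>sqm_emb \<pi> \<rho> A\<close> lets \<open>A\<close> act on the legs selected by \<open>\<pi>\<close>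
  and the identity on those selected by \<open>\<rho>\<close>.\<close>

definition sqm_emb :: "('i \<Rightarrow> 'p) \<Rightarrow> ('i \<Rightarrow> 'r) \<Rightarrow> ('a::zero, 'p) sqm \<Rightarrow> ('a, 'i) sqm" where
  "sqm_emb \<pi> \<rho> A = Sqm (\<lambda>r s. if \<rho> r = \<rho> s then ent A (\<pi> r) (\<pi> s) else 0)"

lemma ent_sqm_emb: "ent (sqm_emb \<pi> \<rho> A) r s = (if \<rho> r = \<rho> s then ent A (\<pi> r) (\<pi> s) else 0)"
  by (simp add: sqm_emb_def)

lemma unital_hom_sqm_emb:
  fixes \<pi> :: "'i::finite \<Rightarrow> 'p::finite" and \<rho> :: "'i \<Rightarrow> 'r"
  assumes "bij (\<lambda>r. (\<pi> r, \<rho> r))"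
  shows "unital_hom (sqm_emb \<pi> \<rho> :: ('a::ring_1, 'p) sqm \<Rightarrow> _)"
proof (rule unital_homI)
  fix A B :: "('a, 'p) sqm"
  have "ent (sqm_emb \<pi> \<rho> A * sqm_emb \<pi> \<rho> B) r s = ent (sqm_emb \<pi> \<rho> (A * B)) r s" for r s
  proof (cases "\<rho> r = \<rho> s")
    case True
    have "ent (sqm_emb \<pi> \<rho> A * sqm_emb \<pi> \<rho> B) r s =
        (\<Sum>t\<in>{t. \<rho> t = \<rho> r}. ent A (\<pi> r) (\<pi> t) * ent B (\<pi> t) (\<pi> s))"
      unfolding ent_mult ent_sqm_emb
      by (rule sum.mono_neutral_cong_right) (use True in auto)
    also have "\<dots> = (\<Sum>p\<in>UNIV. ent A (\<pi> r) p * ent B p (\<pi> s))"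
    proof (rule sum.reindex_bij_betw)
      show "bij_betw \<pi> {t. \<rho> t = \<rho> r} UNIV"
        unfolding bij_betw_def
      proof
        show "inj_on \<pi> {t. \<rho> t = \<rho> r}"
          using bij_is_inj[OF assms] by (auto simp: inj_on_def)
        have "p \<in> \<pi> ` {t. \<rho> t = \<rho> r}" for p
        proof -
          obtain t where "(p, \<rho> r) = (\<pi> t, \<rho> t)" using surjD[OF bij_is_surj[OF assms]] ..
          then show ?thesis by auto
        qed
        then show "\<pi> ` {t. \<rho> t = \<rho> r} = UNIV" by blast
      qed
    qed
    finally show ?thesis using True by (simp add: ent_sqm_emb ent_mult)
  next
    case False
    then show ?thesis unfolding ent_mult ent_sqm_emb by (auto intro!: sum.neutral)
  qed
  then show "sqm_emb \<pi> \<rho> (A * B) = sqm_emb \<pi> \<rho> A * sqm_emb \<pi> \<rho> B"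
    by (intro sqm_eqI) simp
next
  show "sqm_emb \<pi> \<rho> 1 = (1 :: ('a, 'i) sqm)"
    using bij_is_inj[OF assms] by (intro sqm_eqI) (auto simp: ent_sqm_emb ent_one inj_def)
qed (rule sqm_eqI, simp add: ent_sqm_emb)

lemma sqm_map_emb: "g 0 = 0 \<Longrightarrow> sqm_map g (sqm_emb \<pi> \<rho> A) = sqm_emb \<pi> \<rho> (sqm_map g A)"
  by (rule sqm_eqI) (simp add: ent_sqm_emb)

text \<open>Exactly one intermediate index survives in the product: the one with the
  \<open>\<pi>\<close>-part of the column and the \<open>\<rho>\<close>-part of the row. Entries may
  be operators, so their order is kept.\<close>

lemma ent_mult_disjoint_legs:
  fixes \<pi> :: "'i::finite \<Rightarrow> 'p" and \<rho> :: "'i \<Rightarrow> 'r"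
  assumes "bij (\<lambda>r. (\<pi> r, \<rho> r))"
  shows "ent (sqm_emb \<pi> \<rho> A * sqm_emb \<rho> \<pi> B) r s = ent A (\<pi> r) (\<pi> s) * ent B (\<rho> r) (\<rho> s)"
proof -
  obtain t where "(\<pi> s, \<rho> r) = (\<pi> t, \<rho> t)" using surjD[OF bij_is_surj[OF assms]] ..
  then have t: "\<pi> t = \<pi> s" "\<rho> t = \<rho> r" by simp_all
  have uniq: "x = t" if "\<pi> x = \<pi> s" "\<rho> x = \<rho> r" for x
    using bij_is_inj[OF assms] that t by (auto simp: inj_def)
  have "(if \<rho> r = \<rho> x then ent A (\<pi> r) (\<pi> x) else 0) * (if \<pi> x = \<pi> s then ent B (\<rho> x) (\<rho> s) else 0) =
      (if x = t then ent A (\<pi> r) (\<pi> t) * ent B (\<rho> t) (\<rho> s) else 0)" for x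
  proof (cases "x = t")
    case False
    then have "\<rho> r \<noteq> \<rho> x \<or> \<pi> x \<noteq> \<pi> s" using uniq[of x] by metis
    then show ?thesis using False by auto
  qed (simp add: t)
  then have "ent (sqm_emb \<pi> \<rho> A * sqm_emb \<rho> \<pi> B) r s = ent A (\<pi> r) (\<pi> t) * ent B (\<rho> t) (\<rho> s)"
    unfolding ent_mult ent_sqm_emb by simp
  then show ?thesis using t by simp
qed

text \<open>Different legs alone do not suffice when the entries are operators; in the applications
  one of the two factors has scalar, hence central, entries.\<close>

lemma disjoint_legs_commute:
  fixes \<pi> :: "'i::finite \<Rightarrow> 'p" and \<rho> :: "'i \<Rightarrow> 'r"
  assumes "bij (\<lambda>r. (\<pi> r, \<rho> r))" "\<And>i j k l. ent A i j * ent B k l = ent B k l * ent A i j"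
  shows "sqm_emb \<pi> \<rho> A * sqm_emb \<rho> \<pi> B = sqm_emb \<rho> \<pi> B * sqm_emb \<pi> \<rho> A"
proof (rule sqm_eqI)
  have "bij (\<lambda>r. (\<rho> r, \<pi> r))"
    using bij_comp[OF assms(1) bij_swap] by (simp add: comp_def)
  then show "ent (sqm_emb \<pi> \<rho> A * sqm_emb \<rho> \<pi> B) r s = ent (sqm_emb \<rho> \<pi> B * sqm_emb \<pi> \<rho> A) r s" for r s
    using assms by (simp add: ent_mult_disjoint_legs)
qed

abbreviation leg1 :: "('a::zero, 'n) sqm \<Rightarrow> ('a, 'n \<times> 'n) sqm" where "leg1 \<equiv> sqm_emb fst snd"
abbreviation leg2 :: "('a::zero, 'n) sqm \<Rightarrow> ('a, 'n \<times> 'n) sqm" where "leg2 \<equiv> sqm_emb snd fst"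

abbreviation tri1 :: "('a::zero, 'n) sqm \<Rightarrow> ('a, 'n \<times> 'n \<times> 'n) sqm" where
  "tri1 \<equiv> sqm_emb fst snd"
abbreviation tri2 :: "('a::zero, 'n) sqm \<Rightarrow> ('a, 'n \<times> 'n \<times> 'n) sqm" where
  "tri2 \<equiv> sqm_emb (\<lambda>r. fst (snd r)) (\<lambda>r. (fst r, snd (snd r)))"
abbreviation tri3 :: "('a::zero, 'n) sqm \<Rightarrow> ('a, 'n \<times> 'n \<times> 'n) sqm" where
  "tri3 \<equiv> sqm_emb (\<lambda>r. snd (snd r)) (\<lambda>r. (fst r, fst (snd r)))"
abbreviation tri12 :: "('a::zero, 'n \<times> 'n) sqm \<Rightarrow> ('a, 'n \<times> 'n \<times> 'n) sqm" where
  "tri12 \<equiv> sqm_emb (\<lambda>r. (fst r, fst (snd r))) (\<lambda>r. snd (snd r))"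
abbreviation tri13 :: "('a::zero, 'n \<times> 'n) sqm \<Rightarrow> ('a, 'n \<times> 'n \<times> 'n) sqm" where
  "tri13 \<equiv> sqm_emb (\<lambda>r. (fst r, snd (snd r))) (\<lambda>r. fst (snd r))"
abbreviation tri23 :: "('a::zero, 'n \<times> 'n) sqm \<Rightarrow> ('a, 'n \<times> 'n \<times> 'n) sqm" where
  "tri23 \<equiv> sqm_emb snd fst"

lemma leg_bij:
  "bij (\<lambda>r::'a \<times> 'b. (fst r, snd r))" "bij (\<lambda>r::'a \<times> 'b. (snd r, fst r))"
  "bij (\<lambda>r::'a \<times> 'b \<times> 'c. (fst (snd r), fst r, snd (snd r)))"
  "bij (\<lambda>r::'a \<times> 'b \<times> 'c. (snd (snd r), fst r, fst (snd r)))"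
  "bij (\<lambda>r::'a \<times> 'b \<times> 'c. ((fst r, fst (snd r)), snd (snd r)))"
  "bij (\<lambda>r::'a \<times> 'b \<times> 'c. ((fst r, snd (snd r)), fst (snd r)))"
  by (auto simp: bij_def inj_def surj_def)

lemmas unital_hom_leg = leg_bij[THEN unital_hom_sqm_emb]
lemmas leg_mult = unital_hom_leg[THEN unital_hom_mult]

lemma tri_leg:
  "tri12 (leg1 A) = tri1 A" "tri12 (leg2 A) = tri2 A"
  "tri13 (leg1 A) = tri1 A" "tri13 (leg2 A) = tri3 A"
  "tri23 (leg1 A) = tri2 A" "tri23 (leg2 A) = tri3 A"
  by (rule sqm_eqI, auto simp: ent_sqm_emb)+

lemmas ent_mult_leg = leg_bij[THEN ent_mult_disjoint_legs]

section \<open>Bimodules of coefficients\<close>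

text \<open>Applied to sets of operators: those killing a fixed vector (all operators on the left,
  scalars on the right), those mapping F into J (scalars left, all operators right), and those
  mapping a fixed vector into J. Membership lifts to series and matrices, so it can be read off a
  factorised operator identity.\<close>

definition bimod :: "'a::ring_1 set \<Rightarrow> 'a set \<Rightarrow> 'a set \<Rightarrow> bool" where
  "bimod A I C \<longleftrightarrow> 0 \<in> I \<and> (\<forall>x\<in>I. \<forall>y\<in>I. x + y \<in> I) \<and>
     (\<forall>a\<in>A. \<forall>x\<in>I. a * x \<in> I) \<and> (\<forall>x\<in>I. \<forall>c\<in>C. x * c \<in> I)"

lemma bimod_zero: "bimod A I C \<Longrightarrow> 0 \<in> I"
  and bimod_left: "bimod A I C \<Longrightarrow> a \<in> A \<Longrightarrow> x \<in> I \<Longrightarrow> a * x \<in> I"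
  and bimod_right: "bimod A I C \<Longrightarrow> x \<in> I \<Longrightarrow> c \<in> C \<Longrightarrow> x * c \<in> I"
  by (simp_all add: bimod_def)

lemma bimod_sum: "bimod A I C \<Longrightarrow> (\<And>x. x \<in> S \<Longrightarrow> f x \<in> I) \<Longrightarrow> sum f S \<in> I"
  by (induction S rule: infinite_finite_induct) (auto simp: bimod_def)

definition fps_over :: "'a set \<Rightarrow> 'a fps set" where
  "fps_over A = {f. \<forall>n. fps_nth f n \<in> A}"

definition sqm_over :: "'a set \<Rightarrow> ('a, 'i) sqm set" where
  "sqm_over A = {M. \<forall>i j. ent M i j \<in> A}"

lemma bimod_fps_over: "bimod A I C \<Longrightarrow> bimod (fps_over A) (fps_over I) (fps_over C)"
  unfolding bimod_def[of "fps_over A"]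
  by (auto simp: fps_over_def fps_mult_nth bimod_zero intro!: bimod_sum intro: bimod_left bimod_right)
     (simp add: bimod_def)

lemma bimod_sqm_over:
  "bimod A I C \<Longrightarrow> bimod (sqm_over A :: ('a::ring_1, 'i::finite) sqm set) (sqm_over I) (sqm_over C)"
  unfolding bimod_def[of "sqm_over A"]
  by (auto simp: sqm_over_def ent_mult bimod_zero intro!: bimod_sum intro: bimod_left bimod_right)
     (simp add: bimod_def)

lemma sqm_over_emb: "0 \<in> A \<Longrightarrow> M \<in> sqm_over A \<Longrightarrow> sqm_emb p q M \<in> sqm_over A"
  by (simp add: sqm_over_def ent_sqm_emb)

lemma fps_over_zero: "0 \<in> A \<Longrightarrow> 0 \<in> fps_over A"
  by (simp add: fps_over_def)

lemma fps_over_const: "0 \<in> A \<Longrightarrow> a \<in> A \<Longrightarrow> fps_const a \<in> fps_over A"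
  by (simp add: fps_over_def)

section \<open>The completed free algebra\<close>

lemma poly_mapping_monomial_expansion:
  "(p :: 'k \<Rightarrow>\<^sub>0 'a::comm_monoid_add) = (\<Sum>w\<in>Poly_Mapping.keys p. Poly_Mapping.single w (Poly_Mapping.lookup p w))"
  by (rule poly_mapping_eqI) (auto simp: lookup_sum lookup_single when_def in_keys_iff)

lemma single_zero_central:
  fixes p :: "'k::monoid_add \<Rightarrow>\<^sub>0 'a::comm_semiring_1"
  shows "Poly_Mapping.single 0 c * p = p * Poly_Mapping.single 0 c"
proof -
  have "Poly_Mapping.single 0 c * (\<Sum>w\<in>Poly_Mapping.keys p. Poly_Mapping.single w (Poly_Mapping.lookup p w)) =
      (\<Sum>w\<in>Poly_Mapping.keys p. Poly_Mapping.single w (Poly_Mapping.lookup p w)) * Poly_Mapping.single 0 c"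
    by (simp add: sum_distrib_left sum_distrib_right mult_single mult.commute)
  then show ?thesis by (simp flip: poly_mapping_monomial_expansion)
qed

lemma scal_nth: "fps_nth (scal s) k = Poly_Mapping.single 0 (fps_nth s k)"
  by (simp add: scal_def)

lemma single_sum: "Poly_Mapping.single k (sum f A) = (\<Sum>x\<in>A. Poly_Mapping.single k (f x))"
  by (induction A rule: infinite_finite_induct) (simp_all add: single_add)

lemma unital_hom_scal: "unital_hom scal"
  by (rule unital_homI)
     (simp_all add: fps_eq_iff scal_nth single_add fps_mult_nth single_sum mult_single fps_one_nth)

lemmas scal_one [simp] = unital_hom_one[OF unital_hom_scal]
  and scal_zero [simp] = unital_hom_zero[OF unital_hom_scal]
  and scal_power = unital_hom_power[OF unital_hom_scal]

lemma scal_central: "scal s * v = v * scal s"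
proof (rule fps_ext)
  fix n
  have "fps_nth (scal s * v) n = (\<Sum>i=0..n. fps_nth v (n - i) * fps_nth (scal s) i)"
    by (simp add: fps_mult_nth scal_nth single_zero_central)
  also have "\<dots> = fps_nth (v * scal s) n"
    unfolding fps_mult_nth by (rule sum.reindex_bij_witness[of _ "\<lambda>i. n - i" "\<lambda>i. n - i"]) auto
  finally show "fps_nth (scal s * v) n = fps_nth (v * scal s) n" .
qed

lemma scal_fps_X [simp]: "scal fps_X = fps_X"
  by (simp add: fps_eq_iff scal_nth fps_X_def)

definition wd :: "('n \<times> 'n \<times> nat) list \<Rightarrow> 'n falg" where
  "wd ws = fps_const (Poly_Mapping.single (GWord ws) 1)"

lemma wd_Nil [simp]: "wd [] = 1"
  by (simp add: wd_def flip: zero_gword_def)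

lemma wd_append: "wd (u @ v) = wd u * wd v"
  by (simp add: wd_def mult_single)

lemma wd_Cons: "wd (w # ws) = wd [w] * wd ws"
  using wd_append[of "[w]" ws] by simp

lemma tplus_wd: "tplus i j (int s) = wd [(i, j, s)]"
  by (simp add: tplus_def wd_def)

lemma tplus_neg: "s < 0 \<Longrightarrow> tplus i j s = 0"
  by (simp add: tplus_def)

lemma fps_const_word_expansion:
  "(fps_const p :: 'n falg) = (\<Sum>w\<in>Poly_Mapping.keys p. scal (fps_const (Poly_Mapping.lookup p w)) * wd (case w
      of GWord ws \<Rightarrow> ws))"
proof -
  have const_sum: "fps_const (sum f A) = (\<Sum>x\<in>A. fps_const (f x))" for f :: "_ \<Rightarrow> ('n \<times> 'n \<times> nat) gword \<Rightarrow>\<^sub>0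
      complex" and A
    by (induction A rule: infinite_finite_induct) (simp_all flip: fps_const_add)
  have 1: "scal (fps_const c) = fps_const (Poly_Mapping.single 0 c)" for c
    by (simp add: fps_eq_iff scal_nth)
  have "scal (fps_const (Poly_Mapping.lookup p w)) * wd (case w of GWord ws \<Rightarrow> ws) =
      fps_const (Poly_Mapping.single w (Poly_Mapping.lookup p w))" for w
    by (cases w) (simp add: 1 wd_def mult_single)
  then show ?thesis
    by (subst poly_mapping_monomial_expansion) (simp add: const_sum)
qed

subsection \<open>Closed submodules\<close>

definition closed_submodule :: "'n falg set \<Rightarrow> bool" where
  "closed_submodule J \<longleftrightarrow> closed J \<and> 0 \<in> J \<and> (\<forall>u\<in>J. \<forall>v\<in>J. u + v \<in> J) \<and> (\<forall>s. \<forall>v\<in>J. scal s * v \<in> J)"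

lemma closed_submodule_sum:
  "closed_submodule J \<Longrightarrow> (\<And>x. x \<in> S \<Longrightarrow> f x \<in> J) \<Longrightarrow> sum f S \<in> J"
  by (induction S rule: infinite_finite_induct) (auto simp: closed_submodule_def)

text \<open>The distance of two series is 2 to the minus order of their difference, so agreement
  modulo each power of h is approximation.\<close>

lemma closed_h_adic:
  fixes J :: "'a::ring_1 fps set"
  assumes "closed J" "\<And>k. \<exists>u\<in>J. \<exists>w. v = u + fps_X ^ k * w"
  shows "v \<in> J"
proof (rule closed_approachable[THEN iffD1, OF assms(1)], intro allI impI)
  fix e :: real assume "e > 0"
  then obtain k where k: "(1/2::real) ^ k < e"
    by (metis real_arch_pow_inv half_gt_zero_iff zero_less_one less_numeral_extra(1) field_sum_of_halves
        less_add_same_cancel1)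
  obtain u w where u: "u \<in> J" "v = u + fps_X ^ k * w" using assms(2) by blast
  have "dist u v < e"
  proof (cases "u = v")
    case False
    have "fps_nth (u - v) i = 0" if "i < k" for i
      using that by (simp add: u(2) fps_X_power_mult_nth)
    then have "k \<le> subdegree (u - v)" using False by (intro subdegree_geI) auto
    then have "inverse (2 ^ subdegree (u - v)) \<le> (1/2::real) ^ k"
      by (simp add: power_one_over field_simps)
    then show ?thesis using False k by (simp add: dist_fps_def)
  qed (use \<open>e > 0\<close> in simp)
  then show "\<exists>y\<in>J. dist y v < e" using u(1) by blast
qed

lemma closed_h_adicI:
  fixes J :: "'a::ring_1 fps set"
  assumes "\<And>v. (\<And>k. \<exists>u\<in>J. \<exists>w. v = u + fps_X ^ k * w) \<Longrightarrow> v \<in> J"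
  shows "closed J"
proof (rule closure_subset_eq[THEN iffD1], rule subsetI)
  fix v assume "v \<in> closure J"
  then have v: "\<forall>e>0. \<exists>y\<in>J. dist y v < e" by (simp add: closure_approachable)
  show "v \<in> J"
  proof (rule assms)
    fix k
    have "(0::real) < inverse (2 ^ k)" by simp
    then obtain y where y: "y \<in> J" "dist y v < inverse (2 ^ k)" using v by blast
    have "fps_nth (v - y) i = 0" if "i < k" for i
    proof (cases "y = v")
      case False
      then have "inverse (2 ^ subdegree (y - v)) < (inverse (2 ^ k) :: real)" using y(2) by (simp add: dist_fps_def)
      then have "k < subdegree (y - v)" by (simp add: field_simps)
      then have "fps_nth (y - v) i = 0" using that by (intro nth_less_subdegree_zero) simp
      then show ?thesis by simp
    qed simp
    then have "fps_cutoff k (v - y) = 0" by (simp add: fps_eq_iff)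
    then have "v = y + fps_X ^ k * fps_shift k (v - y)"
      using fps_shift_cutoff'[of k "v - y"] by simp
    then show "\<exists>u\<in>J. \<exists>w. v = u + fps_X ^ k * w" using y(1) by blast
  qed
qed

lemma closed_zero_fps: "closed {0 :: 'a::ring_1 fps}"
  by (rule closed_h_adicI) (auto simp: fps_eq_iff fps_X_power_mult_nth, metis lessI)

lemma closed_submodule_zero: "closed_submodule {0}"
  by (simp add: closed_submodule_def closed_zero_fps)

section \<open>Linear endomorphisms of the completed free algebra\<close>

text \<open>A \<open>\<complex>[[h]]\<close>-linear map sends multiples of h^k to multiples of h^k,
  so h-adic continuity is automatic and no topological condition appears.\<close>

typedef 'n endo = "{f :: 'n falg \<Rightarrow> 'n falg. (\<forall>u v. f (u + v) = f u + f v) \<and> (\<forall>s v. f (scal s * v) = scal s * f v)}"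
  morphisms app Endo
  by (rule exI[of _ "\<lambda>v. v"]) simp

lemma app_add [simp]: "app e (u + v) = app e u + app e v"
  and app_scal [simp]: "app e (scal s * v) = scal s * app e v"
  using app[of e] by simp_all

lemma app_zero [simp]: "app e 0 = 0"
  using app_add[of e 0 0] by simp

lemma app_minus [simp]: "app e (- v) = - app e v"
  using app_add[of e v "- v"] by (simp add: minus_unique)

lemma app_sum: "app e (sum f A) = (\<Sum>x\<in>A. app e (f x))"
  by (induction A rule: infinite_finite_induct) simp_all

lemma app_h_power [simp]: "app e (fps_X ^ k * v) = fps_X ^ k * app e v"
  using app_scal[of e "fps_X ^ k" v] by (simp add: scal_power)

lemma app_Endo:
  assumes "\<And>u v. f (u + v) = f u + f v" "\<And>s v. f (scal s * v) = scal s * f v"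
  shows "app (Endo f) = f"
  by (rule Endo_inverse) (simp add: assms)

lemma endo_eqI: "(\<And>v. app e v = app e' v) \<Longrightarrow> e = e'"
  by (metis app_inject ext)

instantiation endo :: (type) ring_1
begin

definition "0 = Endo (\<lambda>v. 0)"
definition "1 = Endo (\<lambda>v. v)"
definition "e + e' = Endo (\<lambda>v. app e v + app e' v)"
definition "e - e' = Endo (\<lambda>v. app e v - app e' v)"
definition "- e = Endo (\<lambda>v. - app e v)"
definition "e * e' = Endo (\<lambda>v. app e (app e' v))"

lemma endo_zero [simp]: "app 0 v = 0"
  and endo_one [simp]: "app 1 v = v"
  and endo_add [simp]: "app (e + e') v = app e v + app e' v"
  and endo_diff [simp]: "app (e - e') v = app e v - app e' v"
  and endo_uminus [simp]: "app (- e) v = - app e v"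
  and endo_mult [simp]: "app (e * e') v = app e (app e' v)"
  by (simp_all add: zero_endo_def one_endo_def plus_endo_def minus_endo_def uminus_endo_def
      times_endo_def app_Endo algebra_simps)

instance
proof
  have "app 0 1 \<noteq> app (1 :: 'a endo) 1" by simp
  then show "(0 :: 'a endo) \<noteq> 1" by metis
qed (rule endo_eqI, simp add: algebra_simps)+

end

lemma endo_sum: "app (sum f A) v = (\<Sum>x\<in>A. app (f x) v)"
  by (induction A rule: infinite_finite_induct) simp_all

definition left_mult :: "'n falg \<Rightarrow> 'n endo" where
  "left_mult a = Endo (\<lambda>v. a * v)"

lemma app_left_mult [simp]: "app (left_mult a) v = a * v"
proof -
  have "a * (scal s * w) = scal s * (a * w)" for s w
    by (metis mult.assoc scal_central)
  then show ?thesis unfolding left_mult_def by (subst app_Endo) (simp_all add: algebra_simps)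
qed

lemma unital_hom_left_mult: "unital_hom left_mult"
  by (intro unital_homI endo_eqI) (simp_all add: algebra_simps)

lemma left_mult_zero [simp]: "left_mult 0 = 0"
  by (rule unital_hom_zero[OF unital_hom_left_mult])

lemma left_mult_scal_central: "left_mult (scal s) * e = e * left_mult (scal s)"
  by (rule endo_eqI) simp

subsection \<open>Linear maps are determined by words\<close>

text \<open>Modulo h^k every element is a finite combination of words, the remainder is mapped to a
  multiple of h^k, and closedness absorbs it. With the identity operator for \<open>e\<close> this
  is an induction principle for the elements of F.\<close>

lemma endo_words_in:
  assumes "closed_submodule J" "\<And>ws. app e (wd ws) \<in> J"
  shows "app e v \<in> J"
proof (rule closed_h_adic)
  show "closed J" using assms(1) by (simp add: closed_submodule_def)
  fix k
  have const: "app e (fps_const p) \<in> J" for p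
    by (subst fps_const_word_expansion)
       (use assms in \<open>auto simp: app_sum closed_submodule_def intro!: closed_submodule_sum[OF assms(1)]\<close>)
  have dec: "v = (\<Sum>i<k. scal (fps_X ^ i) * fps_const (fps_nth v i)) + fps_X ^ k * fps_shift k v"
  proof (rule fps_ext)
    fix n
    have cut: "fps_nth (\<Sum>i<k. scal (fps_X ^ i) * fps_const (fps_nth v i)) n =
        (\<Sum>i<k. if n = i then fps_nth v i else 0)"
      by (rule trans[OF fps_sum_nth sum.cong]) (auto simp: scal_power fps_X_power_mult_nth)
    show "fps_nth v n = fps_nth ((\<Sum>i<k. scal (fps_X ^ i) * fps_const (fps_nth v i)) + fps_X ^ k * fps_shift k v) n"
      unfolding fps_add_nth cut by (simp add: fps_X_power_mult_nth)
  qed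
  have "app e v = app e (\<Sum>i<k. scal (fps_X ^ i) * fps_const (fps_nth v i)) + fps_X ^ k * app e (fps_shift k v)"
    using arg_cong[OF dec, of "app e"] unfolding app_add app_h_power .
  moreover have "app e (\<Sum>i<k. scal (fps_X ^ i) * fps_const (fps_nth v i)) \<in> J"
    unfolding app_sum app_scal
    by (rule closed_submodule_sum[OF assms(1)]) (use assms(1) const in \<open>auto simp: closed_submodule_def\<close>)
  ultimately show "\<exists>u\<in>J. \<exists>w. app e v = u + fps_X ^ k * w" by blast
qed

lemma endo_eq_on_words:
  assumes "\<And>ws. app e (wd ws) = app e' (wd ws)" shows "e = e'"
proof (rule endo_eqI)
  fix v
  have "app (e - e') v \<in> {0}"
    by (rule endo_words_in[OF closed_submodule_zero]) (simp add: assms)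
  then show "app e v = app e' v" by simp
qed

subsection \<open>Linear extension\<close>

definition weighted_sum :: "(('g gword) \<Rightarrow>\<^sub>0 complex) \<Rightarrow> ('g gword \<Rightarrow> 'g gword \<Rightarrow>\<^sub>0 complex) \<Rightarrow> 'g gword \<Rightarrow>\<^sub>0 complex" where
  "weighted_sum p g = (\<Sum>w\<in>Poly_Mapping.keys p. Poly_Mapping.single 0 (Poly_Mapping.lookup p w) * g w)"

lemma weighted_sum_zero [simp]: "weighted_sum 0 g = 0"
  by (simp add: weighted_sum_def)

lemma weighted_sum_add: "weighted_sum (p + q) g = weighted_sum p g + weighted_sum q g"
  unfolding weighted_sum_def
  by (rule setsum_keys_plus_distrib[where f = "\<lambda>w c. Poly_Mapping.single 0 c * g w"])
     (simp_all add: single_add algebra_simps)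

lemma weighted_sum_sum: "weighted_sum (sum f A) g = (\<Sum>x\<in>A. weighted_sum (f x) g)"
  by (induction A rule: infinite_finite_induct) (simp_all add: weighted_sum_add)

lemma weighted_sum_single: "weighted_sum (Poly_Mapping.single w c) g = Poly_Mapping.single 0 c * g w"
  by (simp add: weighted_sum_def)

lemma weighted_sum_scale: "weighted_sum (Poly_Mapping.single 0 c * p) g = Poly_Mapping.single 0 c * weighted_sum p g"
proof -
  have "weighted_sum (Poly_Mapping.single 0 c * (\<Sum>w\<in>Poly_Mapping.keys p. Poly_Mapping.single w
      (Poly_Mapping.lookup p w))) g =
      Poly_Mapping.single 0 c * weighted_sum p g"
    by (simp add: sum_distrib_left weighted_sum_sum weighted_sum_single mult_single weighted_sum_def[of p]
        flip: mult.assoc)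
  then show ?thesis by (simp flip: poly_mapping_monomial_expansion)
qed

text \<open>The prescribed values on words are themselves series in h, so the coefficient of h^k
  convolves the coefficients of the argument with those of the values.\<close>

definition linear_ext :: "(('n \<times> 'n \<times> nat) list \<Rightarrow> 'n falg) \<Rightarrow> 'n endo" where
  "linear_ext f = Endo (\<lambda>v. Abs_fps (\<lambda>k. \<Sum>i=0..k. weighted_sum (fps_nth v i)
     (\<lambda>w. fps_nth (f (case w of GWord ws \<Rightarrow> ws)) (k - i))))"

lemma app_linear_ext_wd: "app (linear_ext f) (wd ws) = f ws"
proof -
  define g where "g = (\<lambda>l w. fps_nth (f (case w of GWord ws \<Rightarrow> ws)) l)"
  define L where "L v = Abs_fps (\<lambda>k. \<Sum>i=0..k. weighted_sum (fps_nth v i) (g (k - i)))" for v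
  have eq: "linear_ext f = Endo L"
    unfolding linear_ext_def g_def L_def[abs_def] ..
  have "app (linear_ext f) = L"
    unfolding eq
  proof (rule app_Endo)
    show "L (u + v) = L u + L v" for u v
      by (rule fps_ext) (simp add: L_def weighted_sum_add sum.distrib)
    show "L (scal s * v) = scal s * L v" for s v
    proof (rule fps_ext)
      fix k
      show "fps_nth (L (scal s * v)) k = fps_nth (scal s * L v) k"
        using fps_mult_assoc_lemma[of "\<lambda>j i l. Poly_Mapping.single 0 (fps_nth s j) * weighted_sum (fps_nth v i)
            (g l)" k k]
        by (simp add: L_def fps_mult_nth scal_nth weighted_sum_sum weighted_sum_scale sum_distrib_left)
    qed
  qed
  moreover have "L (wd ws) = f ws"
  proof (rule fps_ext)
    fix k
    have "fps_nth (L (wd ws)) k = (\<Sum>i\<in>{0}. weighted_sum (fps_nth (wd ws) i) (g (k - i)))"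
      unfolding L_def fps_nth_Abs_fps by (rule sum.mono_neutral_right) (auto simp: wd_def)
    then show "fps_nth (L (wd ws)) k = fps_nth (f ws) k"
      by (simp add: wd_def weighted_sum_single g_def)
  qed
  ultimately show ?thesis by simp
qed

lemma unital_hom_inverse: "unital_hom g \<Longrightarrow> a * b = 1 \<Longrightarrow> g a * g b = 1"
  using unital_hom_mult[of g a b] unital_hom_one[of g] by simp

section \<open>Substitutions in spectral parameters\<close>

definition center :: "'a::ring_1 set" where
  "center = {a. \<forall>b. a * b = b * a}"

lemma center_commute: "a \<in> center \<Longrightarrow> a * b = b * a"
  by (simp add: center_def)

lemma fps_over_center:
  assumes "f \<in> fps_over center" shows "f \<in> center"
  unfolding center_def
proof (intro CollectI allI fps_ext)
  fix g n
  have "fps_nth (f * g) n = (\<Sum>i=0..n. fps_nth g (n - i) * fps_nth f i)"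
    using assms by (simp add: fps_mult_nth fps_over_def center_def)
  also have "\<dots> = fps_nth (g * f) n"
    unfolding fps_mult_nth by (rule sum.reindex_bij_witness[of _ "\<lambda>i. n - i" "\<lambda>i. n - i"]) auto
  finally show "fps_nth (f * g) n = fps_nth (g * f) n" .
qed

lemma fps_over_mono: "A \<subseteq> C \<Longrightarrow> fps_over A \<subseteq> fps_over C"
  by (auto simp: fps_over_def)

lemma fps_over_UNIV [simp]: "fps_over UNIV = UNIV"
  by (simp add: fps_over_def)

lemma sqm_over_UNIV [simp]: "sqm_over UNIV = UNIV"
  by (simp add: sqm_over_def)

lemma fps_X_central: "fps_X * f = f * (fps_X :: 'a::ring_1 fps)"
  by (simp add: fps_mult_fps_X_commute)

lemma fps_const_mult_fps_X_power: "(fps_const a * fps_X) ^ m = fps_const (a ^ m) * (fps_X :: 'a::ring_1 fps) ^ m"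
proof (induction m)
  case (Suc m)
  have "(fps_const a * fps_X) ^ Suc m = fps_const a * (fps_X * fps_const (a ^ m)) * fps_X ^ m"
    by (simp add: Suc mult.assoc)
  also have "\<dots> = fps_const a * fps_const (a ^ m) * (fps_X * fps_X ^ m)"
    by (simp only: fps_X_central[of "fps_const (a ^ m)"] mult.assoc)
  finally show ?case by simp
qed simp

text \<open>\<open>sub_xy \<iota> u f\<close> is \<open>f(u x y)\<close>, where \<open>\<iota>\<close> embeds the coefficients; \<open>sub_scale\<close> replaces the outer
  variable \<open>y\<close> by \<open>u y\<close> for a new outermost variable \<open>u\<close>.\<close>

definition sub_xy :: "('k::comm_ring_1 \<Rightarrow> 'a::ring_1) \<Rightarrow> 'k \<Rightarrow> 'k fps \<Rightarrow> 'a fps fps" where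
  "sub_xy \<iota> u f = fps_scale (fps_const (\<iota> u) * fps_X) (fps_map (\<lambda>a. fps_const (\<iota> a)) f)"

definition sub_scale :: "'a::ring_1 fps \<Rightarrow> 'a fps fps" where
  "sub_scale f = fps_scale fps_X (fps_map fps_const f)"

lemma unital_hom_sub_xy:
  assumes "unital_hom \<iota>" "range \<iota> \<subseteq> center" shows "unital_hom (sub_xy \<iota> u)"
  unfolding sub_xy_def
proof (rule unital_hom_comp[of "fps_scale _" "fps_map _"])
  show "unital_hom (fps_map (\<lambda>a. fps_const (\<iota> a)))"
    by (rule unital_hom_fps_map[OF unital_hom_comp[OF unital_hom_fps_const assms(1)]])
  have "fps_const (\<iota> u) \<in> center"
    using assms(2) by (intro fps_over_center) (auto simp: fps_over_def center_def)
  then have "fps_const (\<iota> u) * a * fps_X = a * fps_const (\<iota> u) * fps_X" for a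
    by (simp only: center_commute)
  then have "fps_const (\<iota> u) * fps_X * a = a * (fps_const (\<iota> u) * fps_X)" for a
    by (simp only: mult.assoc fps_X_central[of a])
  then show "unital_hom (fps_scale (fps_const (\<iota> u) * fps_X))" by (rule unital_hom_fps_scale)
qed

lemma sub_xy_nth:
  assumes "unital_hom \<iota>"
  shows "fps_nth (fps_nth (sub_xy \<iota> u f) m) r = (if r = m then \<iota> (u ^ m * fps_nth f m) else 0)"
proof -
  have "fps_nth (sub_xy \<iota> u f) m = fps_const (\<iota> (fps_nth f m) * \<iota> u ^ m) * fps_X ^ m"
    by (simp add: sub_xy_def fps_const_mult_fps_X_power flip: mult.assoc fps_const_mult)
  also have "\<iota> (fps_nth f m) * \<iota> u ^ m = \<iota> (fps_nth f m * u ^ m)"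
    by (simp add: unital_hom_mult[OF assms] unital_hom_power[OF assms])
  finally show ?thesis
    by (simp add: fps_X_power_mult_right_nth mult.commute)
qed

lemma unital_hom_sub_scale: "unital_hom sub_scale"
  unfolding sub_scale_def
  by (intro unital_hom_comp[of "fps_scale _" "fps_map _"] unital_hom_fps_map unital_hom_fps_const
      unital_hom_fps_scale fps_X_central)

lemma sub_scale_nth: "fps_nth (fps_nth (sub_scale f) m) r = (if r = m then fps_nth f m else 0)"
  by (simp add: sub_scale_def fps_X_power_mult_right_nth)

lemma sub_scale_const: "sub_scale (fps_const a) = fps_const (fps_const a)"
  by (rule fps_ext, rule fps_ext) (simp add: sub_scale_nth)

lemma sub_scale_in:
  "0 \<in> A \<Longrightarrow> f \<in> fps_over A \<Longrightarrow> sub_scale f \<in> fps_over (fps_over A)"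
  by (simp add: fps_over_def sub_scale_nth)

lemma sub_xy_in:
  assumes "unital_hom \<iota>" shows "sub_xy \<iota> u f \<in> fps_over (fps_over (range \<iota>))"
  using unital_hom_zero[OF assms] by (auto simp: fps_over_def sub_xy_nth[OF assms])

lemma fps_swap_sub_xy:
  assumes "unital_hom \<iota>" shows "fps_swap (sub_xy \<iota> u f) = sub_xy \<iota> u f"
  by (rule fps_ext, rule fps_ext) (simp add: sub_xy_nth[OF assms])

section \<open>The Yang--Baxter equation\<close>

text \<open>\<open>B\<^sub>1\<^sub>2(u) Q\<^sub>1\<^sub>3(u v) Q\<^sub>2\<^sub>3(v) = Q\<^sub>2\<^sub>3(v) Q\<^sub>1\<^sub>3(u v) B\<^sub>1\<^sub>2(u)\<close> with \<open>u\<close> the outer and \<open>v\<close> the inner variable.\<close>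

definition yang_baxter ::
  "('k::ring_1 fps, 'n::finite \<times> 'n) sqm \<Rightarrow> ('k fps, 'n \<times> 'n) sqm \<Rightarrow> bool" where
  "yang_baxter B Q \<longleftrightarrow>
     tri12 (sqm_map (fps_map fps_const) B) * tri13 (sqm_map sub_scale Q) * tri23 (sqm_map fps_const Q) =
     tri23 (sqm_map fps_const Q) * tri13 (sqm_map sub_scale Q) * tri12 (sqm_map (fps_map fps_const) B)"

lemma fps_map_sub_xy:
  assumes \<iota>: "unital_hom \<iota>" "range \<iota> \<subseteq> center"
  shows "fps_map (sub_xy \<iota> u) (fps_map fps_const f) = fps_map (\<lambda>a. fps_const (fps_const (\<iota> a))) f"
    and "fps_map (sub_xy \<iota> u) (sub_scale f) = sub_scale (sub_xy \<iota> u f)"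
    and "fps_map (sub_xy \<iota> u) (fps_const f) = fps_const (sub_xy \<iota> u f)"
proof -
  have 0: "\<iota> 0 = 0" by (rule unital_hom_zero[OF \<iota>(1)])
  show "fps_map (sub_xy \<iota> u) (fps_map fps_const f) = fps_map (\<lambda>a. fps_const (fps_const (\<iota> a))) f"
    by (rule fps_ext, rule fps_ext, rule fps_ext) (simp add: sub_xy_nth[OF \<iota>(1)] 0)
  show "fps_map (sub_xy \<iota> u) (sub_scale f) = sub_scale (sub_xy \<iota> u f)"
    by (rule fps_ext, rule fps_ext, rule fps_ext) (auto simp: sub_xy_nth[OF \<iota>(1)] sub_scale_nth 0)
  show "fps_map (sub_xy \<iota> u) (fps_const f) = fps_const (sub_xy \<iota> u f)"
    by (rule fps_ext, rule fps_ext, rule fps_ext) (auto simp: sub_xy_nth[OF \<iota>(1)] 0)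
qed

text \<open>Replacing the inner variable by \<open>u\<close> y/x leaves three variables: outermost
  the ratio of the parameters of two factors T^+, then the second parameter y, then x^-1. The
  matrices get the arguments that occur when one T^- on leg 3 crosses two factors T^+ on legs 1 and
  2.\<close>

lemma yang_baxter_sub_xy:
  fixes u :: "'k::comm_ring_1" and \<iota> :: "'k \<Rightarrow> 'a::ring_1"
  assumes \<iota>: "unital_hom \<iota>" "range \<iota> \<subseteq> center" and yb: "yang_baxter B Q"
  defines "B12 \<equiv> tri12 (sqm_map (fps_map (\<lambda>a. fps_const (fps_const (\<iota> a)))) B)"
    and "Q13 \<equiv> tri13 (sqm_map (\<lambda>f. sub_scale (sub_xy \<iota> u f)) Q)"
    and "Q23 \<equiv> tri23 (sqm_map (\<lambda>f. fps_const (sub_xy \<iota> u f)) Q)"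
  shows "B12 * Q13 * Q23 = Q23 * Q13 * B12"
proof -
  let ?g = "fps_map (sub_xy \<iota> u)"
  have h: "unital_hom (sqm_map ?g)"
    by (intro unital_hom_sqm_map unital_hom_fps_map unital_hom_sub_xy \<iota>)
  have 0: "?g 0 = 0"
    by (intro unital_hom_zero unital_hom_fps_map unital_hom_sub_xy \<iota>)
  show ?thesis
    using arg_cong[OF yb[unfolded yang_baxter_def], of "sqm_map ?g"]
    by (simp add: unital_hom_mult[OF h] sqm_map_emb[of ?g, OF 0] sqm_map_comp
        fps_map_sub_xy[OF \<iota>] B12_def Q13_def Q23_def)
qed

text \<open>Now the parameter of \<open>B12\<close> is substituted and that of \<open>B23\<close>
  becomes the outermost variable. This is the arrangement for one T^+ on leg 1 and two factors T^-
  on legs 2 and 3.\<close>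

lemma yang_baxter_sub_xy_swap:
  fixes u :: "'k::comm_ring_1" and \<iota> :: "'k \<Rightarrow> 'a::ring_1"
  assumes \<iota>: "unital_hom \<iota>" "range \<iota> \<subseteq> center" and yb: "yang_baxter B B"
  defines "B12 \<equiv> tri12 (sqm_map (\<lambda>f. fps_const (sub_xy \<iota> u f)) B)"
    and "B13 \<equiv> tri13 (sqm_map (\<lambda>f. sub_scale (sub_xy \<iota> u f)) B)"
    and "B23 \<equiv> tri23 (sqm_map (fps_map (\<lambda>a. fps_const (fps_const (\<iota> a)))) B)"
  shows "B12 * B13 * B23 = B23 * B13 * B12"
proof -
  let ?g = "\<lambda>f. fps_map (sub_xy \<iota> u) (fps_swap f)"
  have g: "unital_hom ?g"
    by (rule unital_hom_comp[OF unital_hom_fps_map[OF unital_hom_sub_xy[OF \<iota>]] unital_hom_fps_swap])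
  have h: "unital_hom (sqm_map ?g)"
    by (intro unital_hom_sqm_map g)
  have 0: "?g 0 = 0"
    by (intro unital_hom_zero g)
  have sw: "fps_swap (fps_map fps_const f) = fps_const f" "fps_swap (sub_scale f) = sub_scale f"
    "fps_swap (fps_const f) = fps_map fps_const f" for f :: "'k fps"
    by (rule fps_ext, rule fps_ext, simp add: sub_scale_nth)+
  show ?thesis
    using arg_cong[OF yb[unfolded yang_baxter_def], of "sqm_map ?g"]
    by (simp add: unital_hom_mult[OF h] sqm_map_emb[of ?g, OF 0] sqm_map_comp sw
        fps_map_sub_xy[OF \<iota>] B12_def B13_def B23_def)
qed

section \<open>The operator series on the free algebra\<close>

text \<open>T^+(y) with y as outer variable; the inner variable is reserved for x^-1, in which the
  series is constant. The parameter \<open>g\<close> allows generators to be taken as elements of F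
  or as left multiplications.\<close>

definition gen_series :: "('n falg \<Rightarrow> 'a::ring_1) \<Rightarrow> ('a fps fps, 'n) sqm" where
  "gen_series g = Sqm (\<lambda>i j. Abs_fps (\<lambda>s. fps_const (g (tplus i j (int s)))))"

abbreviation op_scal :: "complex fps \<Rightarrow> 'n endo" where
  "op_scal s \<equiv> left_mult (scal s)"

lemma unital_hom_op_scal: "unital_hom op_scal"
  by (rule unital_hom_comp[OF unital_hom_left_mult unital_hom_scal])

lemma op_scal_central: "range op_scal \<subseteq> center"
  by (auto simp: center_def left_mult_scal_central)

lemma zero_in_op_scal: "0 \<in> range op_scal"
  by (rule range_eqI[of _ _ 0]) simp

text \<open>Abstracts the evaluation of operators at a fixed vector: left multiplications come out
  on the left, while on the right only those by elements of \<open>C\<close>, the scalars, come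
  out.\<close>

definition semilinear :: "('a::ring_1 \<Rightarrow> 'b::ring_1) \<Rightarrow> ('b \<Rightarrow> 'a) \<Rightarrow> 'a set \<Rightarrow> bool" where
  "semilinear l \<phi> C \<longleftrightarrow> (\<forall>x y. \<phi> (x + y) = \<phi> x + \<phi> y) \<and> (\<forall>a x. \<phi> (l a * x) = a * \<phi> x) \<and>
     (\<forall>x. \<forall>c\<in>C. \<phi> (x * l c) = \<phi> x * c)"

lemma semilinear_zero: "semilinear l \<phi> C \<Longrightarrow> \<phi> 0 = 0"
  unfolding semilinear_def by (metis add_cancel_right_right)

lemma semilinear_sum:
  assumes "semilinear l \<phi> C" shows "\<phi> (sum f S) = (\<Sum>x\<in>S. \<phi> (f x))"
proof -
  have "\<phi> (x + y) = \<phi> x + \<phi> y" for x y using assms by (simp add: semilinear_def)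
  then show ?thesis
    by (induction S rule: infinite_finite_induct) (simp_all add: semilinear_zero[OF assms])
qed

lemma semilinear_fps_map:
  assumes "semilinear l \<phi> C" shows "semilinear (fps_map l) (fps_map \<phi>) (fps_over C)"
proof -
  have *: "\<phi> (x + y) = \<phi> x + \<phi> y" "\<phi> (l a * x) = a * \<phi> x" "c \<in> C \<Longrightarrow> \<phi> (x * l c) = \<phi> x * c" for x y a c
    using assms by (simp_all add: semilinear_def)
  show ?thesis
    unfolding semilinear_def
    by (simp add: fps_eq_iff fps_mult_nth * semilinear_sum[OF assms] fps_over_def)
qed

lemma semilinear_sqm_map:
  assumes "semilinear l \<phi> C"
  shows "semilinear (sqm_map l) (sqm_map \<phi> :: ('b::ring_1, 'i::finite) sqm \<Rightarrow> _) (sqm_over C)"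
proof -
  have *: "\<phi> (x + y) = \<phi> x + \<phi> y" "\<phi> (l a * x) = a * \<phi> x" "c \<in> C \<Longrightarrow> \<phi> (x * l c) = \<phi> x * c" for x y a c
    using assms by (simp_all add: semilinear_def)
  show ?thesis
    unfolding semilinear_def
    by (intro conjI allI ballI sqm_eqI)
       (simp_all add: ent_mult * semilinear_sum[OF assms] sqm_over_def)
qed

lemma semilinear_app: "semilinear left_mult (\<lambda>e. app e v) (range scal)"
  unfolding semilinear_def by (auto simp flip: scal_central)

locale exchange =
  fixes Q Qi :: "(complex fps fps, 'n::finite \<times> 'n) sqm" and up um :: "complex fps"
  assumes Q_right: "Q * Qi = 1" and Q_left: "Qi * Q = 1"
begin

text \<open>\<open>word_series ws\<close> is the value of the operator series on the word \<open>ws\<close>.\<close>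

primrec word_series :: "('n \<times> 'n \<times> nat) list \<Rightarrow> ('n falg fps, 'n) sqm" where
  "word_series [] = 1"
| "word_series (w # ws) = Sqm (\<lambda>i j. fps_nth (ent
     (sqm_map (sub_xy scal up) Q * leg1 (gen_series (\<lambda>t. t)) * leg2 (sqm_map fps_const (word_series ws)) *
      sqm_map (sub_xy scal um) Qi) (fst w, i) (fst (snd w), j)) (snd (snd w)))"

definition Tm :: "('n endo fps, 'n) sqm" where
  "Tm = Sqm (\<lambda>i j. Abs_fps (\<lambda>p. linear_ext (\<lambda>ws. fps_nth (ent (word_series ws) i j) p)))"

lemma app_Tm_wd: "app (fps_nth (ent Tm i j) p) (wd ws) = fps_nth (ent (word_series ws) i j) p"
  by (simp add: Tm_def app_linear_ext_wd)

lemma app_Tm_one: "app (fps_nth (ent Tm i j) p) 1 = (if i = j \<and> p = 0 then 1 else 0)"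
  using app_Tm_wd[of i j p "[]"] by (simp add: ent_one)

abbreviation "Qp \<equiv> sqm_map (sub_xy op_scal up) Q :: ('n endo fps fps, 'n \<times> 'n) sqm"
abbreviation "Qm \<equiv> sqm_map (sub_xy op_scal um) Q :: ('n endo fps fps, 'n \<times> 'n) sqm"
abbreviation "Qip \<equiv> sqm_map (sub_xy op_scal up) Qi :: ('n endo fps fps, 'n \<times> 'n) sqm"
abbreviation "Qim \<equiv> sqm_map (sub_xy op_scal um) Qi :: ('n endo fps fps, 'n \<times> 'n) sqm"

lemma unital_hom_sub_xy_op: "unital_hom (sub_xy op_scal u)"
  by (intro unital_hom_sub_xy unital_hom_op_scal op_scal_central)

lemma sub_Q_inverse:
  "sqm_map (sub_xy op_scal u) Q * sqm_map (sub_xy op_scal u) Qi = 1"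
  "sqm_map (sub_xy op_scal u) Qi * sqm_map (sub_xy op_scal u) Q = 1"
  by (rule unital_hom_inverse[OF unital_hom_sqm_map[OF unital_hom_sub_xy_op]], rule Q_right Q_left)+

text \<open>True by construction. On a word, the left side prepends a letter and the right side is
  the recursion of \<open>word_series\<close>; evaluation at the word passes \<open>Qp\<close> and
  the generators, which act by left multiplications, and \<open>Qim\<close>, whose coefficients are
  scalars.\<close>

lemma Tm_exchange_conj:
  "leg2 (sqm_map fps_const Tm) * leg1 (gen_series left_mult) =
   Qp * leg1 (gen_series left_mult) * leg2 (sqm_map fps_const Tm) * Qim"
proof (rule sqm_eqI, rule fps_ext, rule fps_ext, rule endo_eq_on_words)
  fix r r' :: "'n \<times> 'n" and s p ws
  define LL :: "'n falg fps fps \<Rightarrow> 'n endo fps fps" where "LL = fps_map (fps_map left_mult)"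
  define ev :: "'n endo fps fps \<Rightarrow> 'n falg fps fps" where "ev = fps_map (fps_map (\<lambda>e. app e (wd ws)))"
  have sl: "semilinear (sqm_map LL) (sqm_map ev :: (_, 'n \<times> 'n) sqm \<Rightarrow> _) (sqm_over (fps_over (fps_over (range
      scal))))"
    unfolding LL_def ev_def by (intro semilinear_sqm_map semilinear_fps_map semilinear_app)
  have LL_sub: "LL (sub_xy scal u f) = sub_xy op_scal u f" for u f
    unfolding LL_def
    by (rule fps_ext, rule fps_ext) (simp add: sub_xy_nth unital_hom_scal unital_hom_op_scal)
  have LL_gen: "leg1 (gen_series left_mult) = sqm_map LL (leg1 (gen_series (\<lambda>t. t)))"
    unfolding LL_def by (rule sqm_eqI, rule fps_ext, rule fps_ext) (simp add: gen_series_def ent_sqm_emb)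
  have Q: "sqm_map (sub_xy op_scal u) A = sqm_map LL (sqm_map (sub_xy scal u) A)" for u and A :: "(complex fps
      fps, 'n \<times> 'n) sqm"
    by (simp add: sqm_map_comp LL_sub)
  have Cin: "(sqm_map (sub_xy scal um) Qi :: ('n falg fps fps, 'n \<times> 'n) sqm) \<in> sqm_over (fps_over (fps_over
      (range scal)))"
    using sub_xy_in[OF unital_hom_scal] by (auto simp: sqm_over_def)
  have evT: "sqm_map ev (leg2 (sqm_map fps_const Tm)) = leg2 (sqm_map fps_const (word_series ws))"
    unfolding ev_def
    by (rule sqm_eqI, rule fps_ext, rule fps_ext) (simp add: ent_sqm_emb app_Tm_wd)
  have "sqm_map ev (Qp * leg1 (gen_series left_mult) * leg2 (sqm_map fps_const Tm) * Qim) =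
      sqm_map (sub_xy scal up) Q * leg1 (gen_series (\<lambda>t. t)) * leg2 (sqm_map fps_const (word_series ws)) *
      sqm_map (sub_xy scal um) Qi" (is "sqm_map ev ?R = ?R'")
    using sl Cin unfolding LL_gen Q semilinear_def by (simp add: evT mult.assoc)
  then have "ent (sqm_map ev ?R) r r' = ent ?R' r r'" by simp
  then have "app (fps_nth (fps_nth (ent ?R r r') s) p) (wd ws) = fps_nth (fps_nth (ent ?R' r r') s) p"
    by (simp add: ev_def fps_eq_iff)
  also have "\<dots> = app (fps_nth (ent Tm (snd r) (snd r')) p) (wd ((fst r, fst r', s) # ws))"
    by (simp add: app_Tm_wd)
  also have "\<dots> = app (fps_nth (fps_nth (ent (leg2 (sqm_map fps_const Tm) * leg1 (gen_series left_mult)) r r') s)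
      p) (wd ws)"
    by (simp add: ent_mult_leg gen_series_def tplus_wd wd_Cons[of _ ws] fps_mult_right_const_nth)
  finally show "app (fps_nth (fps_nth (ent (leg2 (sqm_map fps_const Tm) * leg1 (gen_series left_mult)) r r') s)
      p) (wd ws) =
      app (fps_nth (fps_nth (ent ?R r r') s) p) (wd ws)" ..
qed

lemma Tm_exchange:
  "leg2 (sqm_map fps_const Tm) * leg1 (gen_series left_mult) * Qm =
   Qp * leg1 (gen_series left_mult) * leg2 (sqm_map fps_const Tm)"
  by (simp add: Tm_exchange_conj mult.assoc sub_Q_inverse)

end

lemma fps_over_subset_center: "A \<subseteq> center \<Longrightarrow> fps_over A \<subseteq> center"
  using fps_over_mono[of A center] fps_over_center by blast

section \<open>Compatibility with the defining relations\<close>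

text \<open>Legs 1 and 2 carry T^+, leg 3 carries T^-. In \<open>b * t1 * t2\<close> the Yang-Baxter
  equation is used after the crossing, with parameter "plus"; in \<open>t2 * t1 * b\<close> before
  it, with parameter "minus". Both terms end with the same outer matrices, so their difference
  crosses as a whole.\<close>

lemma exchange_relator_identity:
  fixes t1 :: "'a::ring_1"
  assumes e1: "t3 * t1 * q13m = q13p * t1 * t3" and e2: "t3 * t2 * q23m = q23p * t2 * t3"
    and c1: "t3 * b = b * t3" and c2: "t2 * q13m = q13m * t2" "t2 * q13p = q13p * t2"
    and c3: "t1 * q23m = q23m * t1" "t1 * q23p = q23p * t1"
    and yp: "b * q13p * q23p = q23p * q13p * b" and ym: "b * q13m * q23m = q23m * q13m * b"
  shows "t3 * (b * t1 * t2 - t2 * t1 * b) * (q13m * q23m) = q23p * q13p * (b * t1 * t2 - t2 * t1 * b) * t3"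
proof -
  \<comment> \<open>Versions of the rules with a trailing factor, so that they also apply in the
    middle of a right-associated product.\<close>
  have tail: "x * (y * w) = z * (z' * w)" if "x * y = z * z'" for x y z z' w :: 'a
    using that by (metis mult.assoc)
  have tail3: "x * (y * (z * w)) = x' * (y' * (z' * w))" if "x * y * z = x' * y' * z'" for x y z x' y' z' w :: 'a
    using that by (metis mult.assoc)
  note rules = mult.assoc e1[unfolded mult.assoc] e2[unfolded mult.assoc] yp[unfolded mult.assoc] ym[unfolded
      mult.assoc]
    c1 c2 c3 tail[OF c1] tail[OF c2(1)] tail[OF c2(2)] tail[OF c3(1)] tail[OF c3(2)]
    tail3[OF e1] tail3[OF e2] tail3[OF yp]
  have 1: "t3 * (b * t1 * t2) * (q13m * q23m) = q23p * q13p * (b * t1 * t2) * t3"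
    by (simp only: rules)
  have 2: "t3 * (t2 * t1 * b) * (q13m * q23m) = q23p * q13p * (t2 * t1 * b) * t3"
    by (simp only: rules)
  show ?thesis by (simp only: left_diff_distrib right_diff_distrib 1 2)
qed

definition coeff_series :: "complex fps fps \<Rightarrow> 'n endo fps fps fps" where
  "coeff_series = fps_map (\<lambda>a. fps_const (fps_const (op_scal a)))"

lemma coeff_series_nth: "fps_nth (coeff_series f) m = fps_const (fps_const (op_scal (fps_nth f m)))"
  by (simp add: coeff_series_def)

text \<open>The generating series of the relators after x = u y, with u outermost and y next. Only
  nonnegative powers occur, which is not so for x/y expanded in x and y.\<close>

definition rel_series :: "(complex fps fps, 'n::finite \<times> 'n) sqm \<Rightarrow> ('n endo fps fps fps, 'n \<times> 'n) sqm" where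
  "rel_series B =
     sqm_map coeff_series B * leg1 (sqm_map sub_scale (gen_series left_mult)) *
       leg2 (sqm_map fps_const (gen_series left_mult)) -
     leg2 (sqm_map fps_const (gen_series left_mult)) * leg1 (sqm_map sub_scale (gen_series left_mult)) *
       sqm_map coeff_series B"

lemma sum_UNIV_pair: "(\<Sum>x\<in>(UNIV :: ('a::finite \<times> 'b::finite) set). f x) = (\<Sum>a\<in>UNIV. \<Sum>b\<in>UNIV. f (a, b))"
  by (simp add: sum.cartesian_product flip: UNIV_Times_UNIV)

text \<open>Under x = u y the monomial x^p y^q becomes u^p y^(p+q), whence the argument
  \<open>int r - int p\<close>. The innermost variable, kept for the T^- that will cross, does not
  occur.\<close>

lemma rel_series_nth:
  fixes B :: "complex fps fps ^ ('n::finite \<times> 'n) ^ ('n \<times> 'n)"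
  shows "fps_nth (fps_nth (fps_nth (ent (rel_series (Sqm (\<lambda>r s. B $ r $ s))) (i, k) (j, l)) p) r) c =
     (if c = 0 then left_mult (rtt_relator B i k j l p (int r - int p)) else 0)"
proof -
  let ?S = "\<lambda>i j. sub_scale (ent (gen_series left_mult) i j) :: 'n endo fps fps fps"
  let ?C = "\<lambda>i j. fps_const (ent (gen_series left_mult) i j) :: 'n endo fps fps fps"
  note L = unital_hom_left_mult
  have gen: "fps_nth (ent (gen_series left_mult) i j) s = fps_const (left_mult (tplus i j (int s)))" for i j ::
      'n and s
    by (simp add: gen_series_def)
  have S: "fps_nth (fps_nth (?S i j) m) s = (if s = m then fps_const (left_mult (tplus i j (int m))) else 0)"
      for i j m s
    by (simp add: sub_scale_nth gen)
  \<comment> \<open>The factor in u y contributes only y^m at u^m. For m > r both sides vanish,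
    since \<open>tplus\<close> is 0 at negative exponents.\<close>
  have SC: "fps_nth (fps_nth (?S i j * ?C i' j') m) r = fps_const (left_mult (tplus i j (int m) * tplus i' j'
      (int r - int m)))"
    for i j i' j' m
  proof -
    have "fps_nth (fps_nth (?S i j * ?C i' j') m) r = (\<Sum>s=0..r. fps_nth (fps_nth (?S i j) m) s * fps_nth (ent
        (gen_series left_mult) i' j') (r - s))"
      unfolding fps_mult_right_const_nth by (simp add: fps_mult_nth)
    also have "\<dots> = (\<Sum>s=0..r. if s = m then fps_const (left_mult (tplus i j (int m))) * fps_const (left_mult
        (tplus i' j' (int (r - m)))) else 0)"
      by (rule sum.cong) (simp_all add: S gen)
    also have "\<dots> = fps_const (left_mult (tplus i j (int m) * tplus i' j' (int r - int m)))"
      by (cases "m \<le> r") (simp_all add: of_nat_diff tplus_neg unital_hom_mult[OF L])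
    finally show ?thesis .
  qed
  have CS: "fps_nth (fps_nth (?C i' j' * ?S i j) m) r = fps_const (left_mult (tplus i' j' (int r - int m) *
      tplus i j (int m)))"
    for i j i' j' m
  proof -
    have "fps_nth (fps_nth (?C i' j' * ?S i j) m) r = (\<Sum>s=0..r. fps_nth (ent (gen_series left_mult) i' j') s *
        fps_nth (fps_nth (?S i j) m) (r - s))"
      unfolding fps_mult_left_const_nth by (simp add: fps_mult_nth)
    also have "\<dots> = (\<Sum>s=0..r. fps_nth (ent (gen_series left_mult) i' j') (r - s) * fps_nth (fps_nth (?S i j) m) s)"
      by (rule sum.reindex_bij_witness[of _ "\<lambda>s. r - s" "\<lambda>s. r - s"]) auto
    also have "\<dots> = (\<Sum>s=0..r. if s = m then fps_const (left_mult (tplus i' j' (int (r - m)))) * fps_const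
        (left_mult (tplus i j (int m))) else 0)"
      by (rule sum.cong) (simp_all add: S gen)
    also have "\<dots> = fps_const (left_mult (tplus i' j' (int r - int m) * tplus i j (int m)))"
      by (cases "m \<le> r") (simp_all add: of_nat_diff tplus_neg unital_hom_mult[OF L])
    finally show ?thesis .
  qed
  have B1: "fps_nth (fps_nth (coeff_series f * (?S i j * ?C i' j')) p) r =
      fps_const (left_mult (\<Sum>m\<le>p. scal (fps_nth f m) * tplus i j (int p - int m) * tplus i' j' (int r - int p +
          int m)))"
    for f i j i' j'
  proof -
    have "fps_nth (fps_nth (coeff_series f * (?S i j * ?C i' j')) p) r =
        (\<Sum>m\<le>p. fps_const (op_scal (fps_nth f m)) * fps_nth (fps_nth (?S i j * ?C i' j') (p - m)) r)"
      unfolding fps_mult_nth[of "coeff_series f"] by (simp add: fps_sum_nth coeff_series_nth atLeast0AtMost)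
    also have "\<dots> = (\<Sum>m\<le>p. fps_const (left_mult (scal (fps_nth f m) * tplus i j (int p - int m) * tplus i' j'
        (int r - int p + int m))))"
      by (rule sum.cong[OF refl], simp only: SC) (simp add: of_nat_diff unital_hom_mult[OF L] mult.assoc
          algebra_simps)
    also have "\<dots> = fps_const (left_mult (\<Sum>m\<le>p. scal (fps_nth f m) * tplus i j (int p - int m) * tplus i' j' (int
        r - int p + int m)))"
      by (simp add: unital_hom_sum[OF L] unital_hom_sum[OF unital_hom_fps_const])
    finally show ?thesis .
  qed
  have B2: "fps_nth (fps_nth (?C i' j' * ?S i j * coeff_series f) p) r =
      fps_const (left_mult (\<Sum>m\<le>p. tplus i' j' (int r - int p + int m) * tplus i j (int p - int m) * scal
          (fps_nth f m)))"
    for f i j i' j'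
  proof -
    have "fps_nth (fps_nth (?C i' j' * ?S i j * coeff_series f) p) r =
        (\<Sum>m\<le>p. fps_nth (fps_nth (?C i' j' * ?S i j) m) r * fps_const (op_scal (fps_nth f (p - m))))"
      unfolding fps_mult_nth[of _ "coeff_series f"] by (simp add: fps_sum_nth coeff_series_nth atLeast0AtMost)
    also have "\<dots> = (\<Sum>m\<le>p. fps_nth (fps_nth (?C i' j' * ?S i j) (p - m)) r * fps_const (op_scal (fps_nth f m)))"
      by (rule sum.reindex_bij_witness[of _ "\<lambda>s. p - s" "\<lambda>s. p - s"]) auto
    also have "\<dots> = (\<Sum>m\<le>p. fps_const (left_mult (tplus i' j' (int r - int p + int m) * tplus i j (int p - int m)
        * scal (fps_nth f m))))"
      by (rule sum.cong[OF refl], simp only: CS) (simp add: of_nat_diff unital_hom_mult[OF L] mult.assoc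
          algebra_simps)
    also have "\<dots> = fps_const (left_mult (\<Sum>m\<le>p. tplus i' j' (int r - int p + int m) * tplus i j (int p - int m) *
        scal (fps_nth f m)))"
      by (simp add: unital_hom_sum[OF L] unital_hom_sum[OF unital_hom_fps_const])
    finally show ?thesis .
  qed
  let ?B = "Sqm (\<lambda>r s. B $ r $ s)"
  have "ent (rel_series ?B) (i, k) (j, l) =
      (\<Sum>a\<in>UNIV. \<Sum>b\<in>UNIV. coeff_series (B $ (i, k) $ (a, b)) * (?S a j * ?C b l)) -
      (\<Sum>a\<in>UNIV. \<Sum>b\<in>UNIV. ?C k b * ?S i a * coeff_series (B $ (a, b) $ (j, l)))"
    unfolding rel_series_def ent_diff mult.assoc[of "sqm_map coeff_series ?B"]
    unfolding ent_mult[of "sqm_map coeff_series ?B"] ent_mult[of _ "sqm_map coeff_series ?B"] ent_mult_leg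
    by (simp add: sum_UNIV_pair)
  then have "fps_nth (fps_nth (ent (rel_series ?B) (i, k) (j, l)) p) r =
      fps_const (left_mult (rtt_relator B i k j l p (int r - int p)))"
    by (simp add: fps_sum_nth B1 B2 rtt_relator_def unital_hom_sum[OF L] unital_hom_diff[OF L]
        unital_hom_sum[OF unital_hom_fps_const] unital_hom_diff[OF unital_hom_fps_const] sum.swap[of _ UNIV "{..p}"])
  then show ?thesis by simp
qed

context exchange
begin

text \<open>Cancelling the two matrices \<open>Q\<close> on the right of the crossing identity
  writes T^- times the relators as scalars times relators times operators, which stays in
  \<open>I\<close>. The set in view consists of the operators that map F into J.\<close>

lemma Tm_relator:
  fixes B' :: "complex fps fps ^ ('n \<times> 'n) ^ ('n \<times> 'n)"
  defines "B \<equiv> Sqm (\<lambda>r s. B' $ r $ s)"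
  assumes yb: "yang_baxter B Q" and I: "bimod (range op_scal) I UNIV"
    and rel: "\<And>i k j l p q. left_mult (rtt_relator B' i k j l p q) \<in> I"
  shows "fps_nth (ent Tm i j) c * left_mult (rtt_relator B' i' k' j' l' p (int n - int p)) \<in> I"
proof -
  have relB: "rel_series B \<in> sqm_over (fps_over (fps_over (fps_over I)))"
    using rel bimod_zero[OF I] by (auto simp: sqm_over_def fps_over_def B_def rel_series_nth)
  let ?A = "fps_over (fps_over (fps_over (range op_scal))) :: 'n endo fps fps fps set"
  let ?h = "\<lambda>u f. sub_scale (sub_xy op_scal u f) :: 'n endo fps fps fps"
  let ?k = "\<lambda>u f. fps_const (sub_xy op_scal u f) :: 'n endo fps fps fps"
  have 0: "0 \<in> range (op_scal :: _ \<Rightarrow> 'n endo)" by (rule zero_in_op_scal)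
  have cen: "a * b = b * a" if "a \<in> ?A" for a b
  proof -
    have "?A \<subseteq> center" by (intro fps_over_subset_center op_scal_central)
    then show ?thesis using that by (blast intro: center_commute)
  qed
  have h: "?h u f \<in> ?A" for u f
    by (intro sub_scale_in sub_xy_in unital_hom_op_scal fps_over_zero 0)
  have k: "?k u f \<in> ?A" for u f
    by (intro fps_over_const sub_xy_in unital_hom_op_scal fps_over_zero 0)
  have cs: "coeff_series f \<in> ?A" for f
    using 0 by (simp add: coeff_series_def fps_over_def)
  define t1 where "t1 = tri1 (sqm_map sub_scale (gen_series left_mult :: ('n endo fps fps, 'n) sqm))"
  define t2 where "t2 = tri2 (sqm_map fps_const (gen_series left_mult :: ('n endo fps fps, 'n) sqm))"
  define t3 where "t3 = tri3 (sqm_map (\<lambda>a. fps_const (fps_const a)) Tm)"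
  define b where "b = tri12 (sqm_map (coeff_series :: _ \<Rightarrow> 'n endo fps fps fps) B)"
  define q13 where "q13 u = tri13 (sqm_map (?h u) Q)" for u
  define q23 where "q23 u = tri23 (sqm_map (?k u) Q)" for u
  note homs = unital_hom_sqm_map[OF unital_hom_sub_scale, THEN unital_hom_mult]
    unital_hom_sqm_map[OF unital_hom_fps_const, THEN unital_hom_mult]
  note embs = sqm_map_emb[of sub_scale, OF unital_hom_zero[OF unital_hom_sub_scale]]
    sqm_map_emb[of fps_const, OF unital_hom_zero[OF unital_hom_fps_const]]
  have e1: "t3 * t1 * q13 um = q13 up * t1 * t3"
    using arg_cong[OF Tm_exchange, of "\<lambda>M. tri13 (sqm_map sub_scale M)"]
    by (simp add: homs embs leg_mult tri_leg sqm_map_comp sub_scale_const t1_def t3_def q13_def)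
  have e2: "t3 * t2 * q23 um = q23 up * t2 * t3"
    using arg_cong[OF Tm_exchange, of "\<lambda>M. tri23 (sqm_map fps_const M)"]
    by (simp add: homs embs leg_mult tri_leg sqm_map_comp t2_def t3_def q23_def)
  have c1: "t3 * b = b * t3"
    unfolding t3_def b_def by (rule disjoint_legs_commute[OF leg_bij(4)]) (simp add: cen[OF cs])
  have c2: "t2 * q13 u = q13 u * t2" for u
    unfolding t2_def q13_def by (rule disjoint_legs_commute[OF leg_bij(3)]) (simp add: cen[OF h])
  have c3: "t1 * q23 u = q23 u * t1" for u
    unfolding t1_def q23_def by (rule disjoint_legs_commute[OF leg_bij(1)]) (simp add: cen[OF k])
  have y: "b * q13 u * q23 u = q23 u * q13 u * b" for u
    unfolding b_def q13_def q23_def coeff_series_def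
    by (rule yang_baxter_sub_xy[OF unital_hom_op_scal op_scal_central yb])
  have rel3: "tri12 (rel_series B) = b * t1 * t2 - t2 * t1 * b"
    unfolding rel_series_def
    by (simp add: unital_hom_diff[OF unital_hom_leg(5)] leg_mult tri_leg b_def t1_def t2_def)
  have main: "t3 * tri12 (rel_series B) * (q13 um * q23 um) = q23 up * q13 up * tri12 (rel_series B) * t3"
    unfolding rel3 by (rule exchange_relator_identity[OF e1 e2 c1 c2 c2 c3 c3 y y])
  define z13 where "z13 = tri13 (sqm_map (?h um) Qi)"
  define z23 where "z23 = tri23 (sqm_map (?k um) Qi)"
  have i13: "q13 um * z13 = 1"
    unfolding q13_def z13_def
    by (rule unital_hom_inverse[OF unital_hom_leg(6) unital_hom_inverse[OF unital_hom_sqm_map[OF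
            unital_hom_comp[OF unital_hom_sub_scale unital_hom_sub_xy_op]] Q_right]])
  have i23: "q23 um * z23 = 1"
    unfolding q23_def z23_def
    by (rule unital_hom_inverse[OF unital_hom_leg(2) unital_hom_inverse[OF unital_hom_sqm_map[OF
            unital_hom_comp[OF unital_hom_fps_const unital_hom_sub_xy_op]] Q_right]])
  have "t3 * tri12 (rel_series B) = t3 * tri12 (rel_series B) * q13 um * (q23 um * z23) * z13"
    by (simp add: i23 i13 mult.assoc)
  also have "\<dots> = t3 * tri12 (rel_series B) * (q13 um * q23 um) * (z23 * z13)" by (simp only: mult.assoc)
  also have "\<dots> = (q23 up * (q13 up * tri12 (rel_series B))) * (t3 * (z23 * z13))"
    unfolding main by (simp only: mult.assoc)
  finally have eq: "t3 * tri12 (rel_series B) = (q23 up * (q13 up * tri12 (rel_series B))) * (t3 * (z23 * z13))" .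
  have bm: "bimod (sqm_over ?A) (sqm_over (fps_over (fps_over (fps_over I)))) UNIV"
    using bimod_sqm_over[OF bimod_fps_over[OF bimod_fps_over[OF bimod_fps_over[OF I]]]] by simp
  have zA: "0 \<in> ?A" by (intro fps_over_zero 0)
  have "t3 * tri12 (rel_series B) \<in> sqm_over (fps_over (fps_over (fps_over I)))"
    unfolding eq
  proof (rule bimod_right[OF bm bimod_left[OF bm _ bimod_left[OF bm]] UNIV_I])
    show "q23 up \<in> sqm_over ?A" "q13 up \<in> sqm_over ?A"
      unfolding q23_def q13_def by (rule sqm_over_emb[OF zA], simp only: sqm_over_def ent_sqm_map h k
          mem_Collect_eq simp_thms)+
    show "tri12 (rel_series B) \<in> sqm_over (fps_over (fps_over (fps_over I)))"
      by (intro sqm_over_emb relB fps_over_zero bimod_zero[OF I])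
  qed
  \<comment> \<open>T^- and the relators act on disjoint legs, so one entry of the matrix product is
    one product of entries, with no sum to separate.\<close>
  then have "ent (t3 * tri12 (rel_series B)) (i', k', i) (j', l', j) \<in> fps_over (fps_over (fps_over I))"
    by (simp add: sqm_over_def)
  then have "fps_const (fps_const (ent Tm i j)) * ent (rel_series B) (i', k') (j', l') \<in> fps_over (fps_over
      (fps_over I))"
    unfolding t3_def ent_mult_leg by simp
  then have "fps_nth (ent Tm i j * fps_nth (fps_nth (ent (rel_series B) (i', k') (j', l')) p) n) c \<in> I"
    by (simp add: fps_over_def fps_mult_left_const_nth)
  moreover have "fps_nth (fps_nth (ent (rel_series B) (i', k') (j', l')) p) n =
      fps_const (left_mult (rtt_relator B' i' k' j' l' p (int n - int p)))"
    unfolding B_def by (rule fps_ext) (simp add: rel_series_nth)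
  ultimately show ?thesis by (simp add: fps_mult_right_const_nth)
qed

end

section \<open>The RTT relation for the operator series\<close>

text \<open>The counterpart of \<open>exchange_relator_identity\<close> with two factors T^- on legs
  2 and 3 crossing one T^+ on leg 1. The failure of the RTT relation for T^- thus crosses T^+ as a
  whole.\<close>

lemma exchange_rtt_identity:
  fixes t1 :: "'a::ring_1"
  assumes e1: "t2 * t1 * q12m = q12p * t1 * t2" and e2: "t3 * t1 * q13m = q13p * t1 * t3"
    and c1: "b * t1 = t1 * b" and c2: "t2 * q13m = q13m * t2" "t2 * q13p = q13p * t2"
    and c3: "t3 * q12m = q12m * t3" "t3 * q12p = q12p * t3"
    and yp: "b * q13p * q12p = q12p * q13p * b" and ym: "b * q13m * q12m = q12m * q13m * b"
  shows "(b * t2 * t3 - t3 * t2 * b) * t1 * (q13m * q12m) = q12p * q13p * t1 * (b * t2 * t3 - t3 * t2 * b)"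
proof -
  have tail: "x * (y * w) = z * (z' * w)" if "x * y = z * z'" for x y z z' w :: 'a
    using that by (metis mult.assoc)
  have tail3: "x * (y * (z * w)) = x' * (y' * (z' * w))" if "x * y * z = x' * y' * z'" for x y z x' y' z' w :: 'a
    using that by (metis mult.assoc)
  note rules = mult.assoc e1[unfolded mult.assoc] e2[unfolded mult.assoc] yp[unfolded mult.assoc] ym[unfolded
      mult.assoc]
    c1 c2 c3 tail[OF c1] tail[OF c2(1)] tail[OF c2(2)] tail[OF c3(1)] tail[OF c3(2)]
    tail3[OF e1] tail3[OF e2] tail3[OF yp]
  have 1: "b * t2 * t3 * t1 * (q13m * q12m) = q12p * q13p * t1 * (b * t2 * t3)"
    by (simp only: rules)
  have 2: "t3 * t2 * b * t1 * (q13m * q12m) = q12p * q13p * t1 * (t3 * t2 * b)"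
    by (simp only: rules)
  show ?thesis by (simp only: left_diff_distrib right_diff_distrib 1 2)
qed

definition annihilator :: "'n falg \<Rightarrow> 'n endo set" where
  "annihilator v = {e. app e v = 0}"

lemma bimod_annihilator: "bimod UNIV (annihilator v) (range op_scal)"
  by (auto simp: bimod_def annihilator_def)

lemma bimod_diff:
  assumes "bimod UNIV I C" "x \<in> I" "y \<in> I" shows "x - y \<in> I"
proof -
  have "-1 * y \<in> I" using assms by (intro bimod_left[of UNIV I C]) auto
  then have "x + -1 * y \<in> I" using assms by (simp only: bimod_def)
  then show ?thesis by simp
qed

lemma bimod_add: "bimod A I C \<Longrightarrow> x \<in> I \<Longrightarrow> y \<in> I \<Longrightarrow> x + y \<in> I"
  by (simp add: bimod_def)

lemma fps_over_ann_eq: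
  assumes "\<And>ws. e \<in> fps_over (annihilator (wd ws))" shows "e = 0"
proof (rule fps_ext)
  fix n
  show "fps_nth e n = fps_nth 0 n"
    by (rule endo_eq_on_words) (use assms in \<open>simp add: fps_over_def annihilator_def\<close>)
qed

definition scal_series :: "complex fps fps \<Rightarrow> 'n endo fps fps" where
  "scal_series = fps_map (\<lambda>a. fps_const (op_scal a))"

lemma scal_series_nth: "fps_nth (scal_series f) m = fps_const (op_scal (fps_nth f m))"
  by (simp add: scal_series_def)

context exchange
begin

lemma Tm_minus_one_ann: "Tm - 1 \<in> sqm_over (fps_over (annihilator 1))"
  by (auto simp: sqm_over_def fps_over_def annihilator_def app_Tm_one ent_one)

text \<open>The outermost variable is u = x/y and the inner one is 1/x; as 1/y = u/x, the first T^-
  is constant in u and the second is rescaled by u. The difference \<open>D\<close> of the two sides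
  kills 1, and because it crosses T^+ it kills a word as soon as it kills the tail of that
  word.\<close>

lemma Tm_RTT:
  assumes yb: "yang_baxter Q Q"
  shows "sqm_map scal_series Q * leg1 (sqm_map fps_const Tm) * leg2 (sqm_map sub_scale Tm) =
    leg2 (sqm_map sub_scale Tm) * leg1 (sqm_map fps_const Tm) * sqm_map scal_series Q"
proof -
  let ?A = "fps_over (fps_over (fps_over (range op_scal))) :: 'n endo fps fps fps set"
  let ?h = "\<lambda>u f. sub_scale (sub_xy op_scal u f) :: 'n endo fps fps fps"
  let ?k = "\<lambda>u f. fps_const (sub_xy op_scal u f) :: 'n endo fps fps fps"
  let ?N = "\<lambda>v. fps_over (fps_over (annihilator v)) :: 'n endo fps fps set"
  define bb where "bb = sqm_map (scal_series :: _ \<Rightarrow> 'n endo fps fps) Q"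
  define D where "D = bb * leg1 (sqm_map fps_const Tm) * leg2 (sqm_map sub_scale Tm) -
    leg2 (sqm_map sub_scale Tm) * leg1 (sqm_map fps_const Tm) * bb"
  have 0: "0 \<in> range (op_scal :: _ \<Rightarrow> 'n endo)" by (rule zero_in_op_scal)
  have base: "D \<in> sqm_over (?N 1)"
  proof -
    note bm = bimod_sqm_over[where 'i = "'n \<times> 'n", OF bimod_fps_over[OF bimod_fps_over[OF bimod_annihilator[of
        1]]], simplified]
    have z: "0 \<in> fps_over (annihilator 1)" "0 \<in> ?N 1" by (simp_all add: fps_over_def annihilator_def)
    have "sqm_map fps_const (Tm - 1) \<in> sqm_over (?N 1)" "sqm_map sub_scale (Tm - 1) \<in> sqm_over (?N 1)"
      using Tm_minus_one_ann z
      by (auto simp: sqm_over_def simp del: ent_diff intro!: fps_over_const sub_scale_in) (simp add: annihilator_def)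
    then have "leg1 (sqm_map fps_const (Tm - 1)) \<in> sqm_over (?N 1)" "leg2 (sqm_map sub_scale (Tm - 1)) \<in>
        sqm_over (?N 1)"
      by (auto intro: sqm_over_emb z)
    then have d: "leg1 (sqm_map fps_const Tm) - 1 \<in> sqm_over (?N 1)" "leg2 (sqm_map sub_scale Tm) - 1 \<in> sqm_over
        (?N 1)"
      by (simp_all add: unital_hom_diff[OF unital_hom_leg(1)] unital_hom_diff[OF unital_hom_leg(2)]
          unital_hom_diff[OF unital_hom_sqm_map[OF unital_hom_fps_const]]
          unital_hom_diff[OF unital_hom_sqm_map[OF unital_hom_sub_scale]]
          unital_hom_one[OF unital_hom_leg(1)] unital_hom_one[OF unital_hom_leg(2)]
          unital_hom_one[OF unital_hom_sqm_map[OF unital_hom_fps_const]]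
          unital_hom_one[OF unital_hom_sqm_map[OF unital_hom_sub_scale]])
    have bb: "bb \<in> sqm_over (fps_over (fps_over (range op_scal)))"
      using 0 by (simp add: bb_def sqm_over_def fps_over_def scal_series_nth)
    \<comment> \<open>Telescoping: each summand contains T^- minus 1, which kills 1, followed at
      most by scalars; the two remaining copies of \<open>bb\<close> cancel.\<close>
    have D': "D = bb * leg1 (sqm_map fps_const Tm) * (leg2 (sqm_map sub_scale Tm) - 1) + bb * (leg1 (sqm_map
        fps_const Tm) - 1)
       - (leg2 (sqm_map sub_scale Tm) * ((leg1 (sqm_map fps_const Tm) - 1) * bb) + (leg2 (sqm_map sub_scale Tm)
           - 1) * bb)"
      by (simp add: D_def algebra_simps)
    show ?thesis
      unfolding D'
      by (intro bimod_diff[OF bm] bimod_add[OF bm] bimod_left[OF bm] bimod_right[OF bm] UNIV_I d bb)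
  qed
  \<comment> \<open>The variables are now u, 1/x, y from the outside in, so the series T^+(y),
    stored with y outside, has to be swapped.\<close>
  define t1 where "t1 = tri1 (sqm_map (\<lambda>f. fps_const (fps_swap f)) (gen_series left_mult :: ('n endo fps fps,
      'n) sqm))"
  define t2 where "t2 = tri2 (sqm_map (\<lambda>a. fps_const (fps_map fps_const a)) Tm)"
  define t3 where "t3 = tri3 (sqm_map (\<lambda>a. sub_scale (fps_map fps_const a)) Tm)"
  define b where "b = tri23 (sqm_map (coeff_series :: _ \<Rightarrow> 'n endo fps fps fps) Q)"
  define q12 where "q12 u = tri12 (sqm_map (?k u) Q)" for u
  define q13 where "q13 u = tri13 (sqm_map (?h u) Q)" for u
  have cen: "a * b = b * a" if "a \<in> ?A" for a b
  proof -
    have "?A \<subseteq> center" by (intro fps_over_subset_center op_scal_central)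
    then show ?thesis using that by (blast intro: center_commute)
  qed
  have h: "?h u f \<in> ?A" for u f
    by (intro sub_scale_in sub_xy_in unital_hom_op_scal fps_over_zero 0)
  have k: "?k u f \<in> ?A" for u f
    by (intro fps_over_const sub_xy_in unital_hom_op_scal fps_over_zero 0)
  have cs: "coeff_series f \<in> ?A" for f
    using 0 by (simp add: coeff_series_nth fps_over_def)
  have g: "unital_hom (\<lambda>f. fps_const (fps_swap f))" "unital_hom (\<lambda>f. sub_scale (fps_swap f))"
    by (rule unital_hom_comp[OF unital_hom_fps_const unital_hom_fps_swap]
             unital_hom_comp[OF unital_hom_sub_scale unital_hom_fps_swap])+
  note homs = g[THEN unital_hom_sqm_map, THEN unital_hom_mult]
  note embs = sqm_map_emb[of "\<lambda>f. fps_const (fps_swap f)", OF unital_hom_zero[OF g(1)]]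
    sqm_map_emb[of "\<lambda>f. sub_scale (fps_swap f)", OF unital_hom_zero[OF g(2)]]
  have sw: "fps_swap (fps_const a) = fps_map fps_const a" for a :: "'n endo fps"
    by (rule fps_ext, rule fps_ext) simp
  \<comment> \<open>T^+ is constant in 1/x, so rescaling 1/x by u leaves it unchanged and one
    \<open>t1\<close> serves both crossings.\<close>
  have gen: "sqm_map (\<lambda>f. sub_scale (fps_swap f)) (gen_series left_mult) =
      sqm_map (\<lambda>f. fps_const (fps_swap f)) (gen_series left_mult :: ('n endo fps fps, 'n) sqm)"
    by (rule sqm_eqI, rule fps_ext, rule fps_ext, rule fps_ext) (simp add: gen_series_def sub_scale_nth)
  have e1: "t2 * t1 * q12 um = q12 up * t1 * t2"
    using arg_cong[OF Tm_exchange, of "\<lambda>M. tri12 (sqm_map (\<lambda>f. fps_const (fps_swap f)) M)"]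
    by (simp add: homs embs leg_mult tri_leg sqm_map_comp sw fps_swap_sub_xy[OF unital_hom_op_scal] t1_def
        t2_def q12_def)
  have e2: "t3 * t1 * q13 um = q13 up * t1 * t3"
    using arg_cong[OF Tm_exchange, of "\<lambda>M. tri13 (sqm_map (\<lambda>f. sub_scale (fps_swap f)) M)"]
    by (simp add: homs embs leg_mult tri_leg sqm_map_comp sw gen fps_swap_sub_xy[OF unital_hom_op_scal] t1_def
        t3_def q13_def)
  have c1: "b * t1 = t1 * b"
    unfolding t1_def b_def by (rule disjoint_legs_commute[OF leg_bij(2)]) (simp add: cen[OF cs])
  have c2: "t2 * q13 u = q13 u * t2" for u
    unfolding t2_def q13_def by (rule disjoint_legs_commute[OF leg_bij(3)]) (simp add: cen[OF h])
  have c3: "t3 * q12 u = q12 u * t3" for u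
    unfolding t3_def q12_def by (rule disjoint_legs_commute[OF leg_bij(4)]) (simp add: cen[OF k])
  have y: "b * q13 u * q12 u = q12 u * q13 u * b" for u
    unfolding b_def q13_def q12_def coeff_series_def
    by (rule yang_baxter_sub_xy_swap[OF unital_hom_op_scal op_scal_central yb, symmetric])
  let ?c3 = "fps_map (fps_map fps_const) :: 'n endo fps fps \<Rightarrow> 'n endo fps fps fps"
  have c3hom: "unital_hom ?c3" by (intro unital_hom_fps_map unital_hom_fps_const)
  have c3s: "?c3 (fps_const a) = fps_const (fps_map fps_const a)" "?c3 (sub_scale a) = sub_scale (fps_map
      fps_const a)"
    "?c3 (scal_series f) = coeff_series f" for a f
    by (rule fps_ext, rule fps_ext, rule fps_ext, simp add: sub_scale_nth scal_series_nth coeff_series_nth)+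
  have D3: "tri23 (sqm_map ?c3 D) = b * t2 * t3 - t3 * t2 * b"
    unfolding D_def bb_def
    by (simp add: unital_hom_diff[OF unital_hom_sqm_map[OF c3hom]] unital_hom_mult[OF unital_hom_sqm_map[OF c3hom]]
        sqm_map_emb[of ?c3, OF unital_hom_zero[OF c3hom]] unital_hom_diff[OF unital_hom_leg(2)] leg_mult tri_leg
        sqm_map_comp c3s b_def t2_def t3_def)
  have main: "tri23 (sqm_map ?c3 D) * t1 * (q13 um * q12 um) = q12 up * q13 up * t1 * tri23 (sqm_map ?c3 D)"
    unfolding D3 by (rule exchange_rtt_identity[OF e1 e2 c1 c2 c2 c3 c3 y y])
  define z12 where "z12 = tri12 (sqm_map (?k um) Qi)"
  define z13 where "z13 = tri13 (sqm_map (?h um) Qi)"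
  have i13: "q13 um * z13 = 1"
    unfolding q13_def z13_def
    by (rule unital_hom_inverse[OF unital_hom_leg(6) unital_hom_inverse[OF unital_hom_sqm_map[OF
            unital_hom_comp[OF unital_hom_sub_scale unital_hom_sub_xy_op]] Q_right]])
  have i12: "q12 um * z12 = 1"
    unfolding q12_def z12_def
    by (rule unital_hom_inverse[OF unital_hom_leg(5) unital_hom_inverse[OF unital_hom_sqm_map[OF
            unital_hom_comp[OF unital_hom_fps_const unital_hom_sub_xy_op]] Q_right]])
  have "tri23 (sqm_map ?c3 D) * t1 = tri23 (sqm_map ?c3 D) * t1 * q13 um * (q12 um * z12) * z13"
    by (simp add: i12 i13 mult.assoc)
  also have "\<dots> = tri23 (sqm_map ?c3 D) * t1 * (q13 um * q12 um) * (z12 * z13)" by (simp only: mult.assoc)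
  also have "\<dots> = ((q12 up * q13 up * t1) * tri23 (sqm_map ?c3 D)) * z12 * z13" 
    unfolding main by (simp only: mult.assoc)
  finally have eq: "tri23 (sqm_map ?c3 D) * t1 = ((q12 up * q13 up * t1) * tri23 (sqm_map ?c3 D)) * z12 * z13" .
  have zA: "0 \<in> ?A" by (intro fps_over_zero 0)
  have words: "D \<in> sqm_over (?N (wd ws))" for ws
  proof (induction ws)
    case Nil
    then show ?case using base by simp
  next
    case (Cons w ws)
    let ?I = "annihilator (wd ws)"
    note bm = bimod_sqm_over[where 'i = "'n \<times> 'n \<times> 'n", OF bimod_fps_over[OF bimod_fps_over[OF bimod_fps_over[OF
        bimod_annihilator[of "wd ws"]]]], simplified]
    have z: "0 \<in> ?I" by (simp add: annihilator_def)
    have "?c3 f \<in> fps_over (fps_over (fps_over ?I))" if "f \<in> fps_over (fps_over ?I)" for f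
      using that z by (simp add: fps_over_def)
    then have "sqm_map ?c3 D \<in> sqm_over (fps_over (fps_over (fps_over ?I)))"
      using Cons by (simp add: sqm_over_def)
    then have "tri23 (sqm_map ?c3 D) \<in> sqm_over (fps_over (fps_over (fps_over ?I)))"
      by (intro sqm_over_emb fps_over_zero z)
    then have "tri23 (sqm_map ?c3 D) * t1 \<in> sqm_over (fps_over (fps_over (fps_over ?I)))"
      unfolding eq
    proof (rule bimod_right[OF bm bimod_right[OF bm bimod_left[OF bm UNIV_I]]])
      show "z12 \<in> sqm_over ?A" "z13 \<in> sqm_over ?A"
        unfolding z12_def z13_def by (rule sqm_over_emb[OF zA], simp only: sqm_over_def ent_sqm_map h k
            mem_Collect_eq simp_thms)+
    qed
    then have "ent (tri23 (sqm_map ?c3 D) * t1) (fst w, r) (fst (snd w), s) \<in> fps_over (fps_over (fps_over ?I))"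
        for r s
      unfolding sqm_over_def by blast
    then have "?c3 (ent D r s) * fps_const (fps_swap (ent (gen_series left_mult) (fst w) (fst (snd w)))) \<in>
        fps_over (fps_over (fps_over ?I))" for r s
      unfolding t1_def ent_mult_leg by simp
    moreover have "fps_swap (ent (gen_series left_mult :: ('n endo fps fps, 'n) sqm) i j) = fps_const (Abs_fps
        (\<lambda>s. left_mult (tplus i j (int s))))" for i j
      by (rule fps_ext, rule fps_ext) (simp add: gen_series_def)
    ultimately have "fps_nth (fps_nth (ent D r s) m) n * left_mult (tplus (fst w) (fst (snd w)) (int (snd (snd
        w)))) \<in> ?I" for r s m n
      by (auto simp: fps_over_def fps_mult_right_const_nth fps_mult_left_const_nth)
    then show ?case
      by (simp add: sqm_over_def fps_over_def annihilator_def tplus_wd wd_Cons[of w ws])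
  qed
  have "D = 0"
  proof (rule sqm_eqI, rule fps_ext)
    fix r s n
    have "fps_nth (ent D r s) n \<in> fps_over (annihilator (wd ws))" for ws
      using words[of ws] unfolding sqm_over_def fps_over_def by blast
    then have "fps_nth (ent D r s) n = 0" by (rule fps_over_ann_eq)
    then show "fps_nth (ent D r s) n = fps_nth (ent 0 r s) n" by simp
  qed
  then show ?thesis by (simp add: D_def bb_def)
qed

end

section \<open>Invertibility of the operator series\<close>

definition sqm_transpose :: "('a, 'i) sqm \<Rightarrow> ('a, 'i) sqm" where
  "sqm_transpose A = Sqm (\<lambda>i j. ent A j i)"

text \<open>Transposes the second leg only, the one on which the matrix of T^- acts.\<close>

definition ptrans :: "('a, 'n \<times> 'n) sqm \<Rightarrow> ('a, 'n \<times> 'n) sqm" where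
  "ptrans A = Sqm (\<lambda>r s. ent A (fst r, snd s) (fst s, snd r))"

lemma ent_sqm_transpose [simp]: "ent (sqm_transpose A) i j = ent A j i"
  by (simp add: sqm_transpose_def)

lemma ent_ptrans [simp]: "ent (ptrans A) r s = ent A (fst r, snd s) (fst s, snd r)"
  by (simp add: ptrans_def)

lemma ptrans_ptrans [simp]: "ptrans (ptrans A) = A"
  by (rule sqm_eqI) simp

lemma sqm_transpose_transpose [simp]: "sqm_transpose (sqm_transpose A) = A"
  by (rule sqm_eqI) simp

lemma sqm_map_ptrans: "sqm_map f (ptrans A) = ptrans (sqm_map f A)"
  by (rule sqm_eqI) simp

lemma ent_leg_mult:
  fixes Z :: "('a::ring_1, 'n::finite \<times> 'n) sqm"
  shows "ent (leg1 U * Z) (k, i) s = (\<Sum>k'\<in>UNIV. ent U k k' * ent Z (k', i) s)"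
    and "ent (leg2 U * Z) (k, i) s = (\<Sum>i'\<in>UNIV. ent U i i' * ent Z (k, i') s)"
    and "ent (Z * leg1 U) s (k, i) = (\<Sum>k'\<in>UNIV. ent Z s (k', i) * ent U k' k)"
    and "ent (Z * leg2 U) s (k, i) = (\<Sum>i'\<in>UNIV. ent Z s (k, i') * ent U i' i)"
  by (simp_all add: ent_mult ent_sqm_emb sum_UNIV_pair if_distrib[of "\<lambda>x. x * _"] if_distrib[of "\<lambda>x. _ * x"]
      cong: if_cong)
     (subst sum.swap, simp)+

text \<open>Transposition in leg 2 reverses the matrix order on that leg, but the operator entries
  of \<open>A\<close> and \<open>U\<close> keep their order. Only the entries of \<open>C\<close>
  change place, and these are central.\<close>

lemma ptrans_legs:
  fixes C :: "('a::ring_1, 'n::finite \<times> 'n) sqm"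
  assumes cen: "\<And>r s a. ent C r s * a = a * ent C r s"
  shows "ptrans (C * (leg2 A * leg1 U)) = leg2 (sqm_transpose A) * (ptrans C * leg1 U)"
    and "ptrans (leg1 U * leg2 A * C) = leg1 U * (ptrans C * leg2 (sqm_transpose A))"
proof -
  show "ptrans (C * (leg2 A * leg1 U)) = leg2 (sqm_transpose A) * (ptrans C * leg1 U)"
  proof (rule sqm_eqI)
    fix r s :: "'n \<times> 'n"
    obtain k i l j where [simp]: "r = (k, i)" "s = (l, j)" by (cases r, cases s)
    have "ent (ptrans (C * (leg2 A * leg1 U))) r s =
        (\<Sum>k'\<in>UNIV. \<Sum>i'\<in>UNIV. ent C (k, j) (k', i') * (ent A i' i * ent U k' l))"
      by (simp add: ent_mult[of C] ent_mult_leg sum_UNIV_pair)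
    also have "\<dots> = (\<Sum>k'\<in>UNIV. \<Sum>i'\<in>UNIV. ent A i' i * (ent C (k, j) (k', i') * ent U k' l))"
      by (simp add: cen mult.assoc)
    also have "\<dots> = ent (leg2 (sqm_transpose A) * (ptrans C * leg1 U)) r s"
      by (simp add: ent_leg_mult sum_distrib_left) (rule sum.swap)
    finally show "ent (ptrans (C * (leg2 A * leg1 U))) r s = ent (leg2 (sqm_transpose A) * (ptrans C * leg1 U)) r s" .
  qed
  show "ptrans (leg1 U * leg2 A * C) = leg1 U * (ptrans C * leg2 (sqm_transpose A))"
  proof (rule sqm_eqI)
    fix r s :: "'n \<times> 'n"
    obtain k i l j where [simp]: "r = (k, i)" "s = (l, j)" by (cases r, cases s)
    show "ent (ptrans (leg1 U * leg2 A * C)) r s = ent (leg1 U * (ptrans C * leg2 (sqm_transpose A))) r s"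
      by (simp add: ent_leg_mult sum_distrib_left mult.assoc cen)
  qed
qed

text \<open>By the crossing rules for \<open>S\<close> and \<open>T\<close>, each of
  \<open>S * T - 1\<close> and \<open>T * S - 1\<close> crosses T^+ in its own way. Both kill 1, so
  both vanish by induction on words.\<close>

lemma exchange_inverse:
  fixes B Bi Q :: "(complex fps fps, 'n::finite \<times> 'n) sqm" and up um :: "complex fps"
  assumes exT: "exchange B Bi" and exS: "exchange Q (ptrans B)"
  defines "T \<equiv> exchange.Tm B Bi up um" and "S \<equiv> sqm_transpose (exchange.Tm Q (ptrans B) up um)"
  shows "S * T = 1" "T * S = 1"
proof -
  interpret T: exchange B Bi up um by (rule exT)
  interpret S: exchange Q "ptrans B" up um by (rule exS)
  define t where "t = leg1 (gen_series left_mult :: ('n endo fps fps, 'n) sqm)"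
  define b where "b u = sqm_map (sub_xy op_scal u :: _ \<Rightarrow> 'n endo fps fps) B" for u
  define bi where "bi u = sqm_map (sub_xy op_scal u :: _ \<Rightarrow> 'n endo fps fps) Bi" for u
  define q where "q u = sqm_map (sub_xy op_scal u :: _ \<Rightarrow> 'n endo fps fps) Q" for u
  define L where "L A = leg2 (sqm_map fps_const A)" for A :: "('n endo fps, 'n) sqm"
  have Lhom: "unital_hom L"
    unfolding L_def by (rule unital_hom_comp[OF unital_hom_leg(2) unital_hom_sqm_map[OF unital_hom_fps_const]])
  have pb: "sqm_map (sub_xy op_scal u) (ptrans B) = ptrans (b u)" for u
    by (simp add: b_def sqm_map_ptrans)
  have A_in: "sub_xy op_scal u f \<in> fps_over (fps_over (range (op_scal :: _ \<Rightarrow> 'n endo)))" for u f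
    by (intro sub_xy_in unital_hom_op_scal)
  have "fps_over (fps_over (range (op_scal :: _ \<Rightarrow> 'n endo))) \<subseteq> center"
    by (intro fps_over_subset_center op_scal_central)
  then have cen: "ent (ptrans (b u)) r s * a = a * ent (ptrans (b u)) r s" for u r s a
    unfolding b_def using A_in by (auto intro!: center_commute)
  have q: "q u * ptrans (b u) = 1" "ptrans (b u) * q u = 1" for u
    unfolding q_def pb[symmetric] by (rule S.sub_Q_inverse)+
  have bb: "b u * bi u = 1" for u
    unfolding b_def bi_def by (rule T.sub_Q_inverse)
  have eT: "L T * t * b um = b up * t * L T"
    using T.Tm_exchange by (simp add: T_def t_def b_def L_def)
  have "L (sqm_transpose S) * t * q um = q up * t * L (sqm_transpose S)"
    using S.Tm_exchange by (simp add: S_def t_def q_def L_def)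
  \<comment> \<open>Multiplying by the inverses of \<open>q\<close> on both sides puts the partial
    transposes of B outside; transposing once more moves B between \<open>S\<close> and the
    generator, as the inverse of T^- requires.\<close>
  then have "ptrans (b up) * (L (sqm_transpose S) * t * q um) * ptrans (b um) =
      ptrans (b up) * (q up * t * L (sqm_transpose S)) * ptrans (b um)" by simp
  then have "ptrans (b up) * (L (sqm_transpose S) * t) * (q um * ptrans (b um)) =
      (ptrans (b up) * q up) * t * L (sqm_transpose S) * ptrans (b um)" by (simp only: mult.assoc)
  then have "ptrans (b up) * (L (sqm_transpose S) * t) = t * L (sqm_transpose S) * ptrans (b um)"
    by (simp add: q)
  then have "ptrans (ptrans (b up) * (L (sqm_transpose S) * t)) = ptrans (t * L (sqm_transpose S) * ptrans (b um))"
    by simp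
  moreover have pl: "ptrans (ptrans (b u) * (L A * t)) = L (sqm_transpose A) * (b u * t)" for u A
    using ptrans_legs(1)[of "ptrans (b u)", OF cen]
    by (simp add: L_def t_def) (simp add: sqm_map_def sqm_transpose_def)
  moreover have "ptrans (t * L A * ptrans (b u)) = t * (b u * L (sqm_transpose A))" for u A
    using ptrans_legs(2)[of "ptrans (b u)", OF cen]
    by (simp add: L_def t_def) (simp add: sqm_map_def sqm_transpose_def)
  ultimately have eS: "L S * (b up * t) = t * (b um * L S)" by simp
  \<comment> \<open>Words arise from 1 by prepending letters, so an operator series that kills 1 and
    passes from a tail to the longer word is zero.\<close>
  have zero: "D = 0" if base: "D \<in> sqm_over (fps_over (annihilator 1))"
    and step: "\<And>ws. L D \<in> sqm_over (fps_over (fps_over (annihilator (wd ws)))) \<Longrightarrow>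
      L D * t \<in> sqm_over (fps_over (fps_over (annihilator (wd ws))))" for D
  proof -
    have words: "D \<in> sqm_over (fps_over (annihilator (wd ws)))" for ws
    proof (induction ws)
      case Nil
      then show ?case using base by simp
    next
      case (Cons w ws)
      let ?I = "annihilator (wd ws)"
      have z: "0 \<in> ?I" by (simp add: annihilator_def)
      have "L D \<in> sqm_over (fps_over (fps_over ?I))"
        using Cons z unfolding L_def
        by (intro sqm_over_emb fps_over_zero) (auto simp: sqm_over_def intro!: fps_over_const fps_over_zero)
      then have "L D * t \<in> sqm_over (fps_over (fps_over ?I))" by (rule step)
      then have "ent (L D * t) (fst w, i) (fst (snd w), j) \<in> fps_over (fps_over ?I)" for i j
        unfolding sqm_over_def by blast
      then have "fps_const (ent D i j) * ent (gen_series left_mult) (fst w) (fst (snd w)) \<in> fps_over (fps_over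
          ?I)" for i j
        unfolding L_def t_def ent_mult_leg by simp
      then have "fps_nth (ent D i j) p * left_mult (tplus (fst w) (fst (snd w)) (int (snd (snd w)))) \<in> ?I" for i j p
        by (auto simp: fps_over_def gen_series_def fps_mult_left_const_nth fps_mult_right_const_nth)
      then show ?case
        by (simp add: sqm_over_def fps_over_def annihilator_def tplus_wd wd_Cons[of w ws])
    qed
    show "D = 0"
    proof (rule sqm_eqI)
      fix i j
      have "ent D i j \<in> fps_over (annihilator (wd ws))" for ws
        using words[of ws] unfolding sqm_over_def by blast
      then have "ent D i j = 0" by (rule fps_over_ann_eq)
      then show "ent D i j = ent 0 i j" by simp
    qed
  qed
  have T1: "T - 1 \<in> sqm_over (fps_over (annihilator 1))"
    unfolding T_def by (rule T.Tm_minus_one_ann)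
  have "S - 1 = sqm_transpose (S.Tm - 1)"
    by (rule sqm_eqI) (simp add: S_def ent_one)
  then have S1: "S - 1 \<in> sqm_over (fps_over (annihilator 1))"
    using S.Tm_minus_one_ann by (simp add: sqm_over_def del: ent_diff)
  note bm1 = bimod_sqm_over[where 'i = 'n, OF bimod_fps_over[OF bimod_annihilator[of 1]], simplified]
  note bm2 = bimod_sqm_over[where 'i = "'n \<times> 'n", OF bimod_fps_over[OF bimod_fps_over[OF bimod_annihilator]],
      simplified]
  have "S * T - 1 = 0"
  proof (rule zero)
    have "S * T - 1 = S * (T - 1) + (S - 1)" by (simp add: algebra_simps)
    then show "S * T - 1 \<in> sqm_over (fps_over (annihilator 1))"
      using bimod_add[OF bm1 bimod_left[OF bm1 UNIV_I T1] S1] by (simp only:)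
    have LD: "L (S * T - 1) = L S * L T - 1"
      by (simp add: unital_hom_diff[OF Lhom] unital_hom_mult[OF Lhom] unital_hom_one[OF Lhom])
    have "L S * L T * t * b um = L S * (L T * t * b um)" by (simp only: mult.assoc)
    also have "\<dots> = (L S * (b up * t)) * L T" unfolding eT by (simp only: mult.assoc)
    also have "\<dots> = t * b um * (L S * L T)" unfolding eS by (simp only: mult.assoc)
    finally have "L (S * T - 1) * t * b um = t * b um * L (S * T - 1)"
      by (simp add: LD algebra_simps)
    then have "L (S * T - 1) * t * (b um * bi um) = t * b um * L (S * T - 1) * bi um"
      by (simp only: mult.assoc[symmetric])
    then have eq: "L (S * T - 1) * t = (t * b um) * L (S * T - 1) * bi um" by (simp add: bb)
    fix ws
    assume "L (S * T - 1) \<in> sqm_over (fps_over (fps_over (annihilator (wd ws))))"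
    then show "L (S * T - 1) * t \<in> sqm_over (fps_over (fps_over (annihilator (wd ws))))"
      unfolding eq
      by (rule bimod_right[OF bm2 bimod_left[OF bm2 UNIV_I]]) (use A_in in \<open>simp add: bi_def sqm_over_def\<close>)
  qed
  then show "S * T = 1" by simp
  have "T * S - 1 = 0"
  proof (rule zero)
    have "T * S - 1 = T * (S - 1) + (T - 1)" by (simp add: algebra_simps)
    then show "T * S - 1 \<in> sqm_over (fps_over (annihilator 1))"
      using bimod_add[OF bm1 bimod_left[OF bm1 UNIV_I S1] T1] by (simp only:)
    have LD: "L (T * S - 1) = L T * L S - 1"
      by (simp add: unital_hom_diff[OF Lhom] unital_hom_mult[OF Lhom] unital_hom_one[OF Lhom])
    have "L T * L S * (b up * t) = L T * (L S * (b up * t))" by (simp only: mult.assoc)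
    also have "\<dots> = (L T * t * b um) * L S" unfolding eS by (simp only: mult.assoc)
    also have "\<dots> = b up * t * (L T * L S)" unfolding eT by (simp only: mult.assoc)
    finally have eq: "L (T * S - 1) * (b up * t) = b up * t * L (T * S - 1)"
      by (simp add: LD algebra_simps)
    fix ws :: "('n \<times> 'n \<times> nat) list"
    let ?I = "fps_over (fps_over (annihilator (wd ws)))"
    assume "L (T * S - 1) \<in> sqm_over ?I"
    then have "L (T * S - 1) * (b up * t) \<in> sqm_over ?I"
      unfolding eq by (rule bimod_left[OF bm2 UNIV_I])
    \<comment> \<open>In this order B stands between \<open>T * S - 1\<close> and the generator and
      cannot be cancelled there. The partial transpose, which only permutes entries, exposes it on
      the far left, where \<open>q up\<close> removes it.\<close>
    then have "ptrans (ptrans (b up) * (L (sqm_transpose (T * S - 1)) * t)) \<in> sqm_over ?I"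
      by (simp add: pl)
    then have "ptrans (b up) * (L (sqm_transpose (T * S - 1)) * t) \<in> sqm_over ?I"
      by (auto simp: sqm_over_def)
    then have "q up * (ptrans (b up) * (L (sqm_transpose (T * S - 1)) * t)) \<in> sqm_over ?I"
      by (rule bimod_left[OF bm2 UNIV_I])
    then have "L (sqm_transpose (T * S - 1)) * t \<in> sqm_over ?I"
      by (simp add: q flip: mult.assoc)
    then have "ent (L (sqm_transpose (T * S - 1)) * t) (k, i) (l, j) \<in> ?I" for k i l j
      unfolding sqm_over_def by blast
    then have "ent (L (T * S - 1) * t) (k, i) (l, j) \<in> ?I" for k i l j
      unfolding L_def t_def ent_mult_leg by simp
    then show "L (T * S - 1) * t \<in> sqm_over ?I"
      by (auto simp: sqm_over_def)
  qed
  then show "T * S = 1" by simp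
qed

section \<open>The scalar factor\<close>

lemma fps_inverse_of_unit:
  fixes f :: "complex fps fps"
  assumes "fps_nth f 0 = 1" shows "f * inverse f = 1"
proof -
  have "inverse f = fps_right_inverse f 1"
    unfolding fps_inverse_def[of f] assms by simp
  then show ?thesis using fps_right_inverse[of f 1] assms by simp
qed

text \<open>The first coefficient in which \<open>g\<close> and \<open>g'\<close> may differ enters
  the product linearly, once per factor with weight \<open>c k ^ n\<close>, and all other
  contributions agree.\<close>

lemma prod_fps_scale_difference:
  fixes g g' :: "'a::comm_ring_1 fps" and c :: "nat \<Rightarrow> 'a"
  assumes one: "fps_nth g 0 = 1" "fps_nth g' 0 = 1"
    and agree: "\<And>i. i < n \<Longrightarrow> fps_nth g i = fps_nth g' i" and "n > 0"
  defines "F \<equiv> \<lambda>m g. \<Prod>k<m. fps_scale (c k) g"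
  shows "(\<forall>i<n. fps_nth (F m g) i = fps_nth (F m g') i) \<and>
    fps_nth (F m g) n - fps_nth (F m g') n = (\<Sum>k<m. c k ^ n) * (fps_nth g n - fps_nth g' n)"
proof (induction m)
  case 0
  then show ?case by (simp add: F_def)
next
  case (Suc m)
  let ?s = "fps_scale (c m) g" and ?s' = "fps_scale (c m) g'"
  have F0: "fps_nth (F m h) 0 = 1" if "fps_nth h 0 = 1" for h
    using that by (induction m) (simp_all add: F_def)
  have F: "F (Suc m) h = F m h * fps_scale (c m) h" for h by (simp add: F_def)
  have "fps_nth (F (Suc m) g) i = fps_nth (F (Suc m) g') i" if "i < n" for i
    unfolding F fps_mult_nth using Suc agree that by (intro sum.cong) auto
  moreover have "fps_nth (F (Suc m) g) n - fps_nth (F (Suc m) g') n =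
      (\<Sum>i=0..n. fps_nth (F m g) i * fps_nth ?s (n - i) - fps_nth (F m g') i * fps_nth ?s' (n - i))"
    by (simp add: F fps_mult_nth sum_subtractf)
  moreover have "\<dots> = (\<Sum>i\<in>{0, n}. fps_nth (F m g) i * fps_nth ?s (n - i) - fps_nth (F m g') i * fps_nth ?s' (n - i))"
    using Suc agree by (intro sum.mono_neutral_right) auto
  moreover have "\<dots> = (fps_nth g n - fps_nth g' n) * c m ^ n + (fps_nth (F m g) n - fps_nth (F m g') n)"
    using \<open>n > 0\<close> one by (simp add: F0 algebra_simps)
  ultimately show ?case using Suc by (simp add: algebra_simps)
qed

text \<open>The product determines coefficient n of \<open>g\<close> from the earlier ones after
  division by the power sum of the \<open>c k\<close>, which is assumed to be a unit; recursion on n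
  gives existence and uniqueness.\<close>

lemma ex1_prod_fps_scale:
  fixes c :: "nat \<Rightarrow> 'a::idom" and r :: "'a fps"
  assumes "fps_nth r 0 = 1" and unit: "\<And>n. n > 0 \<Longrightarrow> \<exists>d. (\<Sum>k<M. c k ^ n) * d = 1"
  shows "\<exists>!g. fps_nth g 0 = 1 \<and> (\<Prod>k<M. fps_scale (c k) g) = r"
proof (rule ex_ex1I)
  define F where "F g = (\<Prod>k<M. fps_scale (c k) g)" for g
  define \<sigma> where "\<sigma> n = (\<Sum>k<M. c k ^ n)" for n
  note diff = prod_fps_scale_difference[where m = M and c = c, folded F_def \<sigma>_def]
  have F0: "fps_nth (\<Prod>k<m. fps_scale (c k) h) 0 = 1" if "fps_nth h 0 = 1" for m h
    using that by (induction m) simp_all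
  obtain d where d: "\<And>n. n > 0 \<Longrightarrow> \<sigma> n * d n = 1" using unit unfolding \<sigma>_def by metis
  \<comment> \<open>The approximation \<open>G n\<close> solves the equation in degree n. Its
    successor adds the defect in degree n + 1, divided by the power sum, and so leaves the lower
    coefficients alone.\<close>
  define G where "G = rec_nat (1 :: 'a fps) (\<lambda>n g. g + fps_const (d (Suc n) * (fps_nth r (Suc n) - fps_nth (F g)
      (Suc n))) * fps_X ^ Suc n)"
  have G0: "G 0 = 1" and GS: "G (Suc n) = G n + fps_const (d (Suc n) * (fps_nth r (Suc n) - fps_nth (F (G n))
      (Suc n))) * fps_X ^ Suc n" for n
    by (simp_all add: G_def)
  have G1: "fps_nth (G n) 0 = 1" for n
    by (induction n) (simp_all only: G0 GS fps_add_nth fps_X_power_mult_right_nth, simp_all)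
  have Gle: "fps_nth (G m) i = fps_nth (G n) i" if "n \<le> m" "i \<le> n" for m n i
    using that
  proof (induction m rule: dec_induct)
    case (step m)
    then show ?case by (simp only: GS fps_add_nth fps_X_power_mult_right_nth) simp
  qed simp
  have G: "fps_nth (F (G n)) n = fps_nth r n" for n
  proof (cases n)
    case 0
    then show ?thesis using assms by (simp add: F_def F0 G0)
  next
    case (Suc m)
    have "fps_nth (F (G (Suc m))) (Suc m) - fps_nth (F (G m)) (Suc m) = \<sigma> (Suc m) * (fps_nth (G (Suc m)) (Suc m)
        - fps_nth (G m) (Suc m))"
      using Gle[of m "Suc m"] by (intro diff[THEN conjunct2] G1) auto
    also have "\<dots> = \<sigma> (Suc m) * d (Suc m) * (fps_nth r (Suc m) - fps_nth (F (G m)) (Suc m))"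
      by (simp only: GS fps_add_nth fps_X_power_mult_right_nth) simp
    finally show ?thesis using Suc d[of "Suc m"] by simp
  qed
  define g where "g = Abs_fps (\<lambda>n. fps_nth (G n) n)"
  have g1: "fps_nth g 0 = 1" by (simp add: g_def G0)
  have "fps_nth (F g) n = fps_nth r n" for n
  proof (cases "n = 0")
    case True
    then show ?thesis using assms g1 by (simp add: F_def F0)
  next
    case False
    have "fps_nth (F g) n - fps_nth (F (G n)) n = \<sigma> n * (fps_nth g n - fps_nth (G n) n)"
      using False by (intro diff[THEN conjunct2] G1 g1) (simp_all add: g_def Gle[symmetric])
    then show ?thesis using G by (simp add: g_def)
  qed
  then show "\<exists>g. fps_nth g 0 = 1 \<and> (\<Prod>k<M. fps_scale (c k) g) = r"
    using g1 by (auto simp: F_def fps_eq_iff)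
  fix g g'
  assume g: "fps_nth g 0 = 1 \<and> (\<Prod>k<M. fps_scale (c k) g) = r" "fps_nth g' 0 = 1 \<and> (\<Prod>k<M. fps_scale (c k) g') = r"
  show "g = g'"
  proof (rule fps_ext)
    fix n
    show "fps_nth g n = fps_nth g' n"
    proof (induction n rule: less_induct)
      case (less n)
      show ?case
      proof (cases "n = 0")
        case False
        have "fps_nth (F g) n - fps_nth (F g') n = \<sigma> n * (fps_nth g n - fps_nth g' n)"
          using False less g by (intro diff[THEN conjunct2]) auto
        then have "\<sigma> n * (fps_nth g n - fps_nth g' n) = 0" using g by (simp add: F_def)
        moreover have "\<sigma> n \<noteq> 0" using d[of n] False by auto
        ultimately show ?thesis by simp
      qed (use g in simp)
    qed
  qed
qed

text \<open>With \<open>c k\<close> equal to e^(-2kh) every power sum is M modulo h, a unit since M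
  > 0. Hence the description in \<open>gbar\<close> denotes a unique series.\<close>

lemma gbar_nth_0:
  assumes "M > 0" shows "fps_nth (gbar M) 0 = 1"
proof -
  have scale: "fps_compose g (fps_const c * fps_X) = fps_scale c g" for g :: "complex fps fps" and c
    unfolding fps_compose_linear by (simp add: fps_scale_def mult.commute)
  have "\<exists>d. (\<Sum>k<M. fps_exp (- 2 * of_nat k) ^ n) * d = (1 :: complex fps)" for n
  proof
    have "fps_nth (\<Sum>k<M. fps_exp (- 2 * of_nat k) ^ n :: complex fps) 0 = of_nat M"
      by (simp add: fps_sum_nth fps_nth_power_0)
    then show "(\<Sum>k<M. fps_exp (- 2 * of_nat k) ^ n) * inverse (\<Sum>k<M. fps_exp (- 2 * of_nat k) ^ n) = (1 ::
        complex fps)"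
      using assms by (intro inverse_mult_eq_1') simp
  qed
  then have "\<exists>!g. fps_nth g 0 = 1 \<and> (\<Prod>k<M. fps_compose g (fps_const (fps_exp (- 2 * of_nat k)) * fps_X)) =
     (1 - fps_const (fps_exp (- 2 * (of_nat M - 1))) * fps_X) * inverse (1 - fps_X :: complex fps fps)"
    unfolding scale by (intro ex1_prod_fps_scale) simp_all
  from theI'[OF this] show ?thesis unfolding gbar_def by blast
qed

lemma fbar_nth_0: "M > 0 \<Longrightarrow> fps_nth (fbar M) 0 = 1"
  by (simp add: fbar_def gbar_nth_0)

section \<open>The Yang--Baxter equation for the R-matrix\<close>

definition sqm_scalar :: "'a::ring_1 \<Rightarrow> ('a, 'i) sqm" where
  "sqm_scalar c = Sqm (\<lambda>i j. if i = j then c else 0)"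

lemma ent_sqm_scalar: "ent (sqm_scalar c) i j = (if i = j then c else 0)"
  by (simp add: sqm_scalar_def)

lemma ent_sqm_scalar_mult [simp]: "ent (sqm_scalar c * A) i j = c * ent A i j"
  for A :: "('a::ring_1, 'i::finite) sqm"
  by (simp add: ent_mult ent_sqm_scalar if_distrib[of "\<lambda>x. x * _"] cong: if_cong)

lemma unital_hom_sqm_scalar: "unital_hom (sqm_scalar :: 'a::ring_1 \<Rightarrow> ('a, 'i::finite) sqm)"
  by (intro unital_homI sqm_eqI) (simp_all add: ent_sqm_scalar ent_one)

lemma sqm_scalar_central: "sqm_scalar c * A = A * sqm_scalar c"
  for A :: "('a::comm_ring_1, 'i::finite) sqm"
proof (rule sqm_eqI)
  fix i j
  have "ent (A * sqm_scalar c) i j = ent A i j * c"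
    by (simp add: ent_mult ent_sqm_scalar if_distrib[of "\<lambda>x. _ * x"] cong: if_cong)
  then show "ent (sqm_scalar c * A) i j = ent (A * sqm_scalar c) i j" by (simp add: mult.commute)
qed

lemma sqm_map_scalar: "g 0 = 0 \<Longrightarrow> sqm_map g (sqm_scalar c) = sqm_scalar (g c)"
  by (rule sqm_eqI) (simp add: ent_sqm_scalar)

lemma sqm_emb_scalar: "bij (\<lambda>r. (\<pi> r, \<rho> r)) \<Longrightarrow> sqm_emb \<pi> \<rho> (sqm_scalar c) = sqm_scalar c"
  by (rule sqm_eqI) (auto simp: ent_sqm_emb ent_sqm_scalar bij_def inj_def)

section \<open>Flips of tensor legs as permutation matrices\<close>

definition sqm_perm :: "('i \<Rightarrow> 'i) \<Rightarrow> ('a::ring_1, 'i) sqm" where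
  "sqm_perm \<pi> = Sqm (\<lambda>r s. if s = \<pi> r then 1 else 0)"

lemma ent_sqm_perm_mult: "ent (sqm_perm \<pi> * A) r s = ent A (\<pi> r) s"
  for A :: "('a::ring_1, 'i::finite) sqm"
  by (simp add: ent_mult sqm_perm_def if_distrib[of "\<lambda>x. x * _"] cong: if_cong)

lemma ent_mult_sqm_perm:
  fixes A :: "('a::ring_1, 'i::finite) sqm"
  assumes "\<And>r. \<pi> (\<pi> r) = r" shows "ent (A * sqm_perm \<pi>) r s = ent A r (\<pi> s)"
proof -
  have "s = \<pi> t \<longleftrightarrow> t = \<pi> s" for t using assms by metis
  then show ?thesis
    by (simp add: ent_mult sqm_perm_def if_distrib[of "\<lambda>x. _ * x"] cong: if_cong)
qed

abbreviation flip_sqm :: "('a::ring_1, 'n \<times> 'n) sqm" where "flip_sqm \<equiv> sqm_perm prod.swap"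

lemma sqm_map_perm: "g 0 = 0 \<Longrightarrow> g 1 = 1 \<Longrightarrow> sqm_map g (sqm_perm \<pi>) = sqm_perm \<pi>"
  by (rule sqm_eqI) (simp add: sqm_perm_def)

definition swap12 :: "'a \<times> 'a \<times> 'a \<Rightarrow> 'a \<times> 'a \<times> 'a" where "swap12 r = (fst (snd r), fst r, snd (snd r))"
definition swap23 :: "'a \<times> 'a \<times> 'a \<Rightarrow> 'a \<times> 'a \<times> 'a" where "swap23 r = (fst r, snd (snd r), fst (snd r))"

lemma swap_tri [simp]: "swap12 (swap12 r) = r" "swap23 (swap23 r) = r"
  by (simp_all add: swap12_def swap23_def)

lemma tri_flip: "tri12 flip_sqm = sqm_perm swap12" "tri23 flip_sqm = sqm_perm swap23"
  by (rule sqm_eqI, auto simp: ent_sqm_emb sqm_perm_def swap12_def swap23_def)+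

lemmas perm_simps = ent_sqm_perm_mult ent_mult_sqm_perm[where \<pi> = swap12, OF swap_tri(1)]
  ent_mult_sqm_perm[where \<pi> = swap23, OF swap_tri(2)] ent_mult_sqm_perm[where \<pi> = prod.swap, OF swap_swap]

text \<open>Expand both sides and use \<open>sq\<close> on the squares. The cubic terms agree by the
  braid relation, the terms in \<open>a * b\<close> and \<open>b * a\<close> agree outright, and
  comparing the coefficients of \<open>a\<close> and \<open>b\<close> leaves exactly the scalar
  condition \<open>par\<close>.\<close>

lemma baxterization:
  fixes a b x y z k :: "'a::ring_1"
  assumes cen: "x \<in> center" "y \<in> center" "z \<in> center" "k \<in> center"
    and sq: "a * a = 1 + k * a" "b * b = 1 + k * b" and braid: "a * b * a = b * a * b"
    and par: "y * k + x * y + y * z = x * z"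
  shows "(b + x) * (a + y) * (b + z) = (a + z) * (b + y) * (a + x)"
proof -
  have tail: "u * (v * w) = v * (u * w)" if "u * v = v * u" for u v w :: 'a
    using that by (metis mult.assoc)
  have c: "a * x = x * a" "b * x = x * b" "y * x = x * y" "z * x = x * z" "a * y = y * a" "b * y = y * b"
    "z * y = y * z" "a * z = z * a" "b * z = z * b"
    by (rule center_commute[symmetric], rule cen)+
  note rules = distrib_left distrib_right mult.assoc c tail[OF c(1)] tail[OF c(2)] tail[OF c(3)] tail[OF c(4)]
    tail[OF c(5)] tail[OF c(6)] tail[OF c(7)] tail[OF c(8)] tail[OF c(9)] mult_1_right mult_1_left
    add.assoc add.commute add.left_commute
  let ?C = "b * a * b + z * (b * a) + x * (a * b) + y + x * y * z"
  have "(b + x) * (a + y) * (b + z) = ?C + (y * k + x * y + y * z) * b + x * z * a"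
    by (simp only: rules sq)
  moreover have "(a + z) * (b + y) * (a + x) = a * b * a + (z * (b * a) + x * (a * b) + y + x * y * z) + (y * k
      + x * y + y * z) * a + x * z * b"
    by (simp only: rules sq)
  ultimately show ?thesis by (simp only: par braid) (simp only: add.assoc add.commute add.left_commute)
qed

text \<open>Here \<open>p\<close> and \<open>s\<close> flip legs 1, 2 and legs 2, 3, and
  \<open>p * (s * (b + y)) * p\<close> is the R-matrix on legs 1 and 3. Moving all flips to the left
  turns each of \<open>a\<close> and \<open>b\<close> into the other where needed and leaves the
  longest permutation times the two sides of \<open>br\<close>.\<close>

lemma ybe_from_braid:
  fixes a b p s x y z :: "'a::ring_1"
  assumes cen: "x \<in> center" "y \<in> center" "z \<in> center"
    and p: "p * p = 1" and s: "s * s = 1" and psp: "p * s * p = s * p * s" and psa: "p * s * a = b * (p * s)"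
    and br: "(b + x) * (a + y) * (b + z) = (a + z) * (b + y) * (a + x)"
  shows "p * (a + x) * (p * (s * (b + y)) * p) * (s * (b + z)) = s * (b + z) * (p * (s * (b + y)) * p) * (p * (a
      + x))"
proof -
  have spb: "a * (s * p) = s * p * b"
  proof -
    have "s * p * b = s * p * (b * (p * s)) * (s * p)"
      using p s by (metis mult.assoc mult_1_right)
    also have "\<dots> = s * (p * p) * s * a * (s * p)" by (simp only: mult.assoc flip: psa)
    also have "\<dots> = a * (s * p)" using p s by simp
    finally show ?thesis ..
  qed
  have m1: "(b + w) * (p * s) = p * s * (a + w)" and m2: "(a + w) * (s * p) = s * p * (b + w)" if "w \<in> center" for w
    using center_commute[OF that] by (simp_all add: distrib_left distrib_right psa spb)
  have "p * (a + x) * (p * (s * (b + y)) * p) * (s * (b + z)) = p * (a + x) * p * s * ((b + y) * (p * s)) * (b + z)"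
    by (simp only: mult.assoc)
  also have "\<dots> = p * (a + x) * ((p * s * p) * s) * (a + y) * (b + z)"
    unfolding m1[OF cen(2)] by (simp only: mult.assoc)
  also have "(p * s * p) * s = s * p" unfolding psp using s by (simp add: mult.assoc)
  also have "p * (a + x) * (s * p) * (a + y) * (b + z) = p * ((a + x) * (s * p)) * (a + y) * (b + z)"
    by (simp only: mult.assoc)
  also have "\<dots> = (p * s * p) * ((b + x) * (a + y) * (b + z))"
    unfolding m2[OF cen(1)] by (simp only: mult.assoc)
  also have "\<dots> = s * p * s * ((a + z) * (b + y) * (a + x))" by (simp only: psp br)
  also have "\<dots> = s * ((b + z) * (p * s)) * (b + y) * (a + x)"
    unfolding m1[OF cen(3)] by (simp only: mult.assoc)
  also have "\<dots> = s * (b + z) * (p * (s * (b + y)) * (p * p)) * (a + x)" by (simp add: p mult.assoc)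
  also have "\<dots> = s * (b + z) * (p * (s * (b + y)) * p) * (p * (a + x))" by (simp only: mult.assoc)
  finally show ?thesis .
qed

lemma perm_relations:
  fixes Z :: "('a::ring_1, 'n::finite \<times> 'n) sqm"
  defines "p \<equiv> sqm_perm swap12 :: ('a, 'n \<times> 'n \<times> 'n) sqm" and "s \<equiv> sqm_perm swap23 :: ('a, 'n \<times> 'n \<times> 'n) sqm"
  shows "p * p = 1" "s * s = 1" "p * s * p = s * p * s" "p * s * tri12 Z = tri23 Z * (p * s)" "tri13 Z = p *
      tri23 Z * p"
proof -
  show "p * p = 1"
    unfolding p_def by (rule sqm_eqI, simp add: perm_simps) (auto simp: sqm_perm_def ent_one swap12_def)
  show "s * s = 1"
    unfolding s_def by (rule sqm_eqI, simp add: perm_simps) (auto simp: sqm_perm_def ent_one swap23_def)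
  show "p * s * p = s * p * s"
    unfolding p_def s_def by (rule sqm_eqI, simp add: perm_simps) (auto simp: sqm_perm_def swap12_def swap23_def)
  show "tri13 Z = p * tri23 Z * p"
    unfolding p_def s_def by (rule sqm_eqI, simp add: perm_simps) (auto simp: ent_sqm_emb swap12_def swap23_def)
  show "p * s * tri12 Z = tri23 Z * (p * s)"
    unfolding p_def s_def mult.assoc[symmetric]
    by (rule sqm_eqI) (simp add: perm_simps mult.assoc[of "sqm_perm swap12"], auto simp: ent_sqm_emb swap12_def
        swap23_def)
qed

text \<open>In the R-matrix \<open>w = 1/(1 - x)\<close>, \<open>\<kappa> = e\<^sup>h - e\<^bsup>-h\<^esup>\<close> and \<open>f\<close> is the scalar factor.\<close>

definition baxter_alpha :: "'k::ring_1 \<Rightarrow> 'k fps \<Rightarrow> 'k fps" where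
  "baxter_alpha \<kappa> w = fps_const \<kappa> * fps_X * w"

definition baxter_matrix :: "'k::ring_1 fps \<Rightarrow> 'k fps \<Rightarrow> ('k, 'n::finite \<times> 'n) sqm \<Rightarrow> ('k fps, 'n \<times> 'n) sqm" where
  "baxter_matrix f \<alpha> R = sqm_scalar f * (flip_sqm * (sqm_map fps_const R + sqm_scalar \<alpha>))"

text \<open>The scalar factors are central and give f(u) f(uv) f(v) on either side, the flips are
  handled by \<open>ybe_from_braid\<close>, and what remains is a functional equation for the
  coefficient of the identity in the braid form.\<close>

lemma yang_baxter_baxter_matrix:
  fixes R :: "('k::comm_ring_1, 'n::finite \<times> 'n) sqm"
  assumes w: "(1 - fps_X) * w = 1" and sq: "R * R = 1 + sqm_scalar \<kappa> * R"
    and braid: "tri12 R * tri23 R * tri12 R = tri23 R * tri12 R * tri23 R"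
  shows "yang_baxter (baxter_matrix f (baxter_alpha \<kappa> w) R) (baxter_matrix f (baxter_alpha \<kappa> w) R)"
proof -
  let ?B = "baxter_matrix f (baxter_alpha \<kappa> w) R"
  let ?k = "\<lambda>a::'k. fps_const (fps_const a)"
  let ?g1 = "fps_map fps_const :: 'k fps \<Rightarrow> 'k fps fps" and ?g2 = "sub_scale :: 'k fps \<Rightarrow> 'k fps fps"
    and ?g3 = "fps_const :: 'k fps \<Rightarrow> 'k fps fps"
  let ?al = "\<lambda>g. g (baxter_alpha \<kappa> w) :: 'k fps fps"
  define p where "p = (sqm_perm swap12 :: ('k fps fps, 'n \<times> 'n \<times> 'n) sqm)"
  define s where "s = (sqm_perm swap23 :: ('k fps fps, 'n \<times> 'n \<times> 'n) sqm)"
  define a where "a = tri12 (sqm_map ?k R)"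
  define b where "b = tri23 (sqm_map ?k R)"
  define sc where "sc = (sqm_scalar :: 'k fps fps \<Rightarrow> ('k fps fps, 'n \<times> 'n \<times> 'n) sqm)"
  have hg: "unital_hom ?g1" "unital_hom ?g2" "unital_hom ?g3"
    by (intro unital_hom_fps_map unital_hom_fps_const unital_hom_sub_scale)+
  have hk: "unital_hom ?k" by (rule unital_hom_comp[OF unital_hom_fps_const unital_hom_fps_const])
  have gk: "?g1 (fps_const c) = ?k c" "?g2 (fps_const c) = ?k c" "?g3 (fps_const c) = ?k c" for c
    by (simp_all add: sub_scale_const fps_eq_iff)
  have image: "sqm_map g ?B = sqm_scalar (g f) * (flip_sqm * (sqm_map ?k R + sqm_scalar (?al g)))"
    if h: "unital_hom g" and gk: "\<And>c. g (fps_const c) = ?k c" for g :: "'k fps \<Rightarrow> 'k fps fps"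
    unfolding baxter_matrix_def
    by (simp only: unital_hom_mult[OF unital_hom_sqm_map[OF h]] unital_hom_add[OF unital_hom_sqm_map[OF h]]
        sqm_map_scalar[of g, OF unital_hom_zero[OF h]] sqm_map_perm[of g, OF unital_hom_zero[OF h]
            unital_hom_one[OF h]]
        sqm_map_comp gk)
  have cen: "sc c \<in> center" for c
    by (simp add: center_def sc_def sqm_scalar_central)
  have im12: "tri12 (sqm_map ?g1 ?B) = sc (?g1 f) * (p * (a + sc (?al ?g1)))"
    unfolding image[OF hg(1) gk(1)] p_def a_def sc_def
    by (simp only: leg_mult unital_hom_add[OF unital_hom_leg(5)] sqm_emb_scalar[OF leg_bij(5)] tri_flip)
  have im23: "tri23 (sqm_map g ?B) = sc (g f) * (s * (b + sc (?al g)))"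
    if h: "unital_hom g" "\<And>c. g (fps_const c) = ?k c" for g
    unfolding image[OF h] s_def b_def sc_def
    by (simp only: leg_mult unital_hom_add[OF unital_hom_leg(2)] sqm_emb_scalar[OF leg_bij(2)] tri_flip)
  note pr = perm_relations[where 'a = "'k fps fps" and 'n = 'n, folded p_def s_def]
  have im13: "tri13 (sqm_map ?g2 ?B) = sc (?g2 f) * (p * (s * (b + sc (?al ?g2))) * p)"
    unfolding pr(5) im23[OF hg(2) gk(2)]
    by (simp only: mult.assoc[symmetric] center_commute[OF cen, of _ p, symmetric])
  have hsc: "unital_hom sc" unfolding sc_def by (rule unital_hom_sqm_scalar)
  \<comment> \<open>With \<alpha>(x) = \<kappa> x/(1 - x) this is \<alpha>(uv) (\<kappa> +
    \<alpha>(u) + \<alpha>(v)) = \<alpha>(u) \<alpha>(v), that is, 1 + u/(1 - u) + v/(1 - v) = (1 -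
    uv)/((1 - u)(1 - v)).\<close>
  have par: "?al ?g2 * ?k \<kappa> + ?al ?g1 * ?al ?g2 + ?al ?g2 * ?al ?g3 = ?al ?g1 * ?al ?g3"
  proof -
    define u1 where "u1 = ?g1 fps_X"
    define u2 where "u2 = ?g2 fps_X"
    define u3 where "u3 = ?g3 fps_X"
    have u2: "u2 = u1 * u3"
      unfolding u1_def u2_def u3_def
      by (rule fps_ext, rule fps_ext) (simp add: sub_scale_nth fps_X_def fps_mult_right_const_nth)
    have al: "?al ?g1 = ?k \<kappa> * u1 * ?g1 w" "?al ?g2 = ?k \<kappa> * u2 * ?g2 w" "?al ?g3 = ?k \<kappa> * u3 * ?g3 w"
      unfolding baxter_alpha_def u1_def u2_def u3_def by (simp_all only: hg[THEN unital_hom_mult] gk(1,2))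
    have w1: "(1 - u1) * ?g1 w = 1" "(1 - u2) * ?g2 w = 1" "(1 - u3) * ?g3 w = 1"
      using arg_cong[OF w, of ?g1] arg_cong[OF w, of ?g2] arg_cong[OF w, of ?g3]
      unfolding u1_def u2_def u3_def
      by (simp_all only: hg[THEN unital_hom_mult] hg[THEN unital_hom_diff] hg[THEN unital_hom_one])
    have "v2 * (1 + u1 * v1 + u3 * v3) = v1 * v3"
      if "(1 - u1) * v1 = 1" "(1 - u1 * u3) * v2 = 1" "(1 - u3) * v3 = 1" for v1 v2 v3
    proof -
      have "v1 * v3 * (1 - u1 * u3) = v1 * ((1 - u3) * v3) + (1 - u1) * v1 * v3 - (1 - u1) * v1 * ((1 - u3) * v3)"
        by (simp add: algebra_simps)
      also have "\<dots> = v1 + v3 - 1" by (simp only: that mult_1_left mult_1_right)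
      also have "\<dots> = ((1 - u1) * v1 + u1 * v1) + ((1 - u3) * v3 + u3 * v3) - 1" by (simp add: algebra_simps)
      also have "\<dots> = 1 + u1 * v1 + u3 * v3" by (simp only: that) simp
      finally have "v2 * (1 + u1 * v1 + u3 * v3) = v1 * v3 * ((1 - u1 * u3) * v2)"
        by (simp add: mult_ac)
      then show ?thesis by (simp only: that) simp
    qed
    from this[OF w1(1) w1(2)[unfolded u2] w1(3)]
    have "?k \<kappa> * ?k \<kappa> * u1 * u3 * (?g2 w * (1 + u1 * ?g1 w + u3 * ?g3 w)) = ?k \<kappa> * ?k \<kappa> * u1 * u3 * (?g1 w * ?g3
        w)" by simp
    then show ?thesis unfolding al u2 by (simp only: algebra_simps mult_1_left mult_1_right)
  qed
  have sqab: "a * a = 1 + sc (?k \<kappa>) * a" "b * b = 1 + sc (?k \<kappa>) * b"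
  proof -
    have "sqm_map ?k R * sqm_map ?k R = 1 + sqm_scalar (?k \<kappa>) * sqm_map ?k R"
      using arg_cong[OF sq, of "sqm_map ?k"]
      by (simp only: unital_hom_mult[OF unital_hom_sqm_map[OF hk]] unital_hom_add[OF unital_hom_sqm_map[OF hk]]
        sqm_map_scalar[of ?k, OF unital_hom_zero[OF hk]] unital_hom_one[OF unital_hom_sqm_map[OF hk]])
    from arg_cong[OF this, of tri12] arg_cong[OF this, of tri23]
    show "a * a = 1 + sc (?k \<kappa>) * a" "b * b = 1 + sc (?k \<kappa>) * b"
      unfolding a_def b_def sc_def
      by (simp_all only: leg_mult unital_hom_leg[THEN unital_hom_add] unital_hom_leg[THEN unital_hom_one]
          sqm_emb_scalar[OF leg_bij(5)] sqm_emb_scalar[OF leg_bij(2)])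
  qed
  have braid': "a * b * a = b * a * b"
    using arg_cong[OF braid, of "sqm_map ?k"] unfolding a_def b_def
    by (simp only: unital_hom_mult[OF unital_hom_sqm_map[OF hk]] sqm_map_emb[of ?k, OF unital_hom_zero[OF hk]])
  have par': "sc (?al ?g2) * sc (?k \<kappa>) + sc (?al ?g1) * sc (?al ?g2) + sc (?al ?g2) * sc (?al ?g3) = sc (?al
      ?g1) * sc (?al ?g3)"
    unfolding par[symmetric] unital_hom_mult[OF hsc, symmetric] unital_hom_add[OF hsc, symmetric] ..
  have psa: "p * s * a = b * (p * s)" unfolding a_def b_def by (rule pr(4))
  note main = ybe_from_braid[OF cen cen cen pr(1) pr(2) pr(3) psa
      baxterization[OF cen cen cen cen sqab braid' par']]
  have comb: "(sc c1 * v1) * (sc c2 * v2) * (sc c3 * v3) = sc (c1 * c2 * c3) * (v1 * v2 * v3)" for c1 c2 c3 v1 v2 v3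
  proof -
    have "(sc c1 * v1) * (sc c2 * v2) * (sc c3 * v3) = sc c1 * (v1 * sc c2) * (v2 * sc c3) * v3" by (simp only:
        mult.assoc)
    also have "\<dots> = sc c1 * sc c2 * (v1 * sc c3) * v2 * v3"
      unfolding center_commute[OF cen[of c2], of v1, symmetric] center_commute[OF cen[of c3], of v2, symmetric]
      by (simp only: mult.assoc)
    also have "\<dots> = sc c1 * sc c2 * sc c3 * (v1 * v2 * v3)"
      unfolding center_commute[OF cen[of c3], of v1, symmetric] by (simp only: mult.assoc)
    finally show ?thesis by (simp only: unital_hom_mult[OF hsc])
  qed
  show ?thesis
    unfolding yang_baxter_def im12 im13 im23[OF hg(3) gk(3)] comb main by (simp only: mult_ac)
qed

section \<open>The Yang-Baxter equation for the inverse of the partial transpose\<close>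

definition ptrans3 :: "('a, 'n \<times> 'n \<times> 'n) sqm \<Rightarrow> ('a, 'n \<times> 'n \<times> 'n) sqm" where
  "ptrans3 A = Sqm (\<lambda>r s. ent A (fst r, fst (snd r), snd (snd s)) (fst s, fst (snd s), snd (snd r)))"

lemma ent_ptrans3 [simp]: "ent (ptrans3 A) (a, b, c) (a', b', c') = ent A (a, b, c') (a', b', c)"
  by (simp add: ptrans3_def)

lemma ent_tri12_mult:
  fixes Z :: "('a::ring_1, 'n::finite \<times> 'n \<times> 'n) sqm"
  shows "ent (tri12 A * Z) (a, b, c) s = (\<Sum>x\<in>UNIV. \<Sum>y\<in>UNIV. ent A (a, b) (x, y) * ent Z (x, y, c) s)"
    and "ent (Z * tri12 A) s (a, b, c) = (\<Sum>x\<in>UNIV. \<Sum>y\<in>UNIV. ent Z s (x, y, c) * ent A (x, y) (a, b))"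
  by (simp_all add: ent_mult ent_sqm_emb sum_UNIV_pair if_distrib[of "\<lambda>x. x * _"] if_distrib[of "\<lambda>x. _ * x"]
      cong: if_cong)

lemma ent_tri13_tri23:
  fixes A C :: "('a::ring_1, 'n::finite \<times> 'n) sqm"
  shows "ent (tri13 A * tri23 C) (a, b, c) (a', b', c') = (\<Sum>t\<in>UNIV. ent A (a, c) (a', t) * ent C (b, t) (b', c'))"
    and "ent (tri23 C * tri13 A) (a, b, c) (a', b', c') = (\<Sum>t\<in>UNIV. ent C (b, c) (b', t) * ent A (a, t) (a', c'))"
proof -
  have "ent (tri13 A * tri23 C) (a, b, c) (a', b', c') =
      (\<Sum>x\<in>UNIV. \<Sum>y\<in>UNIV. \<Sum>t\<in>UNIV. if x = a' \<and> y = b then ent A (a, c) (x, t) * ent C (y, t) (b', c') else 0)"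
    by (simp add: ent_mult ent_sqm_emb sum_UNIV_pair) (intro sum.cong refl, auto)
  also have "\<dots> = (\<Sum>x\<in>UNIV. \<Sum>y\<in>UNIV. if x = a' then if y = b then \<Sum>t\<in>UNIV. ent A (a, c) (x, t) * ent C (y, t)
      (b', c') else 0 else 0)"
    by (intro sum.cong refl) auto
  also have "\<dots> = (\<Sum>t\<in>UNIV. ent A (a, c) (a', t) * ent C (b, t) (b', c'))"
    by (subst sum.swap) simp
  finally show "ent (tri13 A * tri23 C) (a, b, c) (a', b', c') = (\<Sum>t\<in>UNIV. ent A (a, c) (a', t) * ent C (b, t)
      (b', c'))" .
  have "ent (tri23 C * tri13 A) (a, b, c) (a', b', c') =
      (\<Sum>x\<in>UNIV. \<Sum>y\<in>UNIV. \<Sum>t\<in>UNIV. if x = a \<and> y = b' then ent C (b, c) (y, t) * ent A (x, t) (a', c') else 0)"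
    by (simp add: ent_mult ent_sqm_emb sum_UNIV_pair) (intro sum.cong refl, auto)
  also have "\<dots> = (\<Sum>x\<in>UNIV. \<Sum>y\<in>UNIV. if x = a then if y = b' then \<Sum>t\<in>UNIV. ent C (b, c) (y, t) * ent A (x, t)
      (a', c') else 0 else 0)"
    by (intro sum.cong refl) auto
  also have "\<dots> = (\<Sum>t\<in>UNIV. ent C (b, c) (b', t) * ent A (a, t) (a', c'))"
    by (subst sum.swap) simp
  finally show "ent (tri23 C * tri13 A) (a, b, c) (a', b', c') = (\<Sum>t\<in>UNIV. ent C (b, c) (b', t) * ent A (a, t)
      (a', c'))" .
qed

lemma ptrans3_mult:
  fixes A C :: "('a::comm_ring_1, 'n::finite \<times> 'n) sqm"
  shows "ptrans3 (tri12 A * Z) = tri12 A * ptrans3 Z" "ptrans3 (Z * tri12 A) = ptrans3 Z * tri12 A"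
    and "ptrans3 (tri13 A * tri23 C) = tri23 (ptrans C) * tri13 (ptrans A)"
    and "ptrans3 (tri23 C * tri13 A) = tri13 (ptrans A) * tri23 (ptrans C)"
  by (rule sqm_eqI, simp add: split_paired_all ent_tri12_mult ent_tri13_tri23 mult.commute)+

text \<open>Transposing leg 3 reverses the two factors that meet there, giving
  \<open>b * (y * x) = x * y * b\<close> for the partial transposes \<open>x\<close>,
  \<open>y\<close>; passing to their inverses restores the original order. Thus the construction
  with \<open>Q\<close> respects the same relations, those given by B.\<close>

lemma yang_baxter_ptrans_inverse:
  fixes B Q :: "('k::comm_ring_1 fps, 'n::finite \<times> 'n) sqm"
  assumes yb: "yang_baxter B B" and Q: "Q * ptrans B = 1" "ptrans B * Q = 1"
  shows "yang_baxter B Q"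
proof -
  let ?g = "sub_scale :: 'k fps \<Rightarrow> 'k fps fps" and ?c = "fps_const :: 'k fps \<Rightarrow> 'k fps fps"
  define b where "b = tri12 (sqm_map (fps_map fps_const) B)"
  define x where "x = tri13 (ptrans (sqm_map ?g B))"
  define y where "y = tri23 (ptrans (sqm_map ?c B))"
  define q13 where "q13 = tri13 (sqm_map ?g Q)"
  define q23 where "q23 = tri23 (sqm_map ?c Q)"
  have inv: "q13 * x = 1" "x * q13 = 1" "q23 * y = 1" "y * q23 = 1"
    unfolding q13_def q23_def x_def y_def sqm_map_ptrans[symmetric]
    by (rule unital_hom_inverse[OF unital_hom_leg(6) unital_hom_inverse[OF unital_hom_sqm_map[OF
        unital_hom_sub_scale]]]
        unital_hom_inverse[OF unital_hom_leg(2) unital_hom_inverse[OF unital_hom_sqm_map[OF unital_hom_fps_const]]],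
        rule Q)+
  have "b * (y * x) = (x * y) * b"
    using arg_cong[OF yb[unfolded yang_baxter_def], of ptrans3]
    unfolding mult.assoc[of "tri12 _"] b_def x_def y_def by (simp only: ptrans3_mult)
  then have "(q23 * q13) * (b * (y * x)) * (q13 * q23) = (q23 * q13) * ((x * y) * b) * (q13 * q23)" by simp
  then have "q23 * q13 * b * (y * (x * q13) * q23) = (q23 * (q13 * x) * y) * b * q13 * q23" by (simp only: mult.assoc)
  then show ?thesis
    unfolding yang_baxter_def b_def[symmetric] q13_def[symmetric] q23_def[symmetric] by (simp add: inv)
qed

section \<open>The R-matrix of a Hecke symmetry\<close>

definition sqm_of :: "'a ^ 'i ^ 'i \<Rightarrow> ('a, 'i) sqm" where
  "sqm_of A = Sqm (\<lambda>r s. A $ r $ s)"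

lemma ent_sqm_of [simp]: "ent (sqm_of A) r s = A $ r $ s"
  by (simp add: sqm_of_def)

lemma sqm_of_simps:
  fixes A C :: "'a::ring_1 ^ 'i::finite ^ 'i"
  shows "sqm_of (A ** C) = sqm_of A * sqm_of C" "sqm_of (A + C) = sqm_of A + sqm_of C"
    "sqm_of (A - C) = sqm_of A - sqm_of C" "sqm_of (0 :: 'a ^ 'i ^ 'i) = 0" "sqm_of (mat c) = sqm_scalar c"
    "sqm_of (mat 1 :: 'a ^ 'i ^ 'i) = 1"
  by (rule sqm_eqI, simp add: matrix_matrix_mult_def ent_mult ent_sqm_scalar mat_def ent_one)+

lemma sqm_of_legs:
  "sqm_of (legs12 A) = tri12 (sqm_of A)" "sqm_of (legs23 A) = tri23 (sqm_of A)"
  by (rule sqm_eqI, simp add: legs12_def legs23_def ent_sqm_emb split: prod.splits)+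

lemma sqm_of_flip: "sqm_of flip = flip_sqm"
  by (rule sqm_eqI) (auto simp: flip_def sqm_perm_def prod_eq_iff)

lemma sqm_of_eq_iff: "sqm_of A = sqm_of C \<longleftrightarrow> A = C"
  by (metis ent_sqm_of vec_eq_iff)

text \<open>\<open>matrix_inv\<close> is a choice of two-sided inverse, so it is meaningful once
  some two-sided inverse is exhibited.\<close>

lemma sqm_of_matrix_inv:
  fixes A :: "'a::ring_1 ^ 'i::finite ^ 'i"
  assumes "sqm_of A * C = 1" "C * sqm_of A = 1"
  shows "sqm_of A * sqm_of (matrix_inv A) = 1" "sqm_of (matrix_inv A) * sqm_of A = 1"
proof -
  define C' :: "'a ^ 'i ^ 'i" where "C' = (\<chi> r s. ent C r s)"
  have "sqm_of C' = C" by (rule sqm_eqI) (simp add: C'_def)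
  then have "A ** C' = mat 1 \<and> C' ** A = mat 1"
    using assms by (simp add: sqm_of_simps(1,6) flip: sqm_of_eq_iff)
  then have "A ** matrix_inv A = mat 1 \<and> matrix_inv A ** A = mat 1"
    unfolding matrix_inv_def by (rule someI)
  then show "sqm_of A * sqm_of (matrix_inv A) = 1" "sqm_of (matrix_inv A) * sqm_of A = 1"
    by (simp_all flip: sqm_of_simps(1,6))
qed

lemma hecke_sqm:
  assumes "hecke_symmetry R"
  defines "\<kappa> \<equiv> fps_exp 1 - fps_exp (-1) :: complex fps"
  shows "sqm_of R * sqm_of R = 1 + sqm_scalar \<kappa> * sqm_of R"
    and "tri12 (sqm_of R) * tri23 (sqm_of R) * tri12 (sqm_of R) = tri23 (sqm_of R) * tri12 (sqm_of R) * tri23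
        (sqm_of R)"
proof -
  let ?e = "sqm_scalar (fps_exp 1 :: complex fps)" and ?e' = "sqm_scalar (fps_exp (- 1) :: complex fps)"
  have h: "(sqm_of R - ?e) * (sqm_of R + ?e') = 0"
    using assms(1) unfolding hecke_symmetry_def by (metis sqm_of_simps)
  have ee: "?e * ?e' = 1"
    by (simp add: fps_exp_add_mult[symmetric] unital_hom_one[OF unital_hom_sqm_scalar] flip: unital_hom_mult[OF
        unital_hom_sqm_scalar])
  have c: "sqm_of R * ?e' = ?e' * sqm_of R" by (rule sqm_scalar_central[symmetric])
  have k: "sqm_scalar \<kappa> = ?e - ?e'"
    unfolding \<kappa>_def by (rule unital_hom_diff[OF unital_hom_sqm_scalar])
  have "sqm_of R * sqm_of R + ?e' * sqm_of R = ?e * sqm_of R + 1"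
    using h by (simp add: algebra_simps c ee)
  then show "sqm_of R * sqm_of R = 1 + sqm_scalar \<kappa> * sqm_of R"
    unfolding k by (simp add: algebra_simps)
  have "sqm_of (legs12 R ** legs23 R ** legs12 R) = sqm_of (legs23 R ** legs12 R ** legs23 R)"
    using assms(1) unfolding hecke_symmetry_def by simp
  then show "tri12 (sqm_of R) * tri23 (sqm_of R) * tri12 (sqm_of R) = tri23 (sqm_of R) * tri12 (sqm_of R) *
      tri23 (sqm_of R)"
    by (simp only: sqm_of_simps(1) sqm_of_legs)
qed

text \<open>In entries, the two trace conditions say that \<Psi>, with its four indices rearranged,
  is an inverse of the partial transpose of P R: the first condition on the left, the second on the
  right.\<close>

lemma skew_invertible_sqm:
  fixes R :: "complex fps ^ ('n::finite \<times> 'n) ^ ('n \<times> 'n)"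
  assumes "skew_invertible R"
  obtains Y where "ptrans (flip_sqm * sqm_of R) * Y = 1" "Y * ptrans (flip_sqm * sqm_of R) = 1"
proof -
  obtain \<Psi> where 1: "trace2 (legs12 R ** legs23 \<Psi>) = flip" and 2: "trace2 (legs12 \<Psi> ** legs23 R) = flip"
    using assms unfolding skew_invertible_def by blast
  have tr: "trace2 (legs12 A ** legs23 C) $ (i1, i3) $ (j1, j3) = (\<Sum>k\<in>UNIV. \<Sum>c\<in>UNIV. A $ (i1, k) $ (j1, c) * C $
      (c, i3) $ (k, j3))"
    for A C :: "complex fps ^ ('n \<times> 'n) ^ ('n \<times> 'n)" and i1 i3 j1 j3
  proof -
    have "(legs12 A ** legs23 C) $ (i1, k, i3) $ (j1, k, j3) = (\<Sum>c\<in>UNIV. A $ (i1, k) $ (j1, c) * C $ (c, i3) $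
        (k, j3))" for k
    proof -
      have "(legs12 A ** legs23 C) $ (i1, k, i3) $ (j1, k, j3) =
          (\<Sum>x\<in>UNIV. \<Sum>y\<in>UNIV. \<Sum>z\<in>UNIV. if x = j1 \<and> z = i3 then A $ (i1, k) $ (x, y) * C $ (y, z) $ (k, j3) else 0)"
        by (simp add: matrix_matrix_mult_def legs12_def legs23_def sum_UNIV_pair) (intro sum.cong refl, auto)
      also have "\<dots> = (\<Sum>x\<in>UNIV. if x = j1 then \<Sum>y\<in>UNIV. \<Sum>z\<in>UNIV. if z = i3 then A $ (i1, k) $ (x, y) * C $ (y, z)
          $ (k, j3) else 0 else 0)"
        by (intro sum.cong refl) auto
      finally show ?thesis by simp
    qed
    then show ?thesis by (simp add: trace2_def)
  qed
  define Y :: "(complex fps, 'n \<times> 'n) sqm" where "Y = Sqm (\<lambda>r s. \<Psi> $ (snd s, fst r) $ (fst s, snd r))"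
  have K0: "ent (ptrans (flip_sqm * sqm_of R)) (x, y) (z, w) = R $ (w, x) $ (z, y)" for x y z w
    by (simp add: perm_simps)
  have "Y * ptrans (flip_sqm * sqm_of R) = 1"
  proof (rule sqm_eqI)
    fix r s :: "'n \<times> 'n"
    have "ent (Y * ptrans (flip_sqm * sqm_of R)) r s = trace2 (legs12 R ** legs23 \<Psi>) $ (snd s, fst r) $ (fst s,
        snd r)"
      unfolding tr by (cases s) (simp add: ent_mult sum_UNIV_pair K0 Y_def mult.commute del: ent_ptrans)
    then show "ent (Y * ptrans (flip_sqm * sqm_of R)) r s = ent 1 r s"
      unfolding 1 by (auto simp: flip_def ent_one prod_eq_iff)
  qed
  moreover have "ptrans (flip_sqm * sqm_of R) * Y = 1"
  proof (rule sqm_eqI)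
    fix r s :: "'n \<times> 'n"
    have "ent (ptrans (flip_sqm * sqm_of R) * Y) r s = trace2 (legs12 \<Psi> ** legs23 R) $ (snd s, fst r) $ (fst s,
        snd r)"
      unfolding tr by (cases r) (simp add: ent_mult sum_UNIV_pair K0 Y_def mult.commute del: ent_ptrans)
    then show "ent (ptrans (flip_sqm * sqm_of R) * Y) r s = ent 1 r s"
      unfolding 2 by (auto simp: flip_def ent_one prod_eq_iff)
  qed
  ultimately show ?thesis using that by blast
qed

lemma Rbar_sqm:
  fixes R :: "complex fps ^ ('n::finite \<times> 'n) ^ ('n \<times> 'n)"
  shows "sqm_of (Rbar M R) = baxter_matrix (fbar M) (baxter_alpha (fps_exp 1 - fps_exp (-1)) (inverse (1 -
      fps_X))) (sqm_of R)"
proof (rule sqm_eqI)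
  fix r s :: "'n \<times> 'n"
  have 1: "(flip ** R) $ r $ s = R $ prod.swap r $ s"
    using arg_cong[OF sqm_of_simps(1)[of flip R], of "\<lambda>A. ent A r s"] by (simp add: sqm_of_flip perm_simps)
  have 2: "(flip :: complex fps ^ ('n \<times> 'n) ^ ('n \<times> 'n)) $ r $ s = (if prod.swap r = s then 1 else 0)"
    by (auto simp: flip_def prod_eq_iff)
  show "ent (sqm_of (Rbar M R)) r s = ent (baxter_matrix (fbar M) (baxter_alpha (fps_exp 1 - fps_exp (-1))
      (inverse (1 - fps_X))) (sqm_of R)) r s"
    by (simp add: Rbar_def baxter_matrix_def baxter_alpha_def perm_simps 1 2 ent_sqm_scalar)
qed

text \<open>The Hecke relation gives (R + \<alpha>)(R - \<kappa> - \<alpha>) = 1 - \<alpha>(\<kappa>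
  + \<alpha>), a scalar series in x with constant term 1 and therefore invertible.\<close>

lemma baxter_matrix_inverse:
  fixes R :: "(complex fps, 'n::finite \<times> 'n) sqm"
  assumes f: "fps_nth f 0 = 1" and \<alpha>: "fps_nth \<alpha> 0 = 0" and sq: "R * R = 1 + sqm_scalar \<kappa> * R"
  obtains Bi where "baxter_matrix f \<alpha> R * Bi = 1" "Bi * baxter_matrix f \<alpha> R = 1"
proof -
  define R' where "R' = sqm_map fps_const R"
  define A where "A = (sqm_scalar \<alpha> :: (complex fps fps, 'n \<times> 'n) sqm)"
  define k where "k = (sqm_scalar (fps_const \<kappa>) :: (complex fps fps, 'n \<times> 'n) sqm)"
  define sc where "sc = (sqm_scalar :: _ \<Rightarrow> (complex fps fps, 'n \<times> 'n) sqm)"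
  have hsc: "unital_hom sc" unfolding sc_def by (rule unital_hom_sqm_scalar)
  have cen: "sc c * Z = Z * sc c" for c Z unfolding sc_def by (rule sqm_scalar_central)
  have Ak: "A = sc \<alpha>" "k = sc (fps_const \<kappa>)" by (simp_all add: A_def k_def sc_def)
  have sq': "R' * R' = 1 + k * R'"
    using arg_cong[OF sq, of "sqm_map fps_const"] unfolding R'_def k_def
    by (simp only: unital_hom_mult[OF unital_hom_sqm_map[OF unital_hom_fps_const]]
        unital_hom_add[OF unital_hom_sqm_map[OF unital_hom_fps_const]]
        sqm_map_scalar[of fps_const, OF unital_hom_zero[OF unital_hom_fps_const]]
        unital_hom_one[OF unital_hom_sqm_map[OF unital_hom_fps_const]])
  define d where "d = 1 - \<alpha> * (fps_const \<kappa> + \<alpha>)"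
  have d: "d * inverse d = 1" using \<alpha> by (intro fps_inverse_of_unit) (simp add: d_def)
  have f': "f * inverse f = 1" by (rule fps_inverse_of_unit[OF f])
  have RA: "R' * A = A * R'" "R' * k = k * R'" "A * k = k * A" unfolding Ak by (rule cen[symmetric])+
  have scd: "sc d = 1 - A * (k + A)"
    by (simp add: d_def Ak unital_hom_one[OF hsc] unital_hom_add[OF hsc] unital_hom_mult[OF hsc]
        unital_hom_diff[OF hsc])
  have e1: "(R' + A) * (R' - k - A) = sc d"
    unfolding scd by (simp add: algebra_simps sq' RA)
  have e2: "(R' - k - A) * (R' + A) = sc d"
    unfolding scd by (simp add: algebra_simps sq' RA)
  have P: "flip_sqm * (flip_sqm :: (complex fps fps, 'n \<times> 'n) sqm) = 1"
    by (rule sqm_eqI, simp add: perm_simps) (auto simp: sqm_perm_def ent_one)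
  have B: "baxter_matrix f \<alpha> R = sc f * (flip_sqm * (R' + A))"
    by (simp add: baxter_matrix_def sc_def R'_def A_def)
  define Bi where "Bi = (sc (inverse f) * sc (inverse d)) * ((R' - k - A) * flip_sqm)"
  have ff: "sc f * sc (inverse f) = 1" "sc d * sc (inverse d) = 1"
    using f' d by (simp_all add: unital_hom_one[OF hsc] flip: unital_hom_mult[OF hsc])
  have "baxter_matrix f \<alpha> R * Bi = sc f * ((flip_sqm * (R' + A)) * (sc (inverse f) * sc (inverse d))) * ((R' - k
      - A) * flip_sqm)"
    unfolding B Bi_def by (simp only: mult.assoc)
  also have "(flip_sqm * (R' + A)) * (sc (inverse f) * sc (inverse d)) = (sc (inverse f) * sc (inverse d)) *
      (flip_sqm * (R' + A))"
    unfolding unital_hom_mult[OF hsc, symmetric] by (rule cen[symmetric])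
  also have "sc f * ((sc (inverse f) * sc (inverse d)) * (flip_sqm * (R' + A))) * ((R' - k - A) * flip_sqm) =
     (sc f * sc (inverse f)) * sc (inverse d) * flip_sqm * ((R' + A) * (R' - k - A)) * flip_sqm"
    by (simp only: mult.assoc)
  also have "\<dots> = sc (inverse d) * (flip_sqm * sc d) * flip_sqm" unfolding e1 ff by (simp add: mult.assoc)
  also have "\<dots> = (sc (inverse d) * sc d) * (flip_sqm * flip_sqm)" unfolding cen[of d flip_sqm, symmetric] by
      (simp only: mult.assoc)
  also have "\<dots> = 1" by (simp add: P cen[of "inverse d" "sc d"] ff)
  finally have r: "baxter_matrix f \<alpha> R * Bi = 1" .
  have "Bi * baxter_matrix f \<alpha> R = (sc (inverse f) * sc (inverse d)) * ((R' - k - A) * flip_sqm * sc f) *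
      (flip_sqm * (R' + A))"
    unfolding B Bi_def by (simp only: mult.assoc)
  also have "(R' - k - A) * flip_sqm * sc f = sc f * ((R' - k - A) * flip_sqm)" by (rule cen[symmetric])
  also have "(sc (inverse f) * sc (inverse d)) * (sc f * ((R' - k - A) * flip_sqm)) * (flip_sqm * (R' + A)) =
      sc (inverse f) * (sc (inverse d) * sc f) * ((R' - k - A) * (flip_sqm * flip_sqm) * (R' + A))"
    by (simp only: mult.assoc)
  also have "\<dots> = sc (inverse f) * (sc f * sc (inverse d)) * sc d"
    unfolding P by (simp only: mult_1_right e2 cen[of "inverse d" "sc f"])
  also have "\<dots> = (sc (inverse f) * sc f) * (sc (inverse d) * sc d)" by (simp only: mult.assoc)
  also have "\<dots> = 1" by (simp add: cen[of "inverse d" "sc d"] cen[of "inverse f" "sc f"] ff)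
  finally have l: "Bi * baxter_matrix f \<alpha> R = 1" .
  from r l show ?thesis by (rule that)
qed

text \<open>\<^term>\<open>ptrans flip_sqm\<close> has rank one, so the Sherman--Morrison formula inverts the partial transpose.\<close>

lemma ptrans_baxter_matrix_inverse:
  fixes R :: "(complex fps, 'n::finite \<times> 'n) sqm"
  assumes f: "fps_nth f 0 = 1" and \<alpha>: "fps_nth \<alpha> 0 = 0"
    and Y: "ptrans (flip_sqm * R) * Y = 1" "Y * ptrans (flip_sqm * R) = 1"
  obtains Q where "Q * ptrans (baxter_matrix f \<alpha> R) = 1" "ptrans (baxter_matrix f \<alpha> R) * Q = 1"
proof -
  define sc where "sc = (sqm_scalar :: _ \<Rightarrow> (complex fps fps, 'n \<times> 'n) sqm)"
  have hsc: "unital_hom sc" unfolding sc_def by (rule unital_hom_sqm_scalar)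
  have cen: "sc c * Z = Z * sc c" for c Z unfolding sc_def by (rule sqm_scalar_central)
  define k0 where "k0 = sqm_map fps_const (ptrans (flip_sqm * R))"
  define y where "y = sqm_map fps_const Y"
  define k1 where "k1 = ptrans (flip_sqm :: (complex fps fps, 'n \<times> 'n) sqm)"
  have ky: "k0 * y = 1" "y * k0 = 1"
    unfolding k0_def y_def by (rule unital_hom_inverse[OF unital_hom_sqm_map[OF unital_hom_fps_const]], rule Y)+
  have B: "ptrans (baxter_matrix f \<alpha> R) = sc f * (k0 + sc \<alpha> * k1)"
  proof -
    have "flip_sqm * sqm_map fps_const R = sqm_map fps_const (flip_sqm * R)"
      unfolding unital_hom_mult[OF unital_hom_sqm_map[OF unital_hom_fps_const]]
      by (simp add: sqm_map_perm)
    moreover have "flip_sqm * sqm_scalar \<alpha> = sc \<alpha> * flip_sqm" unfolding sc_def by (rule sqm_scalar_central[symmetric])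
    ultimately have "baxter_matrix f \<alpha> R = sc f * (sqm_map fps_const (flip_sqm * R) + sc \<alpha> * flip_sqm)"
      by (simp add: baxter_matrix_def sc_def distrib_left)
    then show ?thesis
      by (intro sqm_eqI) (simp add: sc_def k0_def k1_def)
  qed
  \<comment> \<open>\<open>k1\<close> is v v^T for v the sum of all e_a \<otimes> e_a, and \<tau> is
    the number v^T y v.\<close>
  define \<tau> where "\<tau> = (\<Sum>a\<in>UNIV. \<Sum>c\<in>UNIV. ent y (a, a) (c, c))"
  have k1: "ent k1 (a, b) (c, d) = (if a = b \<and> c = d then 1 else 0)" for a b c d
    by (auto simp: k1_def sqm_perm_def)
  have kyk: "k1 * y * k1 = sc \<tau> * k1"
  proof (rule sqm_eqI)
    fix r s :: "'n \<times> 'n"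
    obtain a b c d where [simp]: "r = (a, b)" "s = (c, d)" by (cases r, cases s)
    have 1: "ent (k1 * Z) (a, b) t = (if a = b then \<Sum>i\<in>UNIV. ent Z (i, i) t else 0)" for Z t a b
      by (cases "a = b") (simp_all add: ent_mult sum_UNIV_pair k1 if_distrib[of "\<lambda>x. x * _"] cong: if_cong)
    have 2: "ent (Z * k1) t (c, d) = (if c = d then \<Sum>i\<in>UNIV. ent Z t (i, i) else 0)" for Z t c d
      by (cases "c = d") (simp_all add: ent_mult sum_UNIV_pair k1 if_distrib[of "\<lambda>x. _ * x"] cong: if_cong)
    have "ent (k1 * y * k1) r s = (if a = b \<and> c = d then \<tau> else 0)"
      by (simp add: mult.assoc 1 2 \<tau>_def)
    also have "\<dots> = ent (sc \<tau> * k1) r s"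
      by (simp add: sc_def k1)
    finally show "ent (k1 * y * k1) r s = ent (sc \<tau> * k1) r s" .
  qed
  \<comment> \<open>Chosen to solve \<alpha> = \<sigma>(1 + \<alpha>\<tau>), which is the condition
    for \<open>y - sc \<sigma> * (y * k1 * y)\<close> to invert
    \<open>k0 + sc \<alpha> * k1\<close>.\<close>
  define \<sigma> where "\<sigma> = \<alpha> * inverse (1 + \<alpha> * \<tau>)"
  have "(1 + \<alpha> * \<tau>) * inverse (1 + \<alpha> * \<tau>) = 1" using \<alpha> by (intro fps_inverse_of_unit) simp
  then have "\<alpha> = \<sigma> * (1 + \<alpha> * \<tau>)" unfolding \<sigma>_def by (simp add: mult_ac)
  then have "\<alpha> - \<sigma> - \<alpha> * \<sigma> * \<tau> = 0" by (simp add: algebra_simps)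
  then have s0: "sc \<alpha> - sc \<sigma> - sc \<alpha> * sc \<sigma> * sc \<tau> = 0"
    by (simp add: unital_hom_zero[OF hsc] flip: unital_hom_mult[OF hsc] unital_hom_diff[OF hsc])
  define V where "V = y - sc \<sigma> * (y * k1 * y)"
  have 1: "(k0 + sc \<alpha> * k1) * V = 1"
  proof -
    have "k0 * V = k0 * y - (k0 * sc \<sigma>) * (y * k1 * y)" by (simp add: V_def right_diff_distrib mult.assoc)
    also have "\<dots> = k0 * y - sc \<sigma> * ((k0 * y) * k1 * y)" unfolding cen[of \<sigma> k0, symmetric] by (simp only: mult.assoc)
    finally have a: "k0 * V = 1 - sc \<sigma> * (k1 * y)" by (simp add: ky)
    have "sc \<alpha> * k1 * V = sc \<alpha> * (k1 * y) - sc \<alpha> * (k1 * sc \<sigma>) * (y * k1 * y)" by (simp add: V_def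
        right_diff_distrib mult.assoc)
    also have "\<dots> = sc \<alpha> * (k1 * y) - sc \<alpha> * sc \<sigma> * ((k1 * y * k1) * y)" unfolding cen[of \<sigma> k1, symmetric] by
        (simp only: mult.assoc)
    also have "\<dots> = sc \<alpha> * (k1 * y) - sc \<alpha> * sc \<sigma> * sc \<tau> * (k1 * y)" unfolding kyk by (simp only: mult.assoc)
    finally have "(k0 + sc \<alpha> * k1) * V = 1 + (sc \<alpha> - sc \<sigma> - sc \<alpha> * sc \<sigma> * sc \<tau>) * (k1 * y)"
      by (simp add: distrib_right a left_diff_distrib)
    then show ?thesis by (simp add: s0)
  qed
  have 2: "V * (k0 + sc \<alpha> * k1) = 1"
  proof -
    have a: "V * k0 = 1 - sc \<sigma> * (y * k1)" by (simp add: V_def left_diff_distrib mult.assoc ky)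
    have "V * (sc \<alpha> * k1) = sc \<alpha> * (V * k1)" unfolding mult.assoc[symmetric] cen[of \<alpha> V] ..
    also have "\<dots> = sc \<alpha> * (y * k1) - sc \<alpha> * sc \<sigma> * (y * (k1 * y * k1))" by (simp add: V_def left_diff_distrib
        right_diff_distrib mult.assoc)
    also have "\<dots> = sc \<alpha> * (y * k1) - sc \<alpha> * sc \<sigma> * ((y * sc \<tau>) * k1)" unfolding kyk by (simp only: mult.assoc)
    also have "\<dots> = sc \<alpha> * (y * k1) - sc \<alpha> * sc \<sigma> * sc \<tau> * (y * k1)" unfolding cen[of \<tau> y, symmetric] by (simp
        only: mult.assoc)
    finally have "V * (k0 + sc \<alpha> * k1) = 1 + (sc \<alpha> - sc \<sigma> - sc \<alpha> * sc \<sigma> * sc \<tau>) * (y * k1)"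
      by (simp add: distrib_left a left_diff_distrib)
    then show ?thesis by (simp add: s0)
  qed
  have ff: "sc f * sc (inverse f) = 1" "sc (inverse f) * sc f = 1"
    using fps_inverse_of_unit[OF f] by (simp_all add: unital_hom_one[OF hsc] mult.commute flip:
        unital_hom_mult[OF hsc])
  define Q where "Q = sc (inverse f) * V"
  have "Q * ptrans (baxter_matrix f \<alpha> R) = sc (inverse f) * (V * sc f) * (k0 + sc \<alpha> * k1)"
    unfolding Q_def B by (simp only: mult.assoc)
  also have "\<dots> = sc (inverse f) * sc f * (V * (k0 + sc \<alpha> * k1))"
    unfolding cen[of f V, symmetric] by (simp only: mult.assoc)
  finally have q1: "Q * ptrans (baxter_matrix f \<alpha> R) = 1" by (simp add: 2 ff)
  have "ptrans (baxter_matrix f \<alpha> R) * Q = sc f * ((k0 + sc \<alpha> * k1) * sc (inverse f)) * V"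
    unfolding Q_def B by (simp only: mult.assoc)
  also have "\<dots> = sc f * sc (inverse f) * ((k0 + sc \<alpha> * k1) * V)"
    unfolding cen[of "inverse f" "k0 + sc \<alpha> * k1", symmetric] by (simp only: mult.assoc)
  finally have "ptrans (baxter_matrix f \<alpha> R) * Q = 1" by (simp add: 1 ff)
  with q1 show ?thesis by (rule that)
qed

lemma Rbar_exchange:
  fixes R :: "complex fps ^ ('n::finite \<times> 'n) ^ ('n \<times> 'n)"
  assumes "M > 0" "hecke_symmetry R" "skew_invertible R"
  shows "yang_baxter (sqm_of (Rbar M R)) (sqm_of (Rbar M R))"
    and "exchange (sqm_of (Rbar M R)) (sqm_of (matrix_inv (Rbar M R)))"
    and "\<exists>Q. exchange Q (ptrans (sqm_of (Rbar M R))) \<and> yang_baxter (sqm_of (Rbar M R)) Q"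
proof -
  let ?\<kappa> = "fps_exp 1 - fps_exp (-1) :: complex fps"
  let ?\<alpha> = "baxter_alpha ?\<kappa> (inverse (1 - fps_X))"
  note hs = hecke_sqm[OF assms(2)]
  have f: "fps_nth (fbar M) 0 = 1" by (rule fbar_nth_0[OF assms(1)])
  have \<alpha>: "fps_nth ?\<alpha> 0 = 0" by (simp add: baxter_alpha_def)
  show yb: "yang_baxter (sqm_of (Rbar M R)) (sqm_of (Rbar M R))"
    unfolding Rbar_sqm by (rule yang_baxter_baxter_matrix[OF fps_inverse_of_unit hs]) simp
  obtain Bi where "sqm_of (Rbar M R) * Bi = 1" "Bi * sqm_of (Rbar M R) = 1"
    unfolding Rbar_sqm by (rule baxter_matrix_inverse[OF f \<alpha> hs(1)])
  from sqm_of_matrix_inv[OF this] show "exchange (sqm_of (Rbar M R)) (sqm_of (matrix_inv (Rbar M R)))"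
    by (rule exchange.intro)
  obtain Y where "ptrans (flip_sqm * sqm_of R) * Y = 1" "Y * ptrans (flip_sqm * sqm_of R) = 1"
    by (rule skew_invertible_sqm[OF assms(3)])
  then obtain Q where Q: "Q * ptrans (sqm_of (Rbar M R)) = 1" "ptrans (sqm_of (Rbar M R)) * Q = 1"
    unfolding Rbar_sqm by (rule ptrans_baxter_matrix_inverse[OF f \<alpha>])
  from exchange.intro[OF Q] yang_baxter_ptrans_inverse[OF yb Q]
  show "\<exists>Q. exchange Q (ptrans (sqm_of (Rbar M R))) \<and> yang_baxter (sqm_of (Rbar M R)) Q" by blast
qed

section \<open>The quotient algebra\<close>

lemma app_diff: "app e (u - v) = app e u - app e v"
  using app_add[of e u "- v"] by simp

lemma ring_type_simps:
  "carrier ring_of_type_algebra = UNIV" "monoid.mult ring_of_type_algebra = (*)"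
  "one ring_of_type_algebra = 1" "zero ring_of_type_algebra = 0" "add ring_of_type_algebra = (+)"
  by (simp_all add: ring_of_type_algebra_def)

lemma ring_of_type: "ring (ring_of_type_algebra :: 'a::ring_1 ring)"
proof -
  have "\<exists>y. x + y = 0 \<and> y + x = 0" for x :: 'a by (rule exI[of _ "- x"]) simp
  then show ?thesis
    unfolding ring_of_type_algebra_def by unfold_locales (auto simp: algebra_simps Units_def)
qed

lemma minus_ring_of_type: "a_inv (ring_of_type_algebra :: 'a::ring_1 ring) x = - x"
proof -
  interpret ring "ring_of_type_algebra :: 'a ring" by (rule ring_of_type)
  show ?thesis using minus_equality[of "- x" x] by (simp add: ring_type_simps)
qed

lemma ideal_type_iff:
  "ideal J (ring_of_type_algebra :: 'a::ring_1 ring) \<longleftrightarrow>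
   0 \<in> J \<and> (\<forall>u\<in>J. \<forall>v\<in>J. u + v \<in> J) \<and> (\<forall>v\<in>J. \<forall>a. a * v \<in> J \<and> v * a \<in> J)" (is "?L \<longleftrightarrow> ?R")
proof
  assume ?L
  then interpret ideal J "ring_of_type_algebra :: 'a ring" .
  show ?R
    using additive_subgroup.zero_closed[OF is_additive_subgroup] additive_subgroup.a_closed[OF is_additive_subgroup]
      I_l_closed I_r_closed by (simp add: ring_type_simps)
next
  assume R: ?R
  then have m: "- v \<in> J" if "v \<in> J" for v
    using that by (metis mult_minus1)
  show ?L
  proof (rule idealI)
    show "ring (ring_of_type_algebra :: 'a ring)" by (rule ring_of_type)
    show "subgroup J (add_monoid (ring_of_type_algebra :: 'a ring))"
    proof (rule subgroup.intro)
      fix x assume "x \<in> J"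
      then show "inv\<^bsub>add_monoid (ring_of_type_algebra :: 'a ring)\<^esub> x \<in> J"
        using m minus_ring_of_type[of x] unfolding a_inv_def by simp
    qed (use R in \<open>simp_all add: ring_type_simps\<close>)
  qed (use R in \<open>auto simp: ring_type_simps\<close>)
qed

context
  fixes B :: "complex fps fps ^ ('n::finite \<times> 'n) ^ ('n \<times> 'n)"
begin

abbreviation (input) "J \<equiv> rtt_ideal B"
abbreviation (input) "cl \<equiv> rtt_class B"
abbreviation (input) "Y \<equiv> Y_RTT B"

lemma rtt_ideal_ideal: "ideal J ring_of_type_algebra"
  and rtt_ideal_closed: "closed J"
  and rtt_relator_in: "rtt_relator B i k j l p q \<in> J"
  and rtt_ideal_saturated: "fps_X * a \<in> J \<Longrightarrow> a \<in> J"
proof -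
  define \<K> where "\<K> = {J. ideal J ring_of_type_algebra \<and> (\<forall>i k j l p q. rtt_relator B i k j l p q \<in> J) \<and>
    closed J \<and> (\<forall>a. fps_X * a \<in> J \<longrightarrow> a \<in> J)}"
  have J: "J = \<Inter> \<K>" by (simp add: rtt_ideal_def \<K>_def)
  have K: "ideal K ring_of_type_algebra" "rtt_relator B i k j l p q \<in> K" "closed K" "fps_X * a \<in> K \<Longrightarrow> a \<in> K"
    if "K \<in> \<K>" for K i k j l p q a using that by (simp_all add: \<K>_def)
  show "ideal J ring_of_type_algebra"
    unfolding ideal_type_iff J by (intro conjI ballI allI InterI) (use K(1)[unfolded ideal_type_iff] in blast)+
  show "closed J" unfolding J by (rule closed_Inter) (use K(3) in blast)
  show "rtt_relator B i k j l p q \<in> J" unfolding J using K(2) by blast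
  show "fps_X * a \<in> J \<Longrightarrow> a \<in> J" unfolding J using K(4) by blast
qed

lemma rtt_ideal_zero: "0 \<in> J"
  and rtt_ideal_add: "u \<in> J \<Longrightarrow> v \<in> J \<Longrightarrow> u + v \<in> J"
  and rtt_ideal_left: "v \<in> J \<Longrightarrow> a * v \<in> J"
  and rtt_ideal_right: "v \<in> J \<Longrightarrow> v * a \<in> J"
  using rtt_ideal_ideal by (simp_all add: ideal_type_iff)

lemma rtt_ideal_uminus: "v \<in> J \<Longrightarrow> - v \<in> J"
  using rtt_ideal_left[of v "-1"] by simp

lemma rtt_ideal_diff: "u \<in> J \<Longrightarrow> v \<in> J \<Longrightarrow> u - v \<in> J"
  using rtt_ideal_add[of u "- v"] rtt_ideal_uminus by simp

lemma rtt_ideal_closed_submodule: "closed_submodule J"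
  by (simp add: closed_submodule_def rtt_ideal_closed rtt_ideal_zero rtt_ideal_add rtt_ideal_left)

lemma rtt_ideal_least:
  assumes "ideal K ring_of_type_algebra" "\<And>i k j l p q. rtt_relator B i k j l p q \<in> K" "closed K"
    "\<And>a. fps_X * a \<in> K \<Longrightarrow> a \<in> K"
  shows "J \<subseteq> K"
  unfolding rtt_ideal_def using assms by auto

lemma rtt_class_alt: "cl v = {u. u - v \<in> J}"
proof -
  have "u \<in> cl v \<longleftrightarrow> (\<exists>j\<in>J. u = j + v)" for u
    by (auto simp: rtt_class_def a_r_coset_def' ring_type_simps)
  then show ?thesis by (force simp: algebra_simps)
qed

lemma rtt_class_eq_iff: "cl u = cl v \<longleftrightarrow> u - v \<in> J"
proof
  assume "cl u = cl v"
  then show "u - v \<in> J" using rtt_ideal_zero by (auto simp: rtt_class_alt)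
next
  assume uv: "u - v \<in> J"
  have "w - v \<in> J" if "w - u \<in> J" for w using rtt_ideal_add[OF that uv] by simp
  moreover have "w - u \<in> J" if "w - v \<in> J" for w using rtt_ideal_diff[OF that uv] by simp
  ultimately show "cl u = cl v" by (auto simp: rtt_class_alt)
qed

lemma Y_carrier: "carrier Y = range cl"
  by (auto simp: Y_RTT_def Let_def FactRing_def A_RCOSETS_def' ring_type_simps rtt_class_def)

lemma class_in_Y [simp]: "cl v \<in> carrier Y"
  by (simp add: Y_carrier)

lemma Y_add: "cl u \<oplus>\<^bsub>Y\<^esub> cl v = cl (u + v)"
proof -
  interpret ideal J "ring_of_type_algebra" by (rule rtt_ideal_ideal)
  show ?thesis
    using a_rcos_sum[of u v] by (simp add: Y_RTT_def Let_def FactRing_def rtt_class_def ring_type_simps)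
qed

lemma Y_mult: "cl u \<otimes>\<^bsub>Y\<^esub> cl v = cl (u * v)"
proof -
  interpret ideal J "ring_of_type_algebra" by (rule rtt_ideal_ideal)
  show ?thesis
    using rcoset_mult_add[of u v] by (simp add: Y_RTT_def Let_def FactRing_def rtt_class_def ring_type_simps)
qed

lemma Y_smult: "s \<odot>\<^bsub>Y\<^esub> cl v = cl (scal s * v)"
proof -
  have "s \<odot>\<^bsub>Y\<^esub> cl v = cl (scal s) \<otimes>\<^bsub>Y\<^esub> cl v"
    by (simp add: Y_RTT_def Let_def)
  then show ?thesis by (simp add: Y_mult)
qed

lemma Y_one: "\<one>\<^bsub>Y\<^esub> = cl 1"
  by (simp add: Y_RTT_def Let_def FactRing_def rtt_class_def ring_type_simps)

lemma Y_zero: "\<zero>\<^bsub>Y\<^esub> = cl 0"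
proof -
  have "\<zero>\<^bsub>Y\<^esub> = J" by (simp add: Y_RTT_def Let_def FactRing_def)
  then show ?thesis by (simp add: rtt_class_alt)
qed

lemma Y_finsum: "finite A \<Longrightarrow> finsum Y (\<lambda>x. cl (f x)) A = cl (sum f A)"
proof -
  assume fin: "finite A"
  have "Group.comm_monoid (add_monoid Y)"
    by (rule comm_monoidI)
       (auto simp: Y_carrier Y_zero Y_add add_ac)
  then interpret abelian_monoid Y by (rule abelian_monoid.intro)
  show ?thesis
    using fin by (induction A rule: finite_induct) (simp_all add: Y_zero Y_add)
qed

lemma class_surj:
  assumes "V \<in> carrier Y" obtains v where "V = cl v"
  using assms by (auto simp: Y_carrier)

section \<open>Operator series on the quotient\<close>

definition op_of :: "('n endo fps, 'n) sqm \<Rightarrow> ('n, 'n falg set) opser" where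
  "op_of \<Theta> = (\<lambda>i j. \<lambda>V\<in>carrier Y. \<lambda>p. cl (app (fps_nth (ent \<Theta> i j) p) (SOME v. V = cl v)))"

definition preserves_ideal :: "('n endo fps, 'n) sqm \<Rightarrow> bool" where
  "preserves_ideal \<Theta> \<longleftrightarrow> (\<forall>i j p. \<forall>v\<in>J. app (fps_nth (ent \<Theta> i j) p) v \<in> J)"

definition locally_finite :: "('n endo fps, 'n) sqm \<Rightarrow> bool" where
  "locally_finite \<Theta> \<longleftrightarrow> (\<forall>ws. \<exists>r0. \<forall>r\<ge>r0. \<forall>i j. app (fps_nth (ent \<Theta> i j) r) (wd ws) = 0)"

text \<open>The value at a class is computed from a chosen representative; another one differs by an
  element of J, which \<open>\<Theta>\<close> keeps in J.\<close>

lemma op_of_class: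
  assumes "preserves_ideal \<Theta>" shows "op_of \<Theta> i j (cl v) p = cl (app (fps_nth (ent \<Theta> i j) p) v)"
proof -
  define u where "u = (SOME u. cl v = cl u)"
  have "cl v = cl u" unfolding u_def by (rule someI[of _ v]) simp
  then have "u - v \<in> J" by (metis rtt_class_eq_iff)
  then have "app (fps_nth (ent \<Theta> i j) p) (u - v) \<in> J" using assms by (simp add: preserves_ideal_def)
  then have "cl (app (fps_nth (ent \<Theta> i j) p) u) = cl (app (fps_nth (ent \<Theta> i j) p) v)"
    by (simp add: rtt_class_eq_iff app_diff)
  then show ?thesis by (simp add: op_of_def u_def)
qed

text \<open>On a word almost all coefficients vanish, but a general element involves infinitely many
  words and only h-adic decay survives. For fixed k, the elements with decay modulo h^k form a
  closed submodule containing all words.\<close>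

lemma locally_finite_decay:
  assumes "locally_finite \<Theta>"
  shows "\<exists>r0. \<forall>r\<ge>r0. \<forall>i j. \<exists>w. app (fps_nth (ent \<Theta> i j) r) v = fps_X ^ k * w"
proof -
  define N where "N = {v. \<exists>r0. \<forall>r\<ge>r0. \<forall>i j. \<exists>w. app (fps_nth (ent \<Theta> i j) r) v = fps_X ^ k * w}"
  have add: "u + v \<in> N" if uv: "u \<in> N" "v \<in> N" for u v
  proof -
    obtain r s where rs: "\<forall>r'\<ge>r. \<forall>i j. \<exists>w. app (fps_nth (ent \<Theta> i j) r') u = fps_X ^ k * w"
      "\<forall>r'\<ge>s. \<forall>i j. \<exists>w. app (fps_nth (ent \<Theta> i j) r') v = fps_X ^ k * w"
      using uv unfolding N_def by blast
    have "\<exists>w. app (fps_nth (ent \<Theta> i j) r') (u + v) = fps_X ^ k * w" if r': "r' \<ge> max r s" for r' i j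
    proof -
      obtain w1 w2 where "app (fps_nth (ent \<Theta> i j) r') u = fps_X ^ k * w1" "app (fps_nth (ent \<Theta> i j) r') v =
          fps_X ^ k * w2"
        using rs r' by (meson max.bounded_iff)
      then show ?thesis by (intro exI[of _ "w1 + w2"]) (simp add: distrib_left)
    qed
    then show ?thesis unfolding N_def by blast
  qed
  have scal: "scal s * v \<in> N" if v: "v \<in> N" for s v
  proof -
    obtain r where r: "\<forall>r'\<ge>r. \<forall>i j. \<exists>w. app (fps_nth (ent \<Theta> i j) r') v = fps_X ^ k * w"
      using v by (auto simp: N_def)
    have "\<exists>w. app (fps_nth (ent \<Theta> i j) r') (scal s * v) = fps_X ^ k * w" if r': "r' \<ge> r" for r' i j
    proof -
      obtain w where w: "app (fps_nth (ent \<Theta> i j) r') v = fps_X ^ k * w" using r r' by blast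
      have "scal s * (fps_X ^ k * w) = fps_X ^ k * (scal s * w)"
        unfolding mult.assoc[symmetric] scal_central[of s "fps_X ^ k"] ..
      then show ?thesis using w by auto
    qed
    then show ?thesis unfolding N_def by blast
  qed
  have "closed N"
  proof (rule closed_h_adicI)
    fix v assume "\<And>k. \<exists>u\<in>N. \<exists>w. v = u + fps_X ^ k * w"
    then obtain u w where u: "u \<in> N" "v = u + fps_X ^ k * w" by blast
    have "fps_X ^ k * w \<in> N" unfolding N_def by auto
    then show "v \<in> N" using u add by simp
  qed
  moreover have "0 \<in> N" unfolding N_def by (auto intro: exI[of _ 0])
  ultimately have "closed_submodule N" using add scal by (simp add: closed_submodule_def)
  moreover have "app 1 (wd ws) \<in> N" for ws
  proof -
    obtain r0 where "\<forall>r\<ge>r0. \<forall>i j. app (fps_nth (ent \<Theta> i j) r) (wd ws) = 0"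
      using assms unfolding locally_finite_def by blast
    then have "\<forall>r\<ge>r0. \<forall>i j. \<exists>w. app (fps_nth (ent \<Theta> i j) r) (wd ws) = fps_X ^ k * w"
      by (metis mult_zero_right)
    then show ?thesis unfolding N_def by auto
  qed
  ultimately have "app 1 v \<in> N" by (rule endo_words_in)
  then show ?thesis by (simp add: N_def)
qed

lemma op_of_series:
  assumes "preserves_ideal \<Theta>" "locally_finite \<Theta>" shows "op_of \<Theta> \<in> op_series Y"
proof -
  have "op_of \<Theta> i j \<in> xinv_hom Y" for i j
    unfolding xinv_hom_def
  proof (intro CollectI conjI ballI allI)
    show "op_of \<Theta> i j \<in> carrier Y \<rightarrow>\<^sub>E xinv_series Y"
    proof (rule PiE_I)
      fix V assume "V \<in> carrier Y"
      then obtain v where V: "V = cl v" by (rule class_surj)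
      have "\<exists>r0. \<forall>r\<ge>r0. \<exists>w\<in>carrier Y. op_of \<Theta> i j V r = fps_X ^ k \<odot>\<^bsub>Y\<^esub> w" for k
      proof -
        obtain r0 where r0: "\<forall>r\<ge>r0. \<forall>i j. \<exists>w. app (fps_nth (ent \<Theta> i j) r) v = fps_X ^ k * w"
          using locally_finite_decay[OF assms(2), of v k] by blast
        have "\<exists>w\<in>carrier Y. op_of \<Theta> i j V r = fps_X ^ k \<odot>\<^bsub>Y\<^esub> w" if r: "r \<ge> r0" for r
        proof -
          obtain w where "app (fps_nth (ent \<Theta> i j) r) v = fps_X ^ k * w" using r0 r by blast
          then have "op_of \<Theta> i j V r = fps_X ^ k \<odot>\<^bsub>Y\<^esub> cl w"
            by (simp add: V op_of_class[OF assms(1)] Y_smult scal_power)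
          then show ?thesis using class_in_Y[of w] by (rule bexI)
        qed
        then show ?thesis by blast
      qed
      moreover have "op_of \<Theta> i j V r \<in> carrier Y" for r by (simp add: V op_of_class[OF assms(1)])
      ultimately show "op_of \<Theta> i j V \<in> xinv_series Y" unfolding xinv_series_def by blast
    qed (simp add: op_of_def)
  next
    fix V W r assume "V \<in> carrier Y" "W \<in> carrier Y"
    then show "op_of \<Theta> i j (V \<oplus>\<^bsub>Y\<^esub> W) r = op_of \<Theta> i j V r \<oplus>\<^bsub>Y\<^esub> op_of \<Theta> i j W r"
      by (elim class_surj) (simp add: Y_add op_of_class[OF assms(1)])
  next
    fix V s r assume "V \<in> carrier Y"
    then show "op_of \<Theta> i j (s \<odot>\<^bsub>Y\<^esub> V) r = s \<odot>\<^bsub>Y\<^esub> op_of \<Theta> i j V r"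
      by (elim class_surj) (simp add: Y_smult op_of_class[OF assms(1)])
  qed
  then show ?thesis by (simp add: op_series_def)
qed

lemma op_mult_op_of:
  assumes "preserves_ideal S" "preserves_ideal T" "S * T = 1"
  shows "op_mult Y (op_of S) (op_of T) = op_one Y"
proof (intro ext)
  fix i j V p
  show "op_mult Y (op_of S) (op_of T) i j V p = op_one Y i j V p"
  proof (cases "V \<in> carrier Y")
    case True
    then obtain v where V: "V = cl v" by (rule class_surj)
    have "op_mult Y (op_of S) (op_of T) i j V p =
        cl (\<Sum>k\<in>UNIV. \<Sum>r\<le>p. app (fps_nth (ent S i k) r) (app (fps_nth (ent T k j) (p - r)) v))"
      by (simp add: op_mult_def V op_of_class[OF assms(1)] op_of_class[OF assms(2)] Y_finsum)
    also have "(\<Sum>k\<in>UNIV. \<Sum>r\<le>p. app (fps_nth (ent S i k) r) (app (fps_nth (ent T k j) (p - r)) v)) =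
        app (fps_nth (ent (S * T) i j) p) v"
      by (simp add: ent_mult fps_sum_nth fps_mult_nth endo_sum atLeast0AtMost)
    also have "cl \<dots> = op_one Y i j V p"
      unfolding assms(3) by (simp add: op_one_def V ent_one Y_zero)
    finally show ?thesis .
  qed (simp add: op_mult_def op_one_def)
qed

end

section \<open>Descent to the quotient\<close>

definition right_mult :: "'n falg \<Rightarrow> 'n endo" where
  "right_mult z = Endo (\<lambda>a. a * z)"

lemma app_right_mult [simp]: "app (right_mult z) a = a * z"
  unfolding right_mult_def by (subst app_Endo) (simp_all add: algebra_simps)

lemma op_scal_left_mult: "range op_scal \<subseteq> range left_mult"
  by auto

text \<open>A filtration: the power of 1/x exceeds that of y by at most \<open>d\<close>. Series in
  y/x have \<open>d = 0\<close>, and \<open>d\<close> is additive under products.\<close>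

definition low_degree :: "nat \<Rightarrow> 'a::zero fps fps set" where
  "low_degree d = {f. \<forall>s p. p > s + d \<longrightarrow> fps_nth (fps_nth f s) p = 0}"

lemma low_degree_mult:
  fixes f g :: "'a::ring_1 fps fps"
  assumes "f \<in> low_degree a" "g \<in> low_degree b" shows "f * g \<in> low_degree (a + b)"
  unfolding low_degree_def
proof (intro CollectI allI impI)
  fix s p assume p: "p > s + (a + b)"
  have "fps_nth (fps_nth f i) q * fps_nth (fps_nth g (s - i)) (p - q) = 0" if "i \<le> s" "q \<le> p" for i q
  proof (cases "q > i + a")
    case False
    then have "p - q > (s - i) + b" using p that by linarith
    then show ?thesis using assms(2) by (simp add: low_degree_def)
  qed (use assms(1) in \<open>simp add: low_degree_def\<close>)
  then show "fps_nth (fps_nth (f * g) s) p = 0"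
    by (simp add: fps_mult_nth fps_sum_nth)
qed

lemma low_degree_sqm_mult:
  fixes F G :: "('a::ring_1 fps fps, 'i::finite) sqm"
  assumes "F \<in> sqm_over (low_degree a)" "G \<in> sqm_over (low_degree b)" shows "F * G \<in> sqm_over (low_degree (a + b))"
proof -
  have sum: "sum h S \<in> low_degree (a + b)" if "\<And>x. x \<in> S \<Longrightarrow> h x \<in> low_degree (a + b)" for h :: "'i \<Rightarrow> 'a fps fps" and S
    using that by (induction S rule: infinite_finite_induct) (simp_all add: low_degree_def)
  show ?thesis
    unfolding sqm_over_def
  proof (intro CollectI allI)
    fix i j
    show "ent (F * G) i j \<in> low_degree (a + b)"
      unfolding ent_mult by (rule sum, rule low_degree_mult) (use assms in \<open>auto simp: sqm_over_def\<close>)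
  qed
qed

lemma sub_xy_op_mult_nth:
  fixes f :: "'n endo fps fps"
  shows "fps_nth (fps_nth (sub_xy op_scal u g * f) s) p =
      (\<Sum>m\<le>min s p. op_scal (u ^ m * fps_nth g m) * fps_nth (fps_nth f (s - m)) (p - m))" (is ?left)
    and "fps_nth (fps_nth (f * sub_xy op_scal u g) s) p =
      (\<Sum>m\<le>min s p. fps_nth (fps_nth f (s - m)) (p - m) * op_scal (u ^ m * fps_nth g m))"
proof -
  have "fps_nth (fps_nth (sub_xy op_scal u g * f) s) p =
      (\<Sum>m\<le>s. \<Sum>q\<le>p. if q = m then op_scal (u ^ m * fps_nth g m) * fps_nth (fps_nth f (s - m)) (p - m) else 0)"
    by (simp add: fps_mult_nth fps_sum_nth sub_xy_nth[OF unital_hom_op_scal] atLeast0AtMost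
        if_distrib[of "\<lambda>x. x * _"] cong: if_cong)
  also have "\<dots> = (\<Sum>m\<le>s. if m \<le> p then op_scal (u ^ m * fps_nth g m) * fps_nth (fps_nth f (s - m)) (p - m) else 0)"
    by simp
  also have "\<dots> = (\<Sum>m\<le>min s p. op_scal (u ^ m * fps_nth g m) * fps_nth (fps_nth f (s - m)) (p - m))"
    by (rule sum.mono_neutral_cong_right) auto
  finally show ?left .
  moreover have "sub_xy op_scal u g \<in> (center :: 'n endo fps fps set)"
    using fps_over_subset_center[OF fps_over_subset_center[OF op_scal_central]] sub_xy_in[OF unital_hom_op_scal]
        by blast
  ultimately show "fps_nth (fps_nth (f * sub_xy op_scal u g) s) p =
      (\<Sum>m\<le>min s p. fps_nth (fps_nth f (s - m)) (p - m) * op_scal (u ^ m * fps_nth g m))"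
    using center_commute[of "sub_xy op_scal u g" f] by (simp add: left_mult_scal_central)
qed

context exchange
begin

text \<open>The induction step for prepending a letter: by the exchange rule, T^- after
  multiplication by a letter is a combination of letters times coefficients of T^- times
  scalars.\<close>

lemma Tm_left_in:
  assumes I: "bimod (range left_mult) I (range op_scal)" and T: "Tm \<in> sqm_over (fps_over I)"
  shows "fps_nth (ent Tm i j) p * left_mult (tplus k l (int s)) \<in> I"
proof -
  let ?I = "sqm_over (fps_over (fps_over I)) :: ('n endo fps fps, 'n \<times> 'n) sqm set"
  note bm = bimod_sqm_over[where 'i = "'n \<times> 'n", OF bimod_fps_over[OF bimod_fps_over[OF I]]]
  have z: "0 \<in> I" by (rule bimod_zero[OF I])
  have z': "0 \<in> range (left_mult :: _ \<Rightarrow> 'n endo)" by (rule range_eqI[of _ _ 0]) simp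
  have A: "sub_xy op_scal u f \<in> fps_over (fps_over (range (op_scal :: _ \<Rightarrow> 'n endo)))" for u f
    by (intro sub_xy_in unital_hom_op_scal)
  have "Qp \<in> sqm_over (fps_over (fps_over (range left_mult)))"
    using A fps_over_mono[OF fps_over_mono[OF op_scal_left_mult]] unfolding sqm_over_def by auto
  moreover have "leg1 (gen_series left_mult) \<in> sqm_over (fps_over (fps_over (range (left_mult :: _ \<Rightarrow> 'n endo))))"
    by (rule sqm_over_emb) (use z' in \<open>auto simp: sqm_over_def fps_over_def gen_series_def\<close>)
  moreover have "leg2 (sqm_map fps_const Tm) \<in> ?I"
    by (rule sqm_over_emb) (use z T in \<open>auto simp: sqm_over_def fps_over_def\<close>)
  moreover have "Qim \<in> sqm_over (fps_over (fps_over (range op_scal)))"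
    using A by (auto simp: sqm_over_def)
  ultimately have "(Qp * (leg1 (gen_series left_mult) * leg2 (sqm_map fps_const Tm))) * Qim \<in> ?I"
    by (intro bimod_right[OF bm] bimod_left[OF bm])
  then have "leg2 (sqm_map fps_const Tm) * leg1 (gen_series left_mult) \<in> ?I"
    unfolding Tm_exchange_conj by (simp only: mult.assoc)
  then have "ent (leg2 (sqm_map fps_const Tm) * leg1 (gen_series left_mult)) (k, i) (l, j) \<in> fps_over (fps_over I)"
    unfolding sqm_over_def by blast
  then have "fps_const (ent Tm i j) * ent (gen_series left_mult) k l \<in> fps_over (fps_over I)"
    unfolding ent_mult_leg by simp
  then show ?thesis
    by (simp add: fps_over_def gen_series_def fps_mult_left_const_nth fps_mult_right_const_nth)
qed

text \<open>J lies in \<open>K\<close> by minimality. Stability of \<open>K\<close> on the right is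
  built into the quantifier over \<open>u\<close>, on the left it follows by induction on words,
  closedness and saturation are inherited from J, and the relators belong to \<open>K\<close> by
  \<open>Tm_relator\<close>.\<close>

lemma Tm_preserves_ideal:
  assumes yb: "yang_baxter (sqm_of B) Q"
  shows "preserves_ideal B Tm"
proof -
  let ?J = "rtt_ideal B"
  let ?\<phi> = "\<lambda>i j p. app (fps_nth (ent Tm i j) p)"
  have left: "?\<phi> i j p (a * z) \<in> ?J" if z: "\<And>i j p. ?\<phi> i j p z \<in> ?J" for a z i j p
  proof -
    have "?\<phi> i j p (wd ws * z) \<in> ?J" for ws i j p
    proof (induction ws arbitrary: i j p)
      case Nil
      then show ?case using z by simp
    next
      case (Cons w ws)
      let ?I = "{e. app e (wd ws * z) \<in> ?J}"
      have "bimod (range left_mult) ?I (range op_scal)"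
        by (auto simp: bimod_def rtt_ideal_zero rtt_ideal_add rtt_ideal_left)
      moreover have "Tm \<in> sqm_over (fps_over ?I)" using Cons by (simp add: sqm_over_def fps_over_def)
      ultimately have "fps_nth (ent Tm i j) p * left_mult (tplus (fst w) (fst (snd w)) (int (snd (snd w)))) \<in> ?I"
        by (rule Tm_left_in)
      then show ?case by (simp add: tplus_wd wd_Cons[of w ws] mult.assoc)
    qed
    then have "app (fps_nth (ent Tm i j) p * right_mult z) a \<in> ?J"
      by - (rule endo_words_in[OF rtt_ideal_closed_submodule], simp)
    then show ?thesis by simp
  qed
  define K where "K = {v. \<forall>u i j p. ?\<phi> i j p (v * u) \<in> ?J}"
  have "?J \<subseteq> K"
  proof (rule rtt_ideal_least)
    show "ideal K ring_of_type_algebra"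
      unfolding ideal_type_iff K_def
      by (auto simp: rtt_ideal_zero distrib_right rtt_ideal_add mult.assoc intro: left)
    show "closed K"
    proof (rule closed_h_adicI)
      fix v assume v: "\<And>k. \<exists>u\<in>K. \<exists>w. v = u + fps_X ^ k * w"
      have "?\<phi> i j p (v * u) \<in> ?J" for u i j p
      proof (rule closed_h_adic[OF rtt_ideal_closed])
        fix k
        obtain v' w where v': "v' \<in> K" "v = v' + fps_X ^ k * w" using v by blast
        have "?\<phi> i j p (v * u) = ?\<phi> i j p (v' * u) + fps_X ^ k * ?\<phi> i j p (w * u)"
          by (simp add: v'(2) distrib_right mult.assoc)
        then show "\<exists>x\<in>?J. \<exists>y. ?\<phi> i j p (v * u) = x + fps_X ^ k * y"
          using v'(1) unfolding K_def by blast
      qed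
      then show "v \<in> K" by (simp add: K_def)
    qed
    show "a \<in> K" if "fps_X * a \<in> K" for a
    proof -
      have "?\<phi> i j p (fps_X * a * u) = fps_X * ?\<phi> i j p (a * u)" for u i j p
        using app_h_power[of _ 1 "a * u"] by (simp add: mult.assoc)
      then have "fps_X * ?\<phi> i j p (a * u) \<in> ?J" for u i j p
        using that unfolding K_def by (metis (mono_tags, lifting) mem_Collect_eq)
      then show ?thesis by (auto simp: K_def intro: rtt_ideal_saturated)
    qed
    fix i' k' j' l' p q
    show "rtt_relator B i' k' j' l' p q \<in> K"
    \<comment> \<open>For q < -p each term contains a negative power of y and the relator is 0;
      otherwise q + p is a natural number, as \<open>Tm_relator\<close> needs.\<close>
    proof (cases "q < - int p")
      case True
      then have "rtt_relator B i' k' j' l' p q = 0"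
        by (simp add: rtt_relator_def tplus_neg)
      then show ?thesis by (simp add: K_def rtt_ideal_zero)
    next
      case False
      let ?I = "{e. \<forall>v. app e v \<in> ?J}"
      have I: "bimod (range op_scal) ?I UNIV"
        by (auto simp: bimod_def rtt_ideal_zero rtt_ideal_add rtt_ideal_left)
      have "fps_nth (ent Tm i j) c * left_mult (rtt_relator B i' k' j' l' p (int (nat (q + int p)) - int p)) \<in>
          ?I" for i j c
        by (rule Tm_relator[OF yb[unfolded sqm_of_def] I]) (simp add: rtt_ideal_right rtt_relator_in)
      then show ?thesis using False by (simp add: K_def)
    qed
  qed
  then have "?\<phi> i j p (v * 1) \<in> ?J" if "v \<in> ?J" for v i j p
    using that unfolding K_def by blast
  then show ?thesis by (simp add: preserves_ideal_def)
qed

text \<open>The R-matrices contain 1/x only through y/x and the letters not at all, so extracting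
  y^s for a letter of exponent s raises the degree in 1/x by at most s.\<close>

lemma word_series_degree:
  "sum_list (map (\<lambda>w. snd (snd w)) ws) < p \<Longrightarrow> fps_nth (ent (word_series ws) i j) p = 0"
proof (induction ws arbitrary: i j p)
  case Nil
  then show ?case by (simp add: ent_one)
next
  case (Cons w ws)
  let ?d = "sum_list (map (\<lambda>w. snd (snd w)) ws)"
  have Q: "sqm_map (sub_xy scal u) A \<in> sqm_over (low_degree 0 :: 'n falg fps fps set)" for u and A :: "(complex
      fps fps, 'n \<times> 'n) sqm"
    by (auto simp: sqm_over_def low_degree_def sub_xy_nth[OF unital_hom_scal])
  have g: "leg1 (gen_series (\<lambda>t. t)) \<in> sqm_over (low_degree 0 :: 'n falg fps fps set)"
    by (rule sqm_over_emb) (auto simp: sqm_over_def low_degree_def gen_series_def)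
  have v: "leg2 (sqm_map fps_const (word_series ws)) \<in> sqm_over (low_degree ?d)"
    by (rule sqm_over_emb) (use Cons.IH in \<open>auto simp: sqm_over_def low_degree_def\<close>)
  have "sqm_map (sub_xy scal up) Q * leg1 (gen_series (\<lambda>t. t)) * leg2 (sqm_map fps_const (word_series ws)) *
      sqm_map (sub_xy scal um) Qi \<in> sqm_over (low_degree ?d)"
    using low_degree_sqm_mult[OF low_degree_sqm_mult[OF low_degree_sqm_mult[OF Q g] v] Q] by simp
  then show ?case using Cons.prems by (simp add: sqm_over_def low_degree_def)
qed

lemma Tm_locally_finite: "locally_finite Tm"
  unfolding locally_finite_def
proof
  fix ws :: "('n \<times> 'n \<times> nat) list"
  show "\<exists>r0. \<forall>r\<ge>r0. \<forall>i j. app (fps_nth (ent Tm i j) r) (wd ws) = 0"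
    by (rule exI[of _ "Suc (sum_list (map (\<lambda>w. snd (snd w)) ws))"]) (simp add: app_Tm_wd word_series_degree)
qed

text \<open>The recursion for words in coefficients, now with an arbitrary element of F in place of
  the tail.\<close>

lemma app_Tm_tplus:
  "app (fps_nth (ent Tm i j) p) (tplus k l (int s) * v) =
   (\<Sum>x\<in>UNIV. \<Sum>y\<in>UNIV. \<Sum>m\<le>min s p. scal (up ^ m * fps_nth (ent Q (k, i) (x, y)) m) *
     (\<Sum>x'\<in>UNIV. \<Sum>y'\<in>UNIV. \<Sum>m'\<le>min (s - m) (p - m).
       tplus x x' (int (s - m - m')) * app (fps_nth (ent Tm y y') (p - m - m')) v *
       scal (um ^ m' * fps_nth (ent Qi (x', y') (l, j)) m')))"
proof -
  have "leg2 (sqm_map fps_const Tm) * leg1 (gen_series left_mult) =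
      Qp * ((leg1 (gen_series left_mult) * leg2 (sqm_map fps_const Tm)) * Qim)"
    unfolding Tm_exchange_conj by (simp only: mult.assoc)
  then have "fps_nth (fps_nth (ent (leg2 (sqm_map fps_const Tm) * leg1 (gen_series left_mult)) (k, i) (l, j)) s) p =
      fps_nth (fps_nth (ent (Qp * ((leg1 (gen_series left_mult) * leg2 (sqm_map fps_const Tm)) * Qim)) (k, i)
          (l, j)) s) p"
    by simp
  then have eq: "fps_nth (ent Tm i j) p * left_mult (tplus k l (int s)) =
    (\<Sum>x\<in>UNIV. \<Sum>y\<in>UNIV. \<Sum>m\<le>min s p. op_scal (up ^ m * fps_nth (ent Q (k, i) (x, y)) m) *
     (\<Sum>x'\<in>UNIV. \<Sum>y'\<in>UNIV. \<Sum>m'\<le>min (s - m) (p - m).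
       left_mult (tplus x x' (int (s - m - m'))) * fps_nth (ent Tm y y') (p - m - m') *
       op_scal (um ^ m' * fps_nth (ent Qi (x', y') (l, j)) m')))"
    unfolding ent_mult[of Qp] ent_mult[of _ Qim] ent_mult_leg
    by (simp add: sum_UNIV_pair fps_sum_nth sub_xy_op_mult_nth gen_series_def fps_mult_left_const_nth
        fps_mult_right_const_nth)
  have "a * (scal c * b) = a * b * scal c" for a b :: "'n falg" and c
    by (simp add: mult.assoc scal_central[of c b])
  then show ?thesis
    using arg_cong[OF eq, of "\<lambda>e. app e v"] by (simp add: endo_sum flip: scal_central)
qed

lemma Tm_Tplus_coeff:
  "(\<Sum>x\<in>UNIV. \<Sum>y\<in>UNIV. \<Sum>m\<le>min s p. fps_nth (ent Tm i y) (p - m) * left_mult (tplus k x (int (s - m))) *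
      op_scal (um ^ m * fps_nth (ent Q (x, y) (l, j)) m)) =
   (\<Sum>x\<in>UNIV. \<Sum>y\<in>UNIV. \<Sum>m\<le>min s p. op_scal (up ^ m * fps_nth (ent Q (k, i) (x, y)) m) *
      (left_mult (tplus x l (int (s - m))) * fps_nth (ent Tm y j) (p - m)))"
proof -
  have "leg2 (sqm_map fps_const Tm) * leg1 (gen_series left_mult) * Qm =
      Qp * (leg1 (gen_series left_mult) * leg2 (sqm_map fps_const Tm))"
    unfolding Tm_exchange by (simp only: mult.assoc)
  then have "fps_nth (fps_nth (ent (leg2 (sqm_map fps_const Tm) * leg1 (gen_series left_mult) * Qm) (k, i) (l,
      j)) s) p =
      fps_nth (fps_nth (ent (Qp * (leg1 (gen_series left_mult) * leg2 (sqm_map fps_const Tm))) (k, i) (l, j)) s) p"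
    by simp
  then show ?thesis
    unfolding ent_mult[of Qp] ent_mult[of _ Qm] ent_mult_leg
    by (simp add: sum_UNIV_pair fps_sum_nth sub_xy_op_mult_nth gen_series_def fps_mult_left_const_nth
        fps_mult_right_const_nth)
qed

definition coeff_int :: "'n \<Rightarrow> 'n \<Rightarrow> int \<Rightarrow> 'n endo" where
  "coeff_int i j r = (if r \<ge> 0 then fps_nth (ent Tm i j) (nat r) else 0)"

lemma Tm_RTT_coeff:
  assumes "yang_baxter Q Q"
  shows "(\<Sum>x\<in>UNIV. \<Sum>y\<in>UNIV. \<Sum>m\<le>q. op_scal (fps_nth (ent Q (i, k) (x, y)) m) *
      (coeff_int x j (int m - p) * coeff_int y l (int q - int m))) =
    (\<Sum>x\<in>UNIV. \<Sum>y\<in>UNIV. \<Sum>m\<le>q. coeff_int k y (int q - int m) * coeff_int i x (int m - p) *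
      op_scal (fps_nth (ent Q (x, y) (j, l)) m))"
\<comment> \<open>For p > q all indices \<open>int m - p\<close> are negative, so both sides are
  0.\<close>
proof (cases "p \<le> int q")
  case False
  then show ?thesis by (simp add: coeff_int_def)
next
  case True
  \<comment> \<open>With 1/x = z and 1/y = u z, the monomial x^p y^(-q) is u^q z^(q-p).\<close>
  define r where "r = nat (int q - p)"
  have idx: "coeff_int x j (int m - p) = (if q - m \<le> r then fps_nth (ent Tm x j) (r - (q - m)) else 0)"
    "coeff_int x j (int q - int m) = fps_nth (ent Tm x j) (q - m)" if "m \<le> q" for x j m
  proof -
    have "q - m \<le> r \<longleftrightarrow> p \<le> int m" "q - m \<le> r \<Longrightarrow> nat (int m - p) = r - (q - m)"
      using that True unfolding r_def by linarith+
    then show "coeff_int x j (int m - p) = (if q - m \<le> r then fps_nth (ent Tm x j) (r - (q - m)) else 0)"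
      by (simp add: coeff_int_def)
    show "coeff_int x j (int q - int m) = fps_nth (ent Tm x j) (q - m)"
      using that by (simp add: coeff_int_def nat_diff_distrib)
  qed
  have CS: "fps_nth (fps_nth (fps_const f * sub_scale g) s) r = (if s \<le> r then fps_nth f (r - s) * fps_nth g s
      else 0)"
    for f g :: "'n endo fps" and s
  proof -
    have "fps_nth (fps_nth (fps_const f * sub_scale g) s) r = (\<Sum>t=0..r. fps_nth f t * fps_nth (fps_nth
        (sub_scale g) s) (r - t))"
      unfolding fps_mult_left_const_nth by (simp add: fps_mult_nth)
    also have "\<dots> = (\<Sum>t=0..r. fps_nth f (r - t) * fps_nth (fps_nth (sub_scale g) s) t)"
      by (rule sum.reindex_bij_witness[of _ "\<lambda>t. r - t" "\<lambda>t. r - t"]) auto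
    finally show ?thesis by (simp add: sub_scale_nth if_distrib[of "\<lambda>x. _ * x"] cong: if_cong)
  qed
  have SC: "fps_nth (fps_nth (sub_scale g * fps_const f) s) r = (if s \<le> r then fps_nth g s * fps_nth f (r - s)
      else 0)"
    for f g :: "'n endo fps" and s
  proof -
    have "fps_nth (fps_nth (sub_scale g * fps_const f) s) r = (\<Sum>t=0..r. fps_nth (fps_nth (sub_scale g) s) t *
        fps_nth f (r - t))"
      unfolding fps_mult_right_const_nth by (simp add: fps_mult_nth)
    then show ?thesis by (simp add: sub_scale_nth if_distrib[of "\<lambda>x. x * _"] cong: if_cong)
  qed
  have L: "fps_nth (fps_nth (scal_series h * f) q) r = (\<Sum>m\<le>q. op_scal (fps_nth h m) * fps_nth (fps_nth f (q -
      m)) r)" for h and f :: "'n endo fps fps"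
    unfolding fps_mult_nth[of "scal_series h"] by (simp add: fps_sum_nth scal_series_nth atLeast0AtMost)
  have R: "fps_nth (fps_nth (f * scal_series h) q) r = (\<Sum>m\<le>q. fps_nth (fps_nth f (q - m)) r * op_scal (fps_nth h
      m))" for h and f :: "'n endo fps fps"
  proof -
    have "fps_nth (fps_nth (f * scal_series h) q) r = (\<Sum>m\<le>q. fps_nth (fps_nth f m) r * op_scal (fps_nth h (q - m)))"
      unfolding fps_mult_nth[of f] by (simp add: fps_sum_nth scal_series_nth atLeast0AtMost)
    also have "\<dots> = (\<Sum>m\<le>q. fps_nth (fps_nth f (q - m)) r * op_scal (fps_nth h m))"
      by (rule sum.reindex_bij_witness[of _ "\<lambda>t. q - t" "\<lambda>t. q - t"]) auto
    finally show ?thesis .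
  qed
  have "fps_nth (fps_nth (ent (sqm_map scal_series Q * (leg1 (sqm_map fps_const Tm) * leg2 (sqm_map sub_scale
      Tm))) (i, k) (j, l)) q) r =
      fps_nth (fps_nth (ent (leg2 (sqm_map sub_scale Tm) * leg1 (sqm_map fps_const Tm) * sqm_map scal_series Q)
          (i, k) (j, l)) q) r"
    using Tm_RTT[OF assms] by (simp only: mult.assoc)
  then have eq0: "(\<Sum>x\<in>UNIV. \<Sum>y\<in>UNIV. \<Sum>m\<le>q. op_scal (fps_nth (ent Q (i, k) (x, y)) m) *
      fps_nth (fps_nth (fps_const (ent Tm x j) * sub_scale (ent Tm y l)) (q - m)) r) =
    (\<Sum>x\<in>UNIV. \<Sum>y\<in>UNIV. \<Sum>m\<le>q. fps_nth (fps_nth (sub_scale (ent Tm k y) * fps_const (ent Tm i x)) (q - m)) r *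
      op_scal (fps_nth (ent Q (x, y) (j, l)) m))" (is "?A = ?B")
    unfolding ent_mult[of "sqm_map scal_series Q"] ent_mult[of _ "sqm_map scal_series Q"] ent_mult_leg
    by (simp only: sum_UNIV_pair fps_sum_nth ent_sqm_map fst_conv snd_conv L R)
  have 1: "op_scal c * (coeff_int x j (int m - p) * coeff_int y l (int q - int m)) =
      op_scal c * fps_nth (fps_nth (fps_const (ent Tm x j) * sub_scale (ent Tm y l)) (q - m)) r" if "m \<in> {..q}"
          for c x y m
    unfolding CS using that by (simp add: idx)
  have 2: "fps_nth (fps_nth (sub_scale (ent Tm k y) * fps_const (ent Tm i x)) (q - m)) r * op_scal c =
      coeff_int k y (int q - int m) * coeff_int i x (int m - p) * op_scal c" if "m \<in> {..q}" for c x y m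
    unfolding SC using that by (simp add: idx)
  have "(\<Sum>x\<in>UNIV. \<Sum>y\<in>UNIV. \<Sum>m\<le>q. op_scal (fps_nth (ent Q (i, k) (x, y)) m) *
      (coeff_int x j (int m - p) * coeff_int y l (int q - int m))) = ?A"
    by (intro sum.cong refl 1)
  also note eq0
  also have "?B = (\<Sum>x\<in>UNIV. \<Sum>y\<in>UNIV. \<Sum>m\<le>q. coeff_int k y (int q - int m) * coeff_int i x (int m - p) *
      op_scal (fps_nth (ent Q (x, y) (j, l)) m))"
    by (intro sum.cong refl 2)
  finally show ?thesis .
qed

end

section \<open>Series on several tensor factors\<close>

lemma mser_mult_assoc:
  fixes A B C :: "'n::finite mser"
  shows "mser_mult n (mser_mult n A B) C = mser_mult n A (mser_mult n B C)"
proof (intro ext)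
  fix \<alpha> \<beta> :: "'n list" and e
  let ?L = "{\<gamma> :: 'n list. length \<gamma> = Suc n}"
  let ?S = "\<lambda>e. {(d, d'). d + d' = (e :: nat \<Rightarrow>\<^sub>0 nat)}"
  have split: "(\<Sum>(d, d')\<in>?S e. \<Sum>(f, f')\<in>?S d. g f f' d') = (\<Sum>(f, d)\<in>?S e. \<Sum>(f', d')\<in>?S d. g f f' d')"
    for g :: "_ \<Rightarrow> _ \<Rightarrow> _ \<Rightarrow> 'n falg"
  proof -
    have "(\<Sum>(d, d')\<in>?S e. \<Sum>(f, f')\<in>?S d. g f f' d') =
        (\<Sum>(x, y)\<in>Sigma (?S e) (\<lambda>x. ?S (fst x)). g (fst y) (snd y) (snd x))"
      by (subst sum.Sigma[symmetric]) (auto simp: finite_exponent_splittings case_prod_beta)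
    also have "\<dots> = (\<Sum>(x, y)\<in>Sigma (?S e) (\<lambda>x. ?S (snd x)). g (fst x) (fst y) (snd y))"
      by (rule sum.reindex_bij_witness[of _ "\<lambda>(x, y). ((fst x + fst y, snd y), (fst x, fst y))"
            "\<lambda>(x, y). ((fst y, snd y + snd x), (snd y, snd x))"]) (auto simp: add.assoc)
    also have "\<dots> = (\<Sum>(f, d)\<in>?S e. \<Sum>(f', d')\<in>?S d. g f f' d')"
      by (subst sum.Sigma[symmetric]) (auto simp: finite_exponent_splittings case_prod_beta)
    finally show ?thesis .
  qed
  have "mser_mult n (mser_mult n A B) C \<alpha> \<beta> e =
      (\<Sum>\<gamma>\<in>?L. \<Sum>(d, d')\<in>?S e. \<Sum>\<delta>\<in>?L. \<Sum>(f, f')\<in>?S d. A \<alpha> \<delta> f * B \<delta> \<gamma> f' * C \<gamma> \<beta> d')"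
    unfolding mser_mult_def by (simp add: sum_distrib_right case_prod_beta)
  also have "\<dots> = (\<Sum>\<gamma>\<in>?L. \<Sum>\<delta>\<in>?L. \<Sum>(d, d')\<in>?S e. \<Sum>(f, f')\<in>?S d. A \<alpha> \<delta> f * B \<delta> \<gamma> f' * C \<gamma> \<beta> d')"
    unfolding case_prod_beta by (intro sum.cong refl sum.swap)
  also have "\<dots> = (\<Sum>\<gamma>\<in>?L. \<Sum>\<delta>\<in>?L. \<Sum>(f, d)\<in>?S e. \<Sum>(f', d')\<in>?S d. A \<alpha> \<delta> f * B \<delta> \<gamma> f' * C \<gamma> \<beta> d')"
    unfolding split ..
  also have "\<dots> = (\<Sum>\<delta>\<in>?L. \<Sum>\<gamma>\<in>?L. \<Sum>(f, d)\<in>?S e. \<Sum>(f', d')\<in>?S d. A \<alpha> \<delta> f * B \<delta> \<gamma> f' * C \<gamma> \<beta> d')"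
    by (rule sum.swap)
  also have "\<dots> = (\<Sum>\<delta>\<in>?L. \<Sum>(f, d)\<in>?S e. \<Sum>\<gamma>\<in>?L. \<Sum>(f', d')\<in>?S d. A \<alpha> \<delta> f * B \<delta> \<gamma> f' * C \<gamma> \<beta> d')"
    unfolding case_prod_beta by (intro sum.cong refl sum.swap)
  also have "\<dots> = mser_mult n A (mser_mult n B C) \<alpha> \<beta> e"
    unfolding mser_mult_def by (simp add: sum_distrib_left case_prod_beta mult.assoc)
  finally show "mser_mult n (mser_mult n A B) C \<alpha> \<beta> e = mser_mult n A (mser_mult n B C) \<alpha> \<beta> e" .
qed

lemma finite_lists_length: "finite {\<gamma> :: 'n::finite list. length \<gamma> = m}"
  using finite_lists_length_eq[of "UNIV :: 'n set" m] by simp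

text \<open>\<open>mser_one\<close> accepts indices of any length, whereas the product sums over
  length n + 1 only; hence the condition on \<open>\<beta>\<close>.\<close>

lemma mser_mult_one:
  fixes A :: "'n::finite mser"
  assumes "length \<beta> = Suc n" shows "mser_mult n A mser_one \<alpha> \<beta> e = A \<alpha> \<beta> e"
proof -
  have "(\<Sum>(d, d') | d + d' = e. A \<alpha> \<gamma> d * mser_one \<gamma> \<beta> d') = (if \<gamma> = \<beta> then A \<alpha> \<gamma> e else 0)" for \<gamma>
  proof -
    have "(\<Sum>(d, d') | d + d' = e. A \<alpha> \<gamma> d * mser_one \<gamma> \<beta> d') = (\<Sum>(d, d')\<in>{(e, 0)}. A \<alpha> \<gamma> d * mser_one \<gamma> \<beta> d')"
      by (rule sum.mono_neutral_right[OF finite_exponent_splittings]) (auto simp: mser_one_def split: if_splits)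
    then show ?thesis by (simp add: mser_one_def)
  qed
  then show ?thesis using assms by (simp add: mser_mult_def finite_lists_length)
qed

abbreviation diag_exp :: "nat \<Rightarrow> nat \<Rightarrow> nat \<Rightarrow>\<^sub>0 nat" where
  "diag_exp k m \<equiv> Poly_Mapping.single 0 m + Poly_Mapping.single k m"

lemma lookup_minus_nat: "Poly_Mapping.lookup (e - d) i = Poly_Mapping.lookup e i - Poly_Mapping.lookup (d :: nat
    \<Rightarrow>\<^sub>0 nat) i"
  by (simp add: minus_poly_mapping.rep_eq)

lemma diag_exp_add_minus:
  assumes "k \<noteq> 0" "m \<le> min (Poly_Mapping.lookup e k) (Poly_Mapping.lookup e 0)"
  shows "diag_exp k m + (e - diag_exp k m) = e"
  by (rule poly_mapping_eqI) (use assms in \<open>auto simp: lookup_add lookup_minus_nat lookup_single when_def\<close>)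

text \<open>A series in y_k/x has exponents x^(-m) y_k^m only, so as a factor it reduces the sum
  over all splittings of an exponent to a sum over m.\<close>

lemma sum_splittings_diag:
  fixes f :: "(nat \<Rightarrow>\<^sub>0 nat) \<Rightarrow> (nat \<Rightarrow>\<^sub>0 nat) \<Rightarrow> 'a::comm_monoid_add"
  assumes k: "k \<noteq> 0"
  shows "(\<And>d d'. d \<noteq> diag_exp k (Poly_Mapping.lookup d 0) \<Longrightarrow> f d d' = 0) \<Longrightarrow>
      (\<Sum>(d, d') | d + d' = e. f d d') =
      (\<Sum>m\<le>min (Poly_Mapping.lookup e k) (Poly_Mapping.lookup e 0). f (diag_exp k m) (e - diag_exp k m))"
    and "(\<And>d d'. d' \<noteq> diag_exp k (Poly_Mapping.lookup d' 0) \<Longrightarrow> f d d' = 0) \<Longrightarrow>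
      (\<Sum>(d, d') | d + d' = e. f d d') =
      (\<Sum>m\<le>min (Poly_Mapping.lookup e k) (Poly_Mapping.lookup e 0). f (e - diag_exp k m) (diag_exp k m))"
proof -
  have left: "(\<Sum>(d, d') | d + d' = e. g d d') =
      (\<Sum>m\<le>min (Poly_Mapping.lookup e k) (Poly_Mapping.lookup e 0). g (diag_exp k m) (e - diag_exp k m))"
    if z: "\<And>d d'. d \<noteq> diag_exp k (Poly_Mapping.lookup d 0) \<Longrightarrow> g d d' = 0" for g :: "(nat \<Rightarrow>\<^sub>0 nat) \<Rightarrow> (nat \<Rightarrow>\<^sub>0 nat) \<Rightarrow> 'a"
  proof -
    let ?M = "{..min (Poly_Mapping.lookup e k) (Poly_Mapping.lookup e 0)}"
    let ?h = "\<lambda>m. (diag_exp k m, e - diag_exp k m)"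
    have "(\<Sum>(d, d') | d + d' = e. g d d') = (\<Sum>(d, d')\<in>?h ` ?M. g d d')"
    proof (rule sum.mono_neutral_right[OF finite_exponent_splittings])
      show "?h ` ?M \<subseteq> {(d, d'). d + d' = e}" using diag_exp_add_minus[OF k] by auto
      show "\<forall>x\<in>{(d, d'). d + d' = e} - ?h ` ?M. (case x of (d, d') \<Rightarrow> g d d') = 0"
      proof (rule ballI)
        fix x assume x: "x \<in> {(d, d'). d + d' = e} - ?h ` ?M"
        obtain d d' where dd: "x = (d, d')" by (cases x)
        then have e: "d + d' = e" using x by simp
        show "(case x of (d, d') \<Rightarrow> g d d') = 0"
        proof (cases "d = diag_exp k (Poly_Mapping.lookup d 0)")
          case True
          define m where "m = Poly_Mapping.lookup d 0"
          have d: "d = diag_exp k m" using True by (simp add: m_def)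
          then have "d' = e - diag_exp k m" using e by (metis add_diff_cancel_left')
          moreover have "Poly_Mapping.lookup d k = m"
            unfolding d using k by (simp add: lookup_add lookup_single when_def)
          then have "m \<in> ?M" using e by (auto simp: m_def lookup_add)
          ultimately have "x \<in> ?h ` ?M" using dd d by blast
          then show ?thesis using x by blast
        qed (simp add: dd z)
      qed
    qed
    also have "\<dots> = (\<Sum>m\<in>?M. g (diag_exp k m) (e - diag_exp k m))"
    proof (subst sum.reindex)
      show "inj_on ?h ?M"
      proof (rule inj_onI)
        fix m m' assume "?h m = ?h m'"
        then have "Poly_Mapping.lookup (diag_exp k m) 0 = Poly_Mapping.lookup (diag_exp k m') 0" by simp
        then show "m = m'" using k by (simp add: lookup_add lookup_single)
      qed
    qed simp
    finally show ?thesis .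
  qed
  show "(\<Sum>(d, d') | d + d' = e. f d d') =
      (\<Sum>m\<le>min (Poly_Mapping.lookup e k) (Poly_Mapping.lookup e 0). f (diag_exp k m) (e - diag_exp k m))"
    if "\<And>d d'. d \<noteq> diag_exp k (Poly_Mapping.lookup d 0) \<Longrightarrow> f d d' = 0" using that by (rule left)
  assume z: "\<And>d d'. d' \<noteq> diag_exp k (Poly_Mapping.lookup d' 0) \<Longrightarrow> f d d' = 0"
  have "(\<Sum>(d, d') | d + d' = e. f d d') = (\<Sum>(d, d') | d + d' = e. f d' d)"
    by (rule sum.reindex_bij_witness[of _ prod.swap prod.swap]) (auto simp: add.commute)
  also have "\<dots> = (\<Sum>m\<le>min (Poly_Mapping.lookup e k) (Poly_Mapping.lookup e 0). f (e - diag_exp k m) (diag_exp k m))"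
    using z by (rule left[of "\<lambda>d d'. f d' d"])
  finally show "(\<Sum>(d, d') | d + d' = e. f d d') =
      (\<Sum>m\<le>min (Poly_Mapping.lookup e k) (Poly_Mapping.lookup e 0). f (e - diag_exp k m) (diag_exp k m))" .
qed

text \<open>\<open>x\<close> is the new index in factor k and \<open>y\<close> the one in factor 0,
  the only indices that a matrix on these two factors can change.\<close>

definition leg_upd :: "nat \<Rightarrow> nat \<Rightarrow> 'n list \<Rightarrow> 'n \<Rightarrow> 'n \<Rightarrow> 'n list" where
  "leg_upd n k \<alpha> x y = map (\<lambda>i. if i = 0 then y else if i = k then x else \<alpha> ! i) [0..<Suc n]"

lemma length_leg_upd [simp]: "length (leg_upd n k \<alpha> x y) = Suc n"
  by (simp add: leg_upd_def)

lemma leg_upd_nth: "i \<le> n \<Longrightarrow> leg_upd n k \<alpha> x y ! i = (if i = 0 then y else if i = k then x else \<alpha> ! i)"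
  unfolding leg_upd_def by (subst nth_map) (auto simp del: upt_Suc)

lemma sum_lists_leg:
  fixes F :: "'n::finite list \<Rightarrow> 'a::comm_monoid_add"
  assumes "1 \<le> k" "k \<le> n"
  shows "(\<Sum>\<gamma> | length \<gamma> = Suc n. if \<forall>i\<le>n. i \<noteq> 0 \<and> i \<noteq> k \<longrightarrow> \<alpha> ! i = \<gamma> ! i then F \<gamma> else 0) =
    (\<Sum>x\<in>UNIV. \<Sum>y\<in>UNIV. F (leg_upd n k \<alpha> x y))"
proof -
  let ?P = "\<lambda>\<gamma>. \<forall>i\<le>n. i \<noteq> 0 \<and> i \<noteq> k \<longrightarrow> \<alpha> ! i = \<gamma> ! i"
  have "(\<Sum>\<gamma> | length \<gamma> = Suc n. if ?P \<gamma> then F \<gamma> else 0) = (\<Sum>\<gamma>\<in>{\<gamma> \<in> {\<gamma>. length \<gamma> = Suc n}. ?P \<gamma>}. F \<gamma>)"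
    by (rule sum.inter_filter[OF finite_lists_length, symmetric])
  also have "\<dots> = (\<Sum>z\<in>UNIV. F (leg_upd n k \<alpha> (fst z) (snd z)))"
    by (rule sum.reindex_bij_witness[of _ "\<lambda>z. leg_upd n k \<alpha> (fst z) (snd z)" "\<lambda>\<gamma>. (\<gamma> ! k, \<gamma> ! 0)"])
       (use assms in \<open>auto simp: leg_upd_nth less_Suc_eq_le intro!: nth_equalityI arg_cong[of _ _ F]\<close>)
  finally show ?thesis by (simp add: sum_UNIV_pair)
qed

lemma Bk0_mult:
  fixes B :: "complex fps fps ^ ('n::finite \<times> 'n) ^ ('n \<times> 'n)"
  assumes k: "1 \<le> k" "k \<le> n"
  shows "mser_mult n (Bk0 n k u B) A \<alpha> \<beta> e =
      (\<Sum>x\<in>UNIV. \<Sum>y\<in>UNIV. \<Sum>m\<le>min (Poly_Mapping.lookup e k) (Poly_Mapping.lookup e 0).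
        scal (u ^ m * fps_nth (B $ (\<alpha> ! k, \<alpha> ! 0) $ (x, y)) m) * A (leg_upd n k \<alpha> x y) \<beta> (e - diag_exp k m))"
    and "mser_mult n A (Bk0 n k u B) \<alpha> \<beta> e =
      (\<Sum>x\<in>UNIV. \<Sum>y\<in>UNIV. \<Sum>m\<le>min (Poly_Mapping.lookup e k) (Poly_Mapping.lookup e 0).
        A \<alpha> (leg_upd n k \<beta> x y) (e - diag_exp k m) * scal (u ^ m * fps_nth (B $ (x, y) $ (\<beta> ! k, \<beta> ! 0)) m))"
proof -
  have k0: "k \<noteq> 0" using k by simp
  have l0: "Poly_Mapping.lookup (diag_exp k m) 0 = m" for m using k0 by (simp add: lookup_add lookup_single)
  have inner1: "(\<Sum>(d, d') | d + d' = e. Bk0 n k u B \<alpha> \<gamma> d * A \<gamma> \<beta> d') =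
      (if \<forall>i\<le>n. i \<noteq> 0 \<and> i \<noteq> k \<longrightarrow> \<alpha> ! i = \<gamma> ! i then
        (\<Sum>m\<le>min (Poly_Mapping.lookup e k) (Poly_Mapping.lookup e 0).
          scal (u ^ m * fps_nth (B $ (\<alpha> ! k, \<alpha> ! 0) $ (\<gamma> ! k, \<gamma> ! 0)) m) * A \<gamma> \<beta> (e - diag_exp k m)) else 0)" for \<gamma>
  proof (cases "\<forall>i\<le>n. i \<noteq> 0 \<and> i \<noteq> k \<longrightarrow> \<alpha> ! i = \<gamma> ! i")
    case True
    then have "\<forall>i\<le>n. i \<noteq> 0 \<and> i \<noteq> k \<longrightarrow> \<alpha> ! i = \<gamma> ! i" by (simp add: eq_commute)
    then show ?thesis
      unfolding if_P[OF True]
      by (subst sum_splittings_diag(1)[OF k0]; simp only: Bk0_def Let_def l0 if_True simp_thms) simp_all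
  next
    case False
    then have "\<not> (\<forall>i\<le>n. i \<noteq> 0 \<and> i \<noteq> k \<longrightarrow> \<alpha> ! i = \<gamma> ! i)" by (metis)
    then show ?thesis
      unfolding if_not_P[OF False] Bk0_def Let_def by (intro sum.neutral) auto
  qed
  show "mser_mult n (Bk0 n k u B) A \<alpha> \<beta> e =
      (\<Sum>x\<in>UNIV. \<Sum>y\<in>UNIV. \<Sum>m\<le>min (Poly_Mapping.lookup e k) (Poly_Mapping.lookup e 0).
        scal (u ^ m * fps_nth (B $ (\<alpha> ! k, \<alpha> ! 0) $ (x, y)) m) * A (leg_upd n k \<alpha> x y) \<beta> (e - diag_exp k m))"
    unfolding mser_mult_def inner1 sum_lists_leg[OF k] using k by (simp add: leg_upd_nth)
  have inner2: "(\<Sum>(d, d') | d + d' = e. A \<alpha> \<gamma> d * Bk0 n k u B \<gamma> \<beta> d') =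
      (if \<forall>i\<le>n. i \<noteq> 0 \<and> i \<noteq> k \<longrightarrow> \<beta> ! i = \<gamma> ! i then
        (\<Sum>m\<le>min (Poly_Mapping.lookup e k) (Poly_Mapping.lookup e 0).
          A \<alpha> \<gamma> (e - diag_exp k m) * scal (u ^ m * fps_nth (B $ (\<gamma> ! k, \<gamma> ! 0) $ (\<beta> ! k, \<beta> ! 0)) m)) else 0)" for \<gamma>
  proof (cases "\<forall>i\<le>n. i \<noteq> 0 \<and> i \<noteq> k \<longrightarrow> \<beta> ! i = \<gamma> ! i")
    case True
    then have "\<forall>i\<le>n. i \<noteq> 0 \<and> i \<noteq> k \<longrightarrow> \<gamma> ! i = \<beta> ! i" by (simp add: eq_commute)
    then show ?thesis
      unfolding if_P[OF True]
      by (subst sum_splittings_diag(2)[OF k0]; simp only: Bk0_def Let_def l0 if_True simp_thms) simp_all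
  next
    case False
    then have "\<not> (\<forall>i\<le>n. i \<noteq> 0 \<and> i \<noteq> k \<longrightarrow> \<gamma> ! i = \<beta> ! i)" by (metis)
    then show ?thesis
      unfolding if_not_P[OF False] Bk0_def Let_def by (intro sum.neutral) auto
  qed
  show "mser_mult n A (Bk0 n k u B) \<alpha> \<beta> e =
      (\<Sum>x\<in>UNIV. \<Sum>y\<in>UNIV. \<Sum>m\<le>min (Poly_Mapping.lookup e k) (Poly_Mapping.lookup e 0).
        A \<alpha> (leg_upd n k \<beta> x y) (e - diag_exp k m) * scal (u ^ m * fps_nth (B $ (x, y) $ (\<beta> ! k, \<beta> ! 0)) m))"
    unfolding mser_mult_def inner2 sum_lists_leg[OF k] using k by (simp add: leg_upd_nth)
qed

locale exchange_vec = exchange "sqm_of B" "sqm_of Bi" up um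
  for B Bi :: "complex fps fps ^ ('n::finite \<times> 'n) ^ ('n \<times> 'n)" and up um :: "complex fps"
begin

abbreviation "tp \<equiv> \<lambda>\<alpha> \<beta> e i. tplus (\<alpha> ! i) (\<beta> ! i) (int (Poly_Mapping.lookup e i)) :: 'n falg"

text \<open>The partially evaluated product: the operator series has passed the factors \<open>k, \<dots>, n\<close>.\<close>

definition partial_action :: "nat \<Rightarrow> nat \<Rightarrow> 'n mser" where
  "partial_action n k = (\<lambda>\<alpha> \<beta> e. if Poly_Mapping.keys e \<subseteq> {..n} then
     prod_list (map (tp \<alpha> \<beta> e) [1..<k]) *
     app (fps_nth (ent Tm (\<alpha> ! 0) (\<beta> ! 0)) (Poly_Mapping.lookup e 0)) (prod_list (map (tp \<alpha> \<beta> e) [k..<Suc n]))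
         else 0)"

text \<open>The exchange rule for the k-th letter: the two R-matrices on factors k and 0 bring T^-
  from the right of T_k^+ to its left. The letters before it form a prefix that only has to commute
  with scalars.\<close>

lemma partial_action_step:
  assumes k: "1 \<le> k" "k \<le> n"
  shows "mser_mult n (Bk0 n k up B) (mser_mult n (partial_action n (Suc k)) (Bk0 n k um Bi)) = partial_action n k"
proof (intro ext)
  fix \<alpha> \<beta> :: "'n list" and e :: "nat \<Rightarrow>\<^sub>0 nat"
  have k0: "k \<noteq> 0" using k by simp
  let ?s = "Poly_Mapping.lookup e k" and ?p = "Poly_Mapping.lookup e 0"
  have lk: "Poly_Mapping.lookup (e' - diag_exp k m) i = (if i = 0 \<or> i = k then Poly_Mapping.lookup e' i - m else
      Poly_Mapping.lookup e' i)" for m i e'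
    using k0 by (auto simp: lookup_minus_nat lookup_add lookup_single when_def)
  define pre where "pre = prod_list (map (tp \<alpha> \<beta> e) [1..<k])"
  define rest where "rest = prod_list (map (tp \<alpha> \<beta> e) [Suc k..<Suc n])"
  have H: "partial_action n (Suc k) (leg_upd n k \<alpha> x y) (leg_upd n k \<beta> x' y') (e - diag_exp k m - diag_exp k m') =
      (if Poly_Mapping.keys e \<subseteq> {..n} then
        pre * (tplus x x' (int (?s - m - m')) * app (fps_nth (ent Tm y y') (?p - m - m')) rest) else 0)"
    if m: "m \<le> min ?s ?p" "m' \<le> min (?s - m) (?p - m)" for x y x' y' m m'
  proof -
    let ?e = "e - diag_exp k m - diag_exp k m'" and ?a = "leg_upd n k \<alpha> x y" and ?b = "leg_upd n k \<beta> x' y'"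
    have keys: "Poly_Mapping.keys ?e \<subseteq> {..n} \<longleftrightarrow> Poly_Mapping.keys e \<subseteq> {..n}"
    proof -
      have "i \<in> Poly_Mapping.keys ?e \<longleftrightarrow> i \<in> Poly_Mapping.keys e" if "i > n" for i
        using that k by (simp add: in_keys_iff lk)
      then show ?thesis by (meson atMost_iff not_le subset_iff)
    qed
    have m1: "map (tp ?a ?b ?e) [1..<k] = map (tp \<alpha> \<beta> e) [1..<k]"
      and m2: "map (tp ?a ?b ?e) [Suc k..<Suc n] = map (tp \<alpha> \<beta> e) [Suc k..<Suc n]"
      using k by (auto simp: leg_upd_nth lk simp del: upt_Suc)
    have "map (tp ?a ?b ?e) [1..<Suc k] = map (tp ?a ?b ?e) [1..<k] @ [tplus x x' (int (?s - m - m'))]"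
      using k by (simp add: leg_upd_nth lk)
    then have m3: "map (tp ?a ?b ?e) [1..<Suc k] = map (tp \<alpha> \<beta> e) [1..<k] @ [tplus x x' (int (?s - m - m'))]"
      unfolding m1 .
    show ?thesis
      unfolding partial_action_def keys m3 m2 pre_def rest_def
      by (simp add: leg_upd_nth lk mult.assoc del: upt_Suc)
  qed
  have "mser_mult n (Bk0 n k up B) (mser_mult n (partial_action n (Suc k)) (Bk0 n k um Bi)) \<alpha> \<beta> e =
      (\<Sum>x\<in>UNIV. \<Sum>y\<in>UNIV. \<Sum>m\<le>min ?s ?p. scal (up ^ m * fps_nth (B $ (\<alpha> ! k, \<alpha> ! 0) $ (x, y)) m) *
        (\<Sum>x'\<in>UNIV. \<Sum>y'\<in>UNIV. \<Sum>m'\<le>min (?s - m) (?p - m).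
          partial_action n (Suc k) (leg_upd n k \<alpha> x y) (leg_upd n k \<beta> x' y') (e - diag_exp k m - diag_exp k m') *
          scal (um ^ m' * fps_nth (Bi $ (x', y') $ (\<beta> ! k, \<beta> ! 0)) m')))"
    using k0 by (simp add: Bk0_mult[OF k] lk)
  also have "\<dots> = (\<Sum>x\<in>UNIV. \<Sum>y\<in>UNIV. \<Sum>m\<le>min ?s ?p. scal (up ^ m * fps_nth (B $ (\<alpha> ! k, \<alpha> ! 0) $ (x, y)) m) *
        (\<Sum>x'\<in>UNIV. \<Sum>y'\<in>UNIV. \<Sum>m'\<le>min (?s - m) (?p - m).
          (if Poly_Mapping.keys e \<subseteq> {..n} then
            pre * (tplus x x' (int (?s - m - m')) * app (fps_nth (ent Tm y y') (?p - m - m')) rest) else 0) *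
          scal (um ^ m' * fps_nth (Bi $ (x', y') $ (\<beta> ! k, \<beta> ! 0)) m')))"
    by (intro sum.cong refl arg_cong2[of _ _ _ _ "(*)"] H) simp_all
  also have "\<dots> = partial_action n k \<alpha> \<beta> e"
  proof (cases "Poly_Mapping.keys e \<subseteq> {..n}")
    case True
    have pull: "scal c * (pre * z) = pre * (scal c * z)" for c z
      unfolding mult.assoc[symmetric] scal_central[of c pre] ..
    have "map (tp \<alpha> \<beta> e) [k..<Suc n] = tp \<alpha> \<beta> e k # map (tp \<alpha> \<beta> e) [Suc k..<Suc n]"
      using k by (simp add: upt_conv_Cons del: upt_Suc)
    then have "partial_action n k \<alpha> \<beta> e = pre * app (fps_nth (ent Tm (\<alpha> ! 0) (\<beta> ! 0)) ?p) (tplus (\<alpha> ! k) (\<beta> ! k)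
        (int ?s) * rest)"
      using True by (simp add: partial_action_def pre_def rest_def del: upt_Suc)
    also have "\<dots> = (\<Sum>x\<in>UNIV. \<Sum>y\<in>UNIV. \<Sum>m\<le>min ?s ?p. scal (up ^ m * fps_nth (B $ (\<alpha> ! k, \<alpha> ! 0) $ (x, y)) m) *
        (\<Sum>x'\<in>UNIV. \<Sum>y'\<in>UNIV. \<Sum>m'\<le>min (?s - m) (?p - m).
            pre * (tplus x x' (int (?s - m - m')) * app (fps_nth (ent Tm y y') (?p - m - m')) rest) *
          scal (um ^ m' * fps_nth (Bi $ (x', y') $ (\<beta> ! k, \<beta> ! 0)) m')))"
      unfolding app_Tm_tplus mult.assoc[of pre] sum_distrib_left[of pre, symmetric] pull by (simp add: mult.assoc)
    finally show ?thesis using True by simp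
  qed (simp add: partial_action_def)
  finally show "mser_mult n (Bk0 n k up B) (mser_mult n (partial_action n (Suc k)) (Bk0 n k um Bi)) \<alpha> \<beta> e =
      partial_action n k \<alpha> \<beta> e" .
qed

text \<open>The R-matrices are absorbed in pairs from the inside outwards, factor n first. Each pair
  moves T^- one letter to the left, from acting on 1 to acting on the whole product.\<close>

lemma mser_prod_action:
  assumes "length \<beta> = Suc n" "Poly_Mapping.keys e \<subseteq> {1..n}"
  shows "mser_prod n (map (\<lambda>k. Bk0 n k up B) [1..<Suc n] @ [Tplus_legs n] @ map (\<lambda>k. Bk0 n k um Bi) (rev [1..<Suc n]))
      \<alpha> \<beta> (Poly_Mapping.single 0 p + e) =
    app (fps_nth (ent Tm (\<alpha> ! 0) (\<beta> ! 0)) p) (Tplus_coeff n \<alpha> \<beta> e)"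
proof -
  let ?f = "foldr (mser_mult n)"
  \<comment> \<open>With no letter left T^- acts on 1, where it is the identity; this forces
    exponent 0 of 1/x and equal indices in factor 0.\<close>
  have top: "partial_action n (Suc n) = Tplus_legs n"
  proof (intro ext)
    fix \<alpha> \<beta> :: "'n list" and e :: "nat \<Rightarrow>\<^sub>0 nat"
    have "Poly_Mapping.keys e \<subseteq> {1..n} \<longleftrightarrow> Poly_Mapping.keys e \<subseteq> {..n} \<and> Poly_Mapping.lookup e 0 = 0"
      by (auto simp: subset_iff in_keys_iff Suc_le_eq) (metis neq0_conv)
    then show "partial_action n (Suc n) \<alpha> \<beta> e = Tplus_legs n \<alpha> \<beta> e"
      by (simp add: partial_action_def Tplus_legs_def Tplus_coeff_def app_Tm_one del: upt_Suc)
  qed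
  have chain: "?f (map (\<lambda>k. Bk0 n k up B) [1..<Suc k])
      (mser_mult n (partial_action n (Suc k)) (?f (map (\<lambda>k. Bk0 n k um Bi) (rev [1..<Suc k])) mser_one)) =
      mser_mult n (partial_action n 1) mser_one" if "k \<le> n" for k
    using that
  proof (induction k)
    case (Suc k)
    have "mser_mult n (Bk0 n (Suc k) up B) (mser_mult n (partial_action n (Suc (Suc k))) (mser_mult n (Bk0 n
        (Suc k) um Bi) Z)) =
        mser_mult n (partial_action n (Suc k)) Z" for Z
      using partial_action_step[of "Suc k" n] Suc.prems by (simp add: mser_mult_assoc[symmetric])
    then show ?case using Suc by simp
  qed simp
  have "mser_prod n (map (\<lambda>k. Bk0 n k up B) [1..<Suc n] @ [Tplus_legs n] @ map (\<lambda>k. Bk0 n k um Bi) (rev [1..<Suc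
      n])) =
      mser_mult n (partial_action n 1) mser_one"
    using chain[of n] by (simp add: mser_prod_def top del: upt_Suc)
  then have "mser_prod n (map (\<lambda>k. Bk0 n k up B) [1..<Suc n] @ [Tplus_legs n] @ map (\<lambda>k. Bk0 n k um Bi) (rev
      [1..<Suc n]))
      \<alpha> \<beta> (Poly_Mapping.single 0 p + e) = partial_action n 1 \<alpha> \<beta> (Poly_Mapping.single 0 p + e)"
    by (simp add: mser_mult_one[OF assms(1)])
  also have "\<dots> = app (fps_nth (ent Tm (\<alpha> ! 0) (\<beta> ! 0)) p) (Tplus_coeff n \<alpha> \<beta> e)"
  proof -
    have e0: "Poly_Mapping.lookup e 0 = 0" using assms(2) by (auto simp: in_keys_iff subset_iff)
    have keys: "Poly_Mapping.keys (Poly_Mapping.single 0 p + e) \<subseteq> {..n}"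
      using assms(2) by (auto simp: in_keys_iff lookup_add lookup_single when_def subset_iff split: if_splits)
    have mm: "map (tp \<alpha> \<beta> (Poly_Mapping.single 0 p + e)) [1..<Suc n] = map (tp \<alpha> \<beta> e) [1..<Suc n]"
      by (auto simp: lookup_add lookup_single when_def simp del: upt_Suc)
    show ?thesis
      unfolding partial_action_def mm Tplus_coeff_def using keys by (simp add: lookup_add e0 del: upt_Suc)
  qed
  finally show ?thesis .
qed

end

section \<open>Uniqueness\<close>

lemma wd_prod_list: "prod_list (map (\<lambda>w. wd [w]) ws) = wd ws"
proof (induction ws)
  case (Cons w ws)
  then show ?case using wd_append[of "[w]" ws] by simp
qed simp

text \<open>The source of uniqueness: the letters prescribe an entry and a monomial in which T_[n]^+
  has exactly this word as coefficient. Positions are shifted by one because position 0 belongs to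
  T^- and x.\<close>

lemma Tplus_coeff_word:
  fixes ws :: "('n \<times> 'n \<times> nat) list"
  shows "\<exists>e. Poly_Mapping.keys e \<subseteq> {1..length ws} \<and>
    (\<forall>i j. Tplus_coeff (length ws) (i # map fst ws) (j # map (\<lambda>w. fst (snd w)) ws) e = wd ws)"
proof (intro exI conjI allI)
  define e :: "nat \<Rightarrow>\<^sub>0 nat" where "e = (\<Sum>k<length ws. Poly_Mapping.single (Suc k) (snd (snd (ws ! k))))"
  have lk: "Poly_Mapping.lookup e i = (\<Sum>k<length ws. if Suc k = i then snd (snd (ws ! k)) else 0)" for i
    by (simp add: e_def lookup_sum lookup_single when_def)
  have lk1: "Poly_Mapping.lookup e (Suc k) = snd (snd (ws ! k))" if "k < length ws" for k
    using that by (simp add: lk)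
  show "Poly_Mapping.keys e \<subseteq> {1..length ws}"
    by (auto simp: in_keys_iff lk) (metis (mono_tags, lifting) Suc_leI Suc_le_mono lessThan_iff not_less_eq_eq
        sum.neutral zero_less_Suc)+
  fix i j
  have "map (\<lambda>k. tplus ((i # map fst ws) ! k) ((j # map (\<lambda>w. fst (snd w)) ws) ! k) (int (Poly_Mapping.lookup e
      k))) [1..<Suc (length ws)] =
      map (\<lambda>w. wd [w]) ws"
    by (rule nth_equalityI) (auto simp: lk1 tplus_wd simp del: upt_Suc)
  then show "Tplus_coeff (length ws) (i # map fst ws) (j # map (\<lambda>w. fst (snd w)) ws) e = wd ws"
    unfolding Tplus_coeff_def by (simp only: wd_prod_list)
qed

text \<open>Linearity over \<open>\<complex>[[h]]\<close> and closedness of J make the set where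
  \<open>T\<close> and \<open>T'\<close> agree a closed submodule of F. The action formula puts
  every nonempty word into it, the unit condition the empty one.\<close>

lemma is_Tminus_unique:
  fixes B :: "complex fps fps ^ ('n::finite \<times> 'n) ^ ('n \<times> 'n)"
  assumes T: "is_Tminus B w T" and T': "is_Tminus B w T'"
  shows "T = T'"
proof (intro ext)
  fix i j V p
  have hom: "T i j \<in> xinv_hom (Y_RTT B)" "T' i j \<in> xinv_hom (Y_RTT B)"
    using T T' by (auto simp: is_Tminus_def op_series_def)
  show "T i j V p = T' i j V p"
  proof (cases "V \<in> carrier (Y_RTT B)")
    case False
    then show ?thesis using hom by (simp add: xinv_hom_def PiE_def extensional_def)
  next
    case True
    then obtain v where V: "V = rtt_class B v" by (rule class_surj)
    define N where "N = {v. T i j (rtt_class B v) p = T' i j (rtt_class B v) p}"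
    have car: "S (rtt_class B u) p \<in> carrier (Y_RTT B)" if "S \<in> xinv_hom (Y_RTT B)" for S u
    proof -
      have "S (rtt_class B u) \<in> xinv_series (Y_RTT B)"
        using that class_in_Y[of B u] by (auto simp: xinv_hom_def PiE_iff)
      then show ?thesis by (simp add: xinv_series_def)
    qed
    have add: "S (rtt_class B (u + v)) p = S (rtt_class B u) p \<oplus>\<^bsub>Y_RTT B\<^esub> S (rtt_class B v) p"
      and scal: "S (rtt_class B (scal s * v)) p = s \<odot>\<^bsub>Y_RTT B\<^esub> S (rtt_class B v) p"
      if "S \<in> xinv_hom (Y_RTT B)" for S u v s
      using that unfolding xinv_hom_def by (simp_all flip: Y_add Y_smult)
    have "closed_submodule N"
      unfolding closed_submodule_def
    proof (intro conjI ballI allI)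
      show "u + v \<in> N" if "u \<in> N" "v \<in> N" for u v
        using that by (simp add: N_def add[OF hom(1)] add[OF hom(2)])
      show "scal s * v \<in> N" if "v \<in> N" for s v
        using that by (simp add: N_def scal[OF hom(1)] scal[OF hom(2)])
      show "0 \<in> N"
        using scal[OF hom(1), of 0 0] scal[OF hom(2), of 0 0] car[OF hom(1), of 0] car[OF hom(2), of 0]
        by (auto simp: N_def Y_smult elim!: class_surj)
      show "closed N"
      proof (rule closed_h_adicI)
        fix v assume v: "\<And>k. \<exists>u\<in>N. \<exists>w. v = u + fps_X ^ k * w"
        obtain a a' where a: "T i j (rtt_class B v) p = rtt_class B a" "T' i j (rtt_class B v) p = rtt_class B a'"
          using car[OF hom(1), of v] car[OF hom(2), of v] by (auto elim!: class_surj)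
        \<comment> \<open>Agreement at \<open>u\<close> and linearity place the difference in J +
          h^k F for each k.\<close>
        have "a - a' \<in> rtt_ideal B"
        proof (rule closed_h_adic[OF rtt_ideal_closed])
          fix k
          obtain u z where u: "u \<in> N" "v = u + scal (fps_X ^ k) * z" using v[of k] by (auto simp: scal_power)
          obtain b c c' where b: "T i j (rtt_class B u) p = rtt_class B b" "T i j (rtt_class B z) p = rtt_class B c"
            "T' i j (rtt_class B z) p = rtt_class B c'"
            using car[OF hom(1), of u] car[OF hom(1), of z] car[OF hom(2), of z] by (auto elim!: class_surj)
          have b': "T' i j (rtt_class B u) p = rtt_class B b" using u(1) b by (simp add: N_def)
          have "rtt_class B a = rtt_class B (b + scal (fps_X ^ k) * c)"
            using a(1) unfolding u(2) add[OF hom(1)] scal[OF hom(1)] b Y_smult Y_add by simp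
          moreover have "rtt_class B a' = rtt_class B (b + scal (fps_X ^ k) * c')"
            using a(2) unfolding u(2) add[OF hom(2)] scal[OF hom(2)] b b' Y_smult Y_add by simp
          ultimately have "(a - (b + scal (fps_X ^ k) * c)) - (a' - (b + scal (fps_X ^ k) * c')) \<in> rtt_ideal B"
            unfolding rtt_class_eq_iff by (rule rtt_ideal_diff)
          moreover have "a - a' = ((a - (b + scal (fps_X ^ k) * c)) - (a' - (b + scal (fps_X ^ k) * c'))) +
              fps_X ^ k * (c - c')"
            by (simp add: scal_power algebra_simps)
          ultimately show "\<exists>u\<in>rtt_ideal B. \<exists>w. a - a' = u + fps_X ^ k * w" by blast
        qed
        then show "v \<in> N" by (simp add: N_def a rtt_class_eq_iff)
      qed
    qed
    moreover have "app 1 (wd ws) \<in> N" for ws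
    proof (cases "ws = []")
      case True
      then show ?thesis using T T' by (simp add: N_def is_Tminus_def Tminus_unit_def Y_one)
    next
      case False
      obtain e where e: "Poly_Mapping.keys e \<subseteq> {1..length ws}"
        "\<forall>i j. Tplus_coeff (length ws) (i # map fst ws) (j # map (\<lambda>w. fst (snd w)) ws) e = wd ws"
        using Tplus_coeff_word[of ws] by blast
      let ?a = "i # map fst ws" and ?b = "j # map (\<lambda>w. fst (snd w)) ws"
      have len: "1 \<le> length ws" using False by (cases ws) auto
      have act: "S i j (rtt_class B (wd ws)) p = rtt_class B (mser_prod (length ws)
          (map (\<lambda>k. Bk0 (length ws) k (fps_exp w) B) [1..<Suc (length ws)] @ [Tplus_legs (length ws)] @
            map (\<lambda>k. Bk0 (length ws) k (fps_exp (- w)) (matrix_inv B)) (rev [1..<Suc (length ws)])) ?a ?b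
                (Poly_Mapping.single 0 p + e))"
        if "is_Tminus B w S" for S
        using that len e(1) unfolding is_Tminus_def Tminus_action_def
        by (elim conjE allE[of _ "length ws"] impE allE[of _ ?a] allE[of _ ?b] allE[of _ p] allE[of _ e])
            (simp_all add: e(2) del: upt_Suc)
      show ?thesis unfolding N_def using act[OF T] act[OF T'] by (simp only: endo_one mem_Collect_eq)
    qed
    ultimately have "app 1 v \<in> N" by (rule endo_words_in)
    then show ?thesis by (simp add: N_def V)
  qed
qed

section \<open>The identities in the quotient\<close>

lemma sum_rotate: "(\<Sum>m\<in>M. \<Sum>a\<in>A. \<Sum>b\<in>C. f m a b) = (\<Sum>b\<in>C. \<Sum>a\<in>A. \<Sum>m\<in>M. f m a b)"
  by (subst sum.swap, subst (2) sum.swap, subst sum.swap, intro sum.cong refl)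

lemma sum_rotate': "(\<Sum>m\<in>M. \<Sum>a\<in>A. \<Sum>b\<in>C. f m a b) = (\<Sum>a\<in>A. \<Sum>b\<in>C. \<Sum>m\<in>M. f m a b)"
  by (subst sum.swap, intro sum.cong refl) (rule sum.swap)

context exchange_vec
begin

lemma op_coeff_class:
  assumes "preserves_ideal B' Tm"
  shows "op_coeff (Y_RTT B') (op_of B' Tm) i j r (rtt_class B' v) = rtt_class B' (app (coeff_int i j r) v)"
  using assms by (simp add: op_coeff_def coeff_int_def op_of_class Y_zero)

text \<open>In the stated identity B acts as B_21, which interchanges the two summation indices; the
  sums are therefore in the order y, x.\<close>

lemma Tm_Tplus_app:
  "(\<Sum>m\<le>min p q. \<Sum>y\<in>UNIV. \<Sum>x\<in>UNIV. scal (um ^ m * fps_nth (B $ (x, y) $ (l, j)) m) *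
      app (coeff_int i y (int p - int m)) (tplus k x (int q - int m) * v)) =
   (\<Sum>m\<le>min p q. \<Sum>y\<in>UNIV. \<Sum>x\<in>UNIV. scal (up ^ m * fps_nth (B $ (k, i) $ (x, y)) m) *
      (tplus x l (int q - int m) * app (coeff_int y j (int p - int m)) v))"
proof -
  have c: "coeff_int a b (int p - int m) = fps_nth (ent Tm a b) (p - m)" "int q - int m = int (q - m)"
    if "m \<in> {..min q p}" for a b m
    using that by (auto simp: coeff_int_def nat_diff_distrib of_nat_diff)
  have s: "a * (scal c * z) = scal c * (a * z)" for a z :: "'n falg" and c
    by (metis mult.assoc scal_central)
  have "(\<Sum>x\<in>UNIV. \<Sum>y\<in>UNIV. \<Sum>m\<le>min q p. scal (um ^ m * fps_nth (B $ (x, y) $ (l, j)) m) *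
      app (fps_nth (ent Tm i y) (p - m)) (tplus k x (int (q - m)) * v)) =
    (\<Sum>x\<in>UNIV. \<Sum>y\<in>UNIV. \<Sum>m\<le>min q p. scal (up ^ m * fps_nth (B $ (k, i) $ (x, y)) m) *
      (tplus x l (int (q - m)) * app (fps_nth (ent Tm y j) (p - m)) v))"
    using arg_cong[OF Tm_Tplus_coeff[where s = q and p = p and i = i and k = k and l = l and j = j], of "\<lambda>e. app
        e v"] by (simp add: endo_sum s)
  moreover have "(\<Sum>x\<in>UNIV. \<Sum>y\<in>UNIV. \<Sum>m\<le>min q p. scal (um ^ m * fps_nth (B $ (x, y) $ (l, j)) m) *
      app (coeff_int i y (int p - int m)) (tplus k x (int q - int m) * v)) =
    (\<Sum>x\<in>UNIV. \<Sum>y\<in>UNIV. \<Sum>m\<le>min q p. scal (um ^ m * fps_nth (B $ (x, y) $ (l, j)) m) *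
      app (fps_nth (ent Tm i y) (p - m)) (tplus k x (int (q - m)) * v))"
    by (intro sum.cong refl) (simp only: c)
  moreover have "(\<Sum>x\<in>UNIV. \<Sum>y\<in>UNIV. \<Sum>m\<le>min q p. scal (up ^ m * fps_nth (B $ (k, i) $ (x, y)) m) *
      (tplus x l (int q - int m) * app (coeff_int y j (int p - int m)) v)) =
    (\<Sum>x\<in>UNIV. \<Sum>y\<in>UNIV. \<Sum>m\<le>min q p. scal (up ^ m * fps_nth (B $ (k, i) $ (x, y)) m) *
      (tplus x l (int (q - m)) * app (fps_nth (ent Tm y j) (p - m)) v))"
    by (intro sum.cong refl) (simp only: c)
  ultimately have "(\<Sum>x\<in>UNIV. \<Sum>y\<in>UNIV. \<Sum>m\<le>min p q. scal (um ^ m * fps_nth (B $ (x, y) $ (l, j)) m) *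
      app (coeff_int i y (int p - int m)) (tplus k x (int q - int m) * v)) =
    (\<Sum>x\<in>UNIV. \<Sum>y\<in>UNIV. \<Sum>m\<le>min p q. scal (up ^ m * fps_nth (B $ (k, i) $ (x, y)) m) *
      (tplus x l (int q - int m) * app (coeff_int y j (int p - int m)) v))"
    unfolding min.commute[of p q] by simp
  then show ?thesis by (rule trans[OF sum_rotate trans[OF _ sum_rotate[symmetric]]])
qed

lemma Tm_RTT_app:
  assumes "yang_baxter (sqm_of B) (sqm_of B)"
  shows "(\<Sum>m\<le>q. \<Sum>x\<in>UNIV. \<Sum>y\<in>UNIV. scal (fps_nth (B $ (i, k) $ (x, y)) m) *
      app (coeff_int x j (int m - p)) (app (coeff_int y l (int q - int m)) v)) =
    (\<Sum>m\<le>q. \<Sum>x\<in>UNIV. \<Sum>y\<in>UNIV. scal (fps_nth (B $ (x, y) $ (j, l)) m) *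
      app (coeff_int k y (int q - int m)) (app (coeff_int i x (int m - p)) v))"
proof (rule trans[OF sum_rotate' trans[OF _ sum_rotate'[symmetric]]])
  show "(\<Sum>x\<in>UNIV. \<Sum>y\<in>UNIV. \<Sum>m\<le>q. scal (fps_nth (B $ (i, k) $ (x, y)) m) *
      app (coeff_int x j (int m - p)) (app (coeff_int y l (int q - int m)) v)) =
    (\<Sum>x\<in>UNIV. \<Sum>y\<in>UNIV. \<Sum>m\<le>q. scal (fps_nth (B $ (x, y) $ (j, l)) m) *
      app (coeff_int k y (int q - int m)) (app (coeff_int i x (int m - p)) v))"
    using arg_cong[OF Tm_RTT_coeff[OF assms, where q = q and i = i and k = k and j = j and p = p and l = l], of
        "\<lambda>e. app e v"] by (simp add: endo_sum)
qed

end

theorem proposition5p5: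
  fixes R :: "complex fps ^ ('n::finite \<times> 'n) ^ ('n \<times> 'n)" and M :: nat and a c :: complex
  assumes "CARD('n) \<ge> 2" and "M > 0" and "a \<noteq> 0"
    and "hecke_symmetry R" and "skew_invertible R"
  shows "(\<exists>!T. is_Tminus (Rbar M R) (c / a) T) \<and>
    (\<forall>T. is_Tminus (Rbar M R) (c / a) T \<longrightarrow>
       op_invertible (Y_RTT (Rbar M R)) T \<and>
       Tminus_RTT (Rbar M R) T \<and>
       Tminus_Tplus (Rbar M R) (c / a) T)"
proof -
  define B where "B = Rbar M R"
  define w where "w = c / a"
  note ex = Rbar_exchange[OF assms(2,4,5), folded B_def]
  obtain Q where Q: "exchange Q (ptrans (sqm_of B))" "yang_baxter (sqm_of B) Q" using ex(3) by blast
  interpret T: exchange_vec B "matrix_inv B" "fps_exp w" "fps_exp (- w)"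
    unfolding exchange_vec_def by (rule ex(2))
  interpret S: exchange Q "ptrans (sqm_of B)" "fps_exp w" "fps_exp (- w)" by (rule Q(1))
  let ?Y = "Y_RTT B"
  define T where "T = op_of B T.Tm"
  define S where "S = sqm_transpose S.Tm"
  have pT: "preserves_ideal B T.Tm" by (rule T.Tm_preserves_ideal[OF ex(1)])
  have pS: "preserves_ideal B S"
    using S.Tm_preserves_ideal[OF Q(2)] by (simp add: preserves_ideal_def S_def)
  have lS: "locally_finite S"
    using S.Tm_locally_finite by (simp add: locally_finite_def S_def) metis
  have Tcl: "T i j (rtt_class B v) p = rtt_class B (app (fps_nth (ent T.Tm i j) p) v)" for i j v p
    unfolding T_def by (rule op_of_class[OF pT])
  have "is_Tminus B w T"
    unfolding is_Tminus_def
  proof (intro conjI)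
    show "T \<in> op_series ?Y" unfolding T_def by (rule op_of_series[OF pT T.Tm_locally_finite])
    show "Tminus_unit B T" by (simp add: Tminus_unit_def Y_one Y_zero Tcl T.app_Tm_one)
    show "Tminus_action B w T"
      unfolding Tminus_action_def Tcl
      by (intro allI impI arg_cong[of _ _ "rtt_class B"] T.mser_prod_action[symmetric]) simp_all
  qed
  moreover have "T' = T" if "is_Tminus B w T'" for T'
    by (rule is_Tminus_unique[OF that \<open>is_Tminus B w T\<close>])
  moreover have "op_invertible ?Y T"
    unfolding op_invertible_def
  proof (intro bexI conjI)
    note inv = exchange_inverse[OF ex(2) Q(1), of "fps_exp w" "fps_exp (- w)", folded S_def]
    show "op_of B S \<in> op_series ?Y" by (rule op_of_series[OF pS lS])
    show "op_mult ?Y (op_of B S) T = op_one ?Y" unfolding T_def by (rule op_mult_op_of[OF pS pT inv(1)])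
    show "op_mult ?Y T (op_of B S) = op_one ?Y" unfolding T_def by (rule op_mult_op_of[OF pT pS inv(2)])
  qed
  moreover have "Tminus_RTT B T"
    unfolding Tminus_RTT_def Let_def
  proof (intro ballI allI)
    fix V i k j l and p :: int and q :: nat
    assume "V \<in> carrier ?Y"
    then obtain v where V: "V = rtt_class B v" by (rule class_surj)
    show "(\<Oplus>\<^bsub>?Y\<^esub>m\<in>{..q}. \<Oplus>\<^bsub>?Y\<^esub>a\<in>UNIV. \<Oplus>\<^bsub>?Y\<^esub>b\<in>UNIV. fps_nth (B $ (i, k) $ (a, b)) m \<odot>\<^bsub>?Y\<^esub>
          op_coeff ?Y T a j (int m - p) (op_coeff ?Y T b l (int q - int m) V)) =
       (\<Oplus>\<^bsub>?Y\<^esub>m\<in>{..q}. \<Oplus>\<^bsub>?Y\<^esub>a\<in>UNIV. \<Oplus>\<^bsub>?Y\<^esub>b\<in>UNIV. fps_nth (B $ (a, b) $ (j, l)) m \<odot>\<^bsub>?Y\<^esub>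
          op_coeff ?Y T k b (int q - int m) (op_coeff ?Y T i a (int m - p) V))"
      unfolding V T_def T.op_coeff_class[OF pT] Y_smult
      by (simp add: Y_finsum T.Tm_RTT_app[OF ex(1)])
  qed
  moreover have "Tminus_Tplus B w T"
    unfolding Tminus_Tplus_def Let_def
  proof (intro ballI allI)
    fix V i k j l and p q :: nat
    assume "V \<in> carrier ?Y"
    then obtain v where V: "V = rtt_class B v" by (rule class_surj)
    show "(\<Oplus>\<^bsub>?Y\<^esub>m\<in>{..min p q}. \<Oplus>\<^bsub>?Y\<^esub>a\<in>UNIV. \<Oplus>\<^bsub>?Y\<^esub>b\<in>UNIV.
          (fps_exp (- w) ^ m * fps_nth (B $ (b, a) $ (l, j)) m) \<odot>\<^bsub>?Y\<^esub>
          op_coeff ?Y T i a (int p - int m) (rtt_class B (tplus k b (int q - int m)) \<otimes>\<^bsub>?Y\<^esub> V)) =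
       (\<Oplus>\<^bsub>?Y\<^esub>m\<in>{..min p q}. \<Oplus>\<^bsub>?Y\<^esub>a\<in>UNIV. \<Oplus>\<^bsub>?Y\<^esub>b\<in>UNIV.
          (fps_exp w ^ m * fps_nth (B $ (k, i) $ (b, a)) m) \<odot>\<^bsub>?Y\<^esub>
          (rtt_class B (tplus b l (int q - int m)) \<otimes>\<^bsub>?Y\<^esub> op_coeff ?Y T a j (int p - int m) V))"
      unfolding V Y_mult T_def T.op_coeff_class[OF pT] Y_smult
      by (simp add: Y_finsum T.Tm_Tplus_app)
  qed
  ultimately show ?thesis
    unfolding B_def[symmetric] w_def[symmetric] by blast
qed

end
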